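(* Let $X$ be a connected finite simplicial complex of dimension at most $2$, and let $G\subset C(X)$ be a finite set which generates $C(X)$. For any $\varepsilon>0$ there is an $\eta>0$ such that the following statement is true. Let $k\ge1$, $l_1\ge 1$, $l_2\ge 3$, $r\ge 0$ be integers and suppose that $\phi: C(X)\to M_{l_1l_2+r}(I_k)$ is a unital homomorphism satisfying the following condition: there are $l_1$ continuous maps $a_1,a_2,\dots,a_{l_1}:[0,1]\to X$ such that for every $y\in[0,1]$, $Sp\phi_y$ (where $\phi$ is considered as a homomorphism from $C(X)$ to $M_{(l_1l_2+r)k}(C[0,1])$) and $\Theta(y)$ can be paired within $\eta$, where $$\Theta(y)=\{a_1(y)^{\sim l_2k},a_2(y)^{\sim l_2k},\dots,a_{l_1-1}(y)^{\sim l_2k},a_{l_1}(y)^{\sim(l_2+r)k}\}.$$ Then there are $l_1$ mutually orthogonal projections $p_1,p_2,\dots,p_{l_1}\in M_{l_1l_2+r}(I_k)$ such that: (i) for all $g\in G$ and $y\in[0,1]$, $$\Big\|\phi(g)(y)-\Big(p_0(y)\phi(g)(y)p_0(y)\oplus\sum_{i=1}^{l_1}g(a_i(y))p_i(y)\Big)\Big\|<\varepsilon,$$ where $p_0=\mathbf 1-\sum_{i=1}^{l_1}p_i$; (ii) $\mathrm{rank}(p_i)=(l_2-3)k$ for $1\le i<l_1$, $\mathrm{rank}(p_{l_1})=(l_2+r-3)k$ and $\mathrm{rank}(p_0)=3l_1k$, as projections in $M_{(l_1l_2+r)k}(C[0,1])$.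
   Context: $I_k=\{f\in M_k(C[0,1]): f(0)\in\mathbb C\cdot\mathbf 1_k,\ f(1)\in\mathbb C\cdot\mathbf 1_k\}$, so $M_n(I_k)\subset M_{nk}(C[0,1])$. Homomorphisms are $*$-homomorphisms. $X$ carries its standard metric: each simplex is identified, preserving the affine structure, with a Euclidean simplex with all edges of length $1$, and the distance between two points is the length of a shortest path. For a unital homomorphism $\phi:C(X)\to M_N(C[0,1])$ and $y\in[0,1]$, there are mutually orthogonal rank one projections $q_1,\dots,q_N$ with sum $\mathbf 1_N$ and points $x_1,\dots,x_N\in X$ with $\phi(f)(y)=\sum_j f(x_j)q_j$ for all $f\in C(X)$; $Sp\phi_y=\{x_1,\dots,x_N\}$ counting multiplicity. The notation $a^{\sim m}$ means $a$ repeated $m$ times. Two families $\{x_1,\dots,x_N\}$ and $\{x_1',\dots,x_N'\}$ of points of $X$ (with repetition) can be paired within $\eta$ if there is a permutation $\sigma$ with $\mathrm{dist}(x_j,x'_{\sigma(j)})<\eta$ for all $j$. *)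

theory Defs
  imports
    "HOL-Analysis.Analysis"
    "Jordan_Normal_Form.Schur_Decomposition"
    "Jordan_Normal_Form.DL_Rank"
begin

section \<open>The standard metric of a finite simplicial complex\<close>

text \<open>
  A finite simplicial complex \<open>K\<close> is one in the sense of \<^const>\<open>simplicial_complex\<close>
  (a finite family of simplices of a Euclidean space), with underlying space \<open>X = \<Union>K\<close>.
  The metric of the ambient space is used only for its topology.
\<close>

definition complex_vertices :: "'a::euclidean_space set set \<Rightarrow> 'a set" where
  "complex_vertices K = {v. {v} \<in> K}"

definition barycentric :: "'a::euclidean_space set set \<Rightarrow> 'a \<Rightarrow> 'a \<Rightarrow> real" where
  "barycentric K x = (THE u.
     (\<forall>v. 0 \<le> u v) \<and>
     {v. u v \<noteq> 0} \<subseteq> complex_vertices K \<and>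
     convex hull {v. u v \<noteq> 0} \<in> K \<and>
     (\<Sum>v\<in>complex_vertices K. u v) = 1 \<and>
     (\<Sum>v\<in>complex_vertices K. u v *\<^sub>R v) = x)"

text \<open>
  Barycentric coordinates embed \<open>X\<close> in \<open>\<real>\<^sup>V\<close>, where \<open>V\<close> is the set of vertices, affinely on
  each simplex.  Two distinct unit vectors of \<open>\<real>\<^sup>V\<close> have distance \<open>sqrt 2\<close>, so after division by
  \<open>sqrt 2\<close> every simplex is carried to a Euclidean simplex all of whose edges have length 1.
\<close>

definition chord :: "'a::euclidean_space set set \<Rightarrow> 'a \<Rightarrow> 'a \<Rightarrow> real" where
  "chord K x x' =
     L2_set (\<lambda>v. barycentric K x v - barycentric K x' v) (complex_vertices K) / sqrt 2"

definition path_length :: "'a::euclidean_space set set \<Rightarrow> (real \<Rightarrow> 'a) \<Rightarrow> ennreal" where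
  "path_length K \<gamma> =
     (SUP ts \<in> {ts. sorted ts \<and> set ts \<subseteq> {0..1}}.
        \<Sum>i<length ts - 1. ennreal (chord K (\<gamma> (ts ! i)) (\<gamma> (ts ! Suc i))))"

text \<open>
  The infimum is the length of a shortest path.  It is \<open>\<infinity>\<close> exactly for points in different
  components, hence finite when \<open>X\<close> is connected.
\<close>

definition std_dist :: "'a::euclidean_space set set \<Rightarrow> 'a \<Rightarrow> 'a \<Rightarrow> ennreal" where
  "std_dist K x x' =
     (INF \<gamma> \<in> {\<gamma>. path \<gamma> \<and> path_image \<gamma> \<subseteq> \<Union>K \<and> pathstart \<gamma> = x \<and> pathfinish \<gamma> = x'}.
        path_length K \<gamma>)"

text \<open>Families with repetition are lists.\<close>

definition paired_within ::
    "'a::euclidean_space set set \<Rightarrow> real \<Rightarrow> 'a list \<Rightarrow> 'a list \<Rightarrow> bool" where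
  "paired_within K \<eta> xs xs' \<longleftrightarrow>
     length xs = length xs' \<and>
     (\<exists>\<sigma>. \<sigma> permutes {..<length xs} \<and>
          (\<forall>j<length xs. std_dist K (xs ! j) (xs' ! \<sigma> j) < ennreal \<eta>))"

section \<open>The algebra \<open>C(X)\<close>\<close>

text \<open>
  An element of \<open>C(X)\<close> is represented by a total function that is continuous on \<open>X\<close>; two such
  functions represent the same element iff they agree on \<open>X\<close>.
\<close>

definition cont_alg :: "'a::topological_space set \<Rightarrow> ('a \<Rightarrow> complex) set" where
  "cont_alg X = {f. continuous_on X f}"

inductive_set star_algebra :: "('a \<Rightarrow> complex) set \<Rightarrow> ('a \<Rightarrow> complex) set"
  for G :: "('a \<Rightarrow> complex) set" where
  gen: "g \<in> G \<Longrightarrow> g \<in> star_algebra G"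
| const: "(\<lambda>x. c) \<in> star_algebra G"
| add: "f \<in> star_algebra G \<Longrightarrow> g \<in> star_algebra G \<Longrightarrow> (\<lambda>x. f x + g x) \<in> star_algebra G"
| mult: "f \<in> star_algebra G \<Longrightarrow> g \<in> star_algebra G \<Longrightarrow> (\<lambda>x. f x * g x) \<in> star_algebra G"
| star: "f \<in> star_algebra G \<Longrightarrow> (\<lambda>x. cnj (f x)) \<in> star_algebra G"

text \<open>
  Generation is as a unital C*-algebra: the *-algebra generated by \<open>G\<close> and the constants is
  dense in \<open>C(X)\<close> for the supremum norm.
\<close>

definition generates_cont_alg :: "'a::topological_space set \<Rightarrow> ('a \<Rightarrow> complex) set \<Rightarrow> bool" where
  "generates_cont_alg X G \<longleftrightarrow>
     G \<subseteq> cont_alg X \<and>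
     (\<forall>f\<in>cont_alg X. \<forall>e>0. \<exists>h\<in>star_algebra G. \<forall>x\<in>X. cmod (f x - h x) < e)"

section \<open>Complex matrices and matrix-valued functions on the unit interval\<close>

definition vec_l2norm :: "complex Matrix.vec \<Rightarrow> real" where
  "vec_l2norm v = L2_set (\<lambda>i. cmod (vec_index v i)) {..<dim_vec v}"

definition op_norm :: "complex Matrix.mat \<Rightarrow> real" where
  "op_norm A =
     (SUP v \<in> {v \<in> carrier_vec (dim_col A). vec_l2norm v \<le> 1}. vec_l2norm (A *\<^sub>v v))"

text \<open>The type of matrices of all sizes has no zero, so finite sums need the size explicitly.\<close>

definition msum :: "nat \<Rightarrow> ('i \<Rightarrow> complex Matrix.mat) \<Rightarrow> 'i set \<Rightarrow> complex Matrix.mat" where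
  "msum N A J = Matrix.mat N N (\<lambda>(r, s). \<Sum>j\<in>J. A j $$ (r, s))"

definition projection_mat :: "nat \<Rightarrow> complex Matrix.mat \<Rightarrow> bool" where
  "projection_mat N P \<longleftrightarrow> P \<in> carrier_mat N N \<and> P * P = P \<and> mat_adjoint P = P"

text \<open>
  \<open>M\<^sub>N(C[0,1])\<close>.  Only the values of a function on \<open>{0..1}\<close> matter.
\<close>

definition interval_mats :: "nat \<Rightarrow> (real \<Rightarrow> complex Matrix.mat) set" where
  "interval_mats N =
     {F. (\<forall>t\<in>{0..1}. F t \<in> carrier_mat N N) \<and>
         (\<forall>r<N. \<forall>s<N. continuous_on {0..1} (\<lambda>t. F t $$ (r, s)))}"

definition dim_drop_alg :: "nat \<Rightarrow> (real \<Rightarrow> complex Matrix.mat) set" where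
  "dim_drop_alg k =
     {f \<in> interval_mats k. (\<exists>c. f 0 = c \<cdot>\<^sub>m 1\<^sub>m k) \<and> (\<exists>c. f 1 = c \<cdot>\<^sub>m 1\<^sub>m k)}"

definition mat_block :: "nat \<Rightarrow> nat \<Rightarrow> nat \<Rightarrow> complex Matrix.mat \<Rightarrow> complex Matrix.mat" where
  "mat_block k i j A = Matrix.mat k k (\<lambda>(r, s). A $$ (i * k + r, j * k + s))"

text \<open>
  \<open>M\<^sub>n(I\<^sub>k)\<close> inside \<open>M\<^sub>n\<^sub>k(C[0,1])\<close>, under the usual identification of an \<open>n \<times> n\<close> matrix of
  \<open>k \<times> k\<close> blocks with an \<open>nk \<times> nk\<close> matrix.
\<close>

definition dim_drop_mats :: "nat \<Rightarrow> nat \<Rightarrow> (real \<Rightarrow> complex Matrix.mat) set" where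
  "dim_drop_mats n k =
     {F \<in> interval_mats (n * k). \<forall>i<n. \<forall>j<n. (\<lambda>t. mat_block k i j (F t)) \<in> dim_drop_alg k}"

text \<open>
  Unital *-homomorphisms from \<open>C(X)\<close> to a unital *-subalgebra \<open>B\<close> of \<open>M\<^sub>N(C[0,1])\<close>.  The second
  conjunct says that the value depends only on the element of \<open>C(X)\<close>, not on its representative.
\<close>

definition unital_star_hom ::
    "'a::topological_space set \<Rightarrow> nat \<Rightarrow> (real \<Rightarrow> complex Matrix.mat) set \<Rightarrow>
     (('a \<Rightarrow> complex) \<Rightarrow> real \<Rightarrow> complex Matrix.mat) \<Rightarrow> bool" where
  "unital_star_hom X N B \<phi> \<longleftrightarrow>
     (\<forall>f\<in>cont_alg X. \<phi> f \<in> B) \<and>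
     (\<forall>f\<in>cont_alg X. \<forall>g\<in>cont_alg X. (\<forall>x\<in>X. f x = g x) \<longrightarrow> (\<forall>y\<in>{0..1}. \<phi> f y = \<phi> g y)) \<and>
     (\<forall>y\<in>{0..1}. \<phi> (\<lambda>x. 1) y = 1\<^sub>m N) \<and>
     (\<forall>f\<in>cont_alg X. \<forall>g\<in>cont_alg X. \<forall>y\<in>{0..1}. \<phi> (\<lambda>x. f x + g x) y = \<phi> f y + \<phi> g y) \<and>
     (\<forall>f\<in>cont_alg X. \<forall>c. \<forall>y\<in>{0..1}. \<phi> (\<lambda>x. c * f x) y = c \<cdot>\<^sub>m \<phi> f y) \<and>
     (\<forall>f\<in>cont_alg X. \<forall>g\<in>cont_alg X. \<forall>y\<in>{0..1}. \<phi> (\<lambda>x. f x * g x) y = \<phi> f y * \<phi> g y) \<and>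
     (\<forall>f\<in>cont_alg X. \<forall>y\<in>{0..1}. \<phi> (\<lambda>x. cnj (f x)) y = mat_adjoint (\<phi> f y))"

text \<open>
  \<open>is_spectrum X N \<phi> y xs\<close>: the list \<open>xs\<close> enumerates \<open>Sp \<phi>\<^sub>y\<close> with multiplicity.  Such a list
  exists for every unital homomorphism and is unique up to order.
\<close>

definition is_spectrum ::
    "'a::topological_space set \<Rightarrow> nat \<Rightarrow> (('a \<Rightarrow> complex) \<Rightarrow> real \<Rightarrow> complex Matrix.mat) \<Rightarrow>
     real \<Rightarrow> 'a list \<Rightarrow> bool" where
  "is_spectrum X N \<phi> y xs \<longleftrightarrow>
     length xs = N \<and> set xs \<subseteq> X \<and>
     (\<exists>q. (\<forall>j<N. projection_mat N (q j) \<and> vec_space.rank N (q j) = 1) \<and>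
          (\<forall>i<N. \<forall>j<N. i \<noteq> j \<longrightarrow> q i * q j = 0\<^sub>m N N) \<and>
          msum N q {..<N} = 1\<^sub>m N \<and>
          (\<forall>f\<in>cont_alg X. \<phi> f y = msum N (\<lambda>j. f (xs ! j) \<cdot>\<^sub>m q j) {..<N}))"

text \<open>The family \<open>\<Theta>(y)\<close>; the maps are indexed by \<open>1, \<dots>, l\<^sub>1\<close>.\<close>

definition Theta ::
    "nat \<Rightarrow> nat \<Rightarrow> nat \<Rightarrow> nat \<Rightarrow> (nat \<Rightarrow> real \<Rightarrow> 'a) \<Rightarrow> real \<Rightarrow> 'a list" where
  "Theta k l1 l2 r a y =
     concat (map (\<lambda>i. replicate (l2 * k) (a i y)) [1..<l1]) @
     replicate ((l2 + r) * k) (a l1 y)"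

end

theory Submission
  imports Defs
begin

text \<open>
  Why the theorem holds.  Points of \<open>X\<close> enter only through the finitely many scalars \<open>g x\<close>, and
  these are close whenever the standard distance is small; this determines \<open>\<eta>\<close>.

  At a point \<open>y\<close>, the operators \<open>\<phi> g y\<close> are diagonal in an orthonormal basis \<open>v\<^sub>1, \<dots>, v\<^sub>N\<close>
  with eigenvalues \<open>g x\<^sub>j\<close>.  The pairing with \<open>\<Theta>(y)\<close> gives each \<open>v\<^sub>j\<close> a label \<open>i\<close>
  with \<open>x\<^sub>j\<close> close to \<open>a\<^sub>i y\<close>, and label \<open>i\<close> is used \<open>l\<^sub>2 k\<close> (for \<open>i = l\<^sub>1\<close>:
  \<open>(l\<^sub>2 + r) k\<close>) times.  Let \<open>p\<^sub>i\<close> be the projection onto the span of all but \<open>3 k\<close> of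
  the basis vectors with label \<open>i\<close>.  If \<open>A\<close> is within \<open>\<delta>\<close> of the operator that is
  \<open>g (a\<^sub>i y)\<close> on the vectors of label \<open>i\<close>, then
  \<open>A - p\<^sub>0 A p\<^sub>0 - \<Sum>\<^sub>i g (a\<^sub>i y) p\<^sub>i\<close> has norm at most \<open>2 \<delta>\<close>, because the
  expression vanishes for that diagonal operator (\<open>approx_family_projections\<close>).  So every \<open>y\<close>
  has good projections, and the work is to choose them continuously.  By Bolzano's
  bisection principle (\<open>spectral_families_joined\<close>) it is enough to join two choices at nearby
  points by a path of choices that are good at one point, which takes two kinds of moves.

  A frame of joint approximate eigenvectors can be moved to any other one with the same
  eigenvalues through such frames, one vector at a time, by the complex reflections
  \<open>1 + (\<zeta> - 1) h h\<^sup>* / \<parallel>h\<parallel>\<^sup>2\<close> with \<open>\<bar>\<zeta>\<bar> = 1\<close> (\<open>frame_step\<close>, \<open>frame_path\<close>).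
  A permutation that makes the eigenvalues at the two points correspond comes from Hall's
  theorem, applied to the doubly stochastic matrix
  \<open>\<bar>\<langle>v\<^sub>j, v'\<^sub>m\<rangle>\<bar>\<^sup>2\<close> (\<open>eigenframe_matching\<close>).

  What remains is to change the labels of a fixed frame.  Two labellings with the same label
  counts differ by cycles of the form: \<open>m\<^sub>1\<close> has label \<open>i\<^sub>1\<close> and should have \<open>i\<^sub>2\<close>, \<open>m\<^sub>2\<close>
  has \<open>i\<^sub>2\<close> and should have \<open>i\<^sub>3\<close>, and so on, with distinct labels along the cycle.  Since
  \<open>p\<^sub>i\<close> does not use all vectors of label \<open>i\<close>, it can first be moved, inside the span of the
  vectors of label \<open>i\<close>, away from the one vector of that label in the cycle; after that the
  labels on the cycle can be changed without touching any \<open>p\<^sub>i\<close> (\<open>relabelling_connected\<close>,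
  \<open>relabel_connected\<close>).  This is the only use of the loss of rank in \<open>p\<^sub>i\<close>.

  At the end points \<open>\<phi> f y\<close> has the form \<open>\<psi> f \<otimes> 1\<^sub>k\<close>.  The basis is then taken of the form
  \<open>u\<^sub>m \<otimes> e\<^sub>\<kappa>\<close>, and a second matching argument chooses the labels constant in \<open>\<kappa>\<close>
  (\<open>ampliated_spectral_family\<close>), so that the resulting projections lie in \<open>M\<^sub>n \<otimes> 1\<^sub>k\<close>.
\<close>


section \<open>Matchings and relabellings\<close>

text \<open>
  Hall's marriage theorem, by the induction of Halmos and Vaughan: either every proper nonempty
  subset has a surplus of neighbours, and one pair can be fixed arbitrarily, or a tight subset
  splits the problem into two smaller ones.
\<close>

lemma hall_marriage:
  fixes Nb :: "'a \<Rightarrow> 'b set"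
  assumes "finite A" "\<And>a. a \<in> A \<Longrightarrow> finite (Nb a)"
    and "\<And>J. J \<subseteq> A \<Longrightarrow> card J \<le> card (\<Union>(Nb ` J))"
  shows "\<exists>f. inj_on f A \<and> (\<forall>a\<in>A. f a \<in> Nb a)"
  using assms
proof (induction A arbitrary: Nb rule: finite_psubset_induct)
  case (psubset A)
  show ?case
  proof (cases "A = {}")
    case True
    then show ?thesis by simp
  next
    case False
    show ?thesis
    proof (cases "\<forall>J. J \<noteq> {} \<and> J \<subset> A \<longrightarrow> card J < card (\<Union>(Nb ` J))")
      case True
      obtain a where a: "a \<in> A" using False by auto
      have "card {a} \<le> card (\<Union>(Nb ` {a}))" using a by (intro psubset.prems(2)) auto
      then have "Nb a \<noteq> {}" by auto
      then obtain b where b: "b \<in> Nb a" by auto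
      define Nb' where "Nb' = (\<lambda>x. Nb x - {b})"
      have "\<exists>f. inj_on f (A - {a}) \<and> (\<forall>x\<in>A - {a}. f x \<in> Nb' x)"
      proof (rule psubset.IH)
        show "A - {a} \<subset> A" using a by auto
        show "finite (Nb' x)" if "x \<in> A - {a}" for x
          using that psubset.prems(1) by (auto simp: Nb'_def)
        fix J assume J: "J \<subseteq> A - {a}"
        show "card J \<le> card (\<Union>(Nb' ` J))"
        proof (cases "J = {}")
          case True then show ?thesis by simp
        next
          case False
          have "card J < card (\<Union>(Nb ` J))" using True False J a by blast
          moreover have "card (\<Union>(Nb' ` J)) = card (\<Union>(Nb ` J) - {b})"
            by (rule arg_cong[of _ _ card]) (auto simp: Nb'_def)
          moreover have "card (\<Union>(Nb ` J)) - 1 \<le> card (\<Union>(Nb ` J) - {b})"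
            by (simp add: card_Diff_singleton_if)
          ultimately show ?thesis by linarith
        qed
      qed
      then obtain f where f: "inj_on f (A - {a})" "\<forall>x\<in>A - {a}. f x \<in> Nb' x" by auto
      have "inj_on (f(a := b)) A"
        using f by (auto simp: inj_on_def Nb'_def)
      moreover have "\<forall>x\<in>A. (f(a := b)) x \<in> Nb x"
        using f b by (auto simp: Nb'_def)
      ultimately show ?thesis by blast
    next
      case False
      then obtain B where B: "B \<noteq> {}" "B \<subset> A" "card (\<Union>(Nb ` B)) \<le> card B"
        by (meson not_less)
      have "\<exists>f. inj_on f B \<and> (\<forall>x\<in>B. f x \<in> Nb x)"
        using B psubset.prems by (intro psubset.IH) auto
      then obtain f where f: "inj_on f B" "\<forall>x\<in>B. f x \<in> Nb x" by auto
      define Nb' where "Nb' = (\<lambda>x. Nb x - \<Union>(Nb ` B))"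
      have "\<exists>g. inj_on g (A - B) \<and> (\<forall>x\<in>A - B. g x \<in> Nb' x)"
      proof (rule psubset.IH)
        show "A - B \<subset> A" using B by auto
        show "finite (Nb' x)" if "x \<in> A - B" for x
          using that psubset.prems(1) by (auto simp: Nb'_def)
        fix J assume J: "J \<subseteq> A - B"
        have fJ: "finite J" "finite B" using J B psubset.hyps by (auto intro: finite_subset)
        have "card J + card B = card (J \<union> B)"
          using J fJ by (subst card_Un_disjoint) auto
        also have "\<dots> \<le> card (\<Union>(Nb ` (J \<union> B)))"
          using J B by (intro psubset.prems(2)) auto
        also have "\<Union>(Nb ` (J \<union> B)) = \<Union>(Nb' ` J) \<union> \<Union>(Nb ` B)" by (auto simp: Nb'_def)
        also have "card \<dots> \<le> card (\<Union>(Nb' ` J)) + card (\<Union>(Nb ` B))"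
          by (rule card_Un_le)
        finally show "card J \<le> card (\<Union>(Nb' ` J))" using B(3) by linarith
      qed
      then obtain g where g: "inj_on g (A - B)" "\<forall>x\<in>A - B. g x \<in> Nb' x" by auto
      define h where "h = (\<lambda>x. if x \<in> B then f x else g x)"
      have "inj_on h A"
      proof (rule inj_onI)
        fix x y assume xy: "x \<in> A" "y \<in> A" "h x = h y"
        show "x = y"
        proof (cases "x \<in> B \<longleftrightarrow> y \<in> B")
          case True
          then show ?thesis using xy f(1) g(1) by (auto simp: h_def inj_on_def split: if_splits)
        next
          case False
          have out: "h z \<notin> \<Union>(Nb ` B)" if "z \<in> A" "z \<notin> B" for z
            using that g(2) by (auto simp: h_def Nb'_def)
          have "h z \<in> \<Union>(Nb ` B)" if "z \<in> B" for z
            using that f(2) by (auto simp: h_def)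
          then show ?thesis using False xy out by metis
        qed
      qed
      moreover have "\<forall>x\<in>A. h x \<in> Nb x" using f g by (auto simp: h_def Nb'_def)
      ultimately show ?thesis by blast
    qed
  qed
qed

text \<open>
  A doubly stochastic matrix has a permutation along which all entries exceed a threshold
  \<open>\<theta>\<close> with \<open>\<theta> n\<^sup>2 < 1\<close>: the entries below the threshold have total weight less than 1, which
  is too little to violate Hall's condition.
\<close>

lemma doubly_stochastic_matching:
  fixes w :: "'a \<Rightarrow> 'b \<Rightarrow> real"
  assumes fin: "finite A" "finite B" and card: "card A = card B"
    and w0: "\<And>a b. a \<in> A \<Longrightarrow> b \<in> B \<Longrightarrow> 0 \<le> w a b"
    and row: "\<And>a. a \<in> A \<Longrightarrow> (\<Sum>b\<in>B. w a b) = 1"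
    and col: "\<And>b. b \<in> B \<Longrightarrow> (\<Sum>a\<in>A. w a b) = 1"
    and \<theta>: "0 \<le> \<theta>" "\<theta> * (real (card A))\<^sup>2 < 1"
  shows "\<exists>f. bij_betw f A B \<and> (\<forall>a\<in>A. w a (f a) > \<theta>)"
proof -
  define Nb where "Nb = (\<lambda>a. {b\<in>B. w a b > \<theta>})"
  have "\<exists>f. inj_on f A \<and> (\<forall>a\<in>A. f a \<in> Nb a)"
  proof (rule hall_marriage)
    show "finite A" by fact
    show "finite (Nb a)" for a using fin by (auto simp: Nb_def)
    fix J assume J: "J \<subseteq> A"
    define M where "M = \<Union>(Nb ` J)"
    have M: "M \<subseteq> B" by (auto simp: M_def Nb_def)
    have fJ: "finite J" "finite M" using J M fin by (auto intro: finite_subset)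
    have "real (card J) = (\<Sum>a\<in>J. \<Sum>b\<in>B. w a b)" using J row by (simp add: subset_iff)
    also have "\<dots> = (\<Sum>a\<in>J. (\<Sum>b\<in>B - M. w a b) + (\<Sum>b\<in>M. w a b))"
      using M fin by (simp add: sum.subset_diff)
    also have "\<dots> = (\<Sum>a\<in>J. \<Sum>b\<in>B - M. w a b) + (\<Sum>a\<in>J. \<Sum>b\<in>M. w a b)"
      by (simp add: sum.distrib)
    also have "(\<Sum>a\<in>J. \<Sum>b\<in>M. w a b) \<le> (\<Sum>a\<in>A. \<Sum>b\<in>M. w a b)"
      using fin J M w0 by (intro sum_mono2 sum_nonneg) auto
    also have "\<dots> = (\<Sum>b\<in>M. \<Sum>a\<in>A. w a b)" by (rule sum.swap)
    also have "\<dots> = real (card M)" using M col by (simp add: subset_iff)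
    also have "(\<Sum>a\<in>J. \<Sum>b\<in>B - M. w a b) \<le> (\<Sum>a\<in>J. \<Sum>b\<in>B - M. \<theta>)"
      using J by (intro sum_mono) (force simp: M_def Nb_def)
    also have "\<dots> = \<theta> * (real (card J) * real (card (B - M)))" by simp
    also have "\<dots> \<le> \<theta> * (real (card A) * real (card B))"
      using \<theta> J fin by (intro mult_left_mono mult_mono) (auto intro: card_mono)
    also have "\<dots> < 1" using \<theta> card by (simp add: power2_eq_square)
    finally show "card J \<le> card (\<Union>(Nb ` J))" unfolding M_def by linarith
  qed
  then obtain f where f: "inj_on f A" "\<forall>a\<in>A. f a \<in> Nb a" by auto
  have "f ` A \<subseteq> B" using f by (auto simp: Nb_def)
  moreover have "card (f ` A) = card B" using f card by (simp add: card_image)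
  ultimately have "f ` A = B" using fin by (simp add: card_subset_eq)
  with f show ?thesis by (intro exI[of _ f]) (auto simp: bij_betw_def Nb_def)
qed

lemma exists_invariant_subset:
  assumes "finite S" "S \<noteq> {}" "f ` S \<subseteq> S"
  shows "\<exists>T\<subseteq>S. T \<noteq> {} \<and> f ` T = T"
  using assms
proof (induction S rule: finite_psubset_induct)
  case (psubset S)
  show ?case
  proof (cases "f ` S = S")
    case True
    then show ?thesis using psubset.prems(1) by (intro exI[of _ S] conjI order_refl)
  next
    case False
    then have "f ` S \<subset> S" using psubset.prems by auto
    then have "\<exists>T\<subseteq>f ` S. T \<noteq> {} \<and> f ` T = T"
      using psubset.prems by (intro psubset.IH) auto
    then obtain T where "T \<subseteq> f ` S" "T \<noteq> {}" "f ` T = T" by (elim exE conjE)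
    moreover from this(1) have "T \<subseteq> S" using psubset.prems(2) by (rule subset_trans)
    ultimately show ?thesis by (intro exI conjI)
  qed
qed

text \<open>
  A labelling of \<open>A\<close> gives every \<open>m\<close> an admissible label, \<open>near m i\<close> expressing admissibility,
  and uses the label \<open>i\<close> exactly \<open>L i\<close> times.  A selection picks \<open>c i\<close> of the elements with
  label \<open>i\<close>, for each \<open>i\<close>.
\<close>

definition labelling :: "'m set \<Rightarrow> 'i set \<Rightarrow> ('m \<Rightarrow> 'i \<Rightarrow> bool) \<Rightarrow> ('i \<Rightarrow> nat) \<Rightarrow> ('m \<Rightarrow> 'i) \<Rightarrow> bool" where
  "labelling A I near L \<mu> \<longleftrightarrow>
     (\<forall>m\<in>A. \<mu> m \<in> I \<and> near m (\<mu> m)) \<and> (\<forall>i\<in>I. card {m\<in>A. \<mu> m = i} = L i)"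

definition selection :: "'m set \<Rightarrow> 'i set \<Rightarrow> ('i \<Rightarrow> nat) \<Rightarrow> ('m \<Rightarrow> 'i) \<Rightarrow> ('i \<Rightarrow> 'm set) \<Rightarrow> bool" where
  "selection A I c \<mu> Q \<longleftrightarrow> (\<forall>i\<in>I. Q i \<subseteq> {m\<in>A. \<mu> m = i} \<and> card (Q i) = c i)"

text \<open>
  Given two labellings that differ, some of the discrepancies can be corrected at once, at most
  one for each old label, without changing the label counts.  If label \<open>i\<close> is wrongly given to
  some element, choose one such element \<open>pick i\<close> and let \<open>nx i\<close> be its correct label; equality of the
  counts shows that \<open>nx i\<close> is again wrongly given to some element, and \<open>\<mu>\<close> is corrected on a
  set of labels permuted by \<open>nx\<close>.
\<close>

lemma labelling_cycle:
  assumes fin: "finite A"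
    and lab: "labelling A I near L \<mu>" "labelling A I near L \<mu>'"
    and ne: "\<exists>m\<in>A. \<mu> m \<noteq> \<mu>' m"
  shows "\<exists>P \<mu>''. P \<subseteq> {m\<in>A. \<mu> m \<noteq> \<mu>' m} \<and> P \<noteq> {} \<and> inj_on \<mu> P \<and>
           \<mu>'' = (\<lambda>m. if m \<in> P then \<mu>' m else \<mu> m) \<and> labelling A I near L \<mu>''"
proof -
  define S where "S = \<mu> ` {m\<in>A. \<mu> m \<noteq> \<mu>' m}"
  have "\<forall>i\<in>S. \<exists>m\<in>A. \<mu> m = i \<and> \<mu>' m \<noteq> i" unfolding S_def by auto
  then obtain pick where pick: "\<And>i. i \<in> S \<Longrightarrow> pick i \<in> A \<and> \<mu> (pick i) = i \<and> \<mu>' (pick i) \<noteq> i"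
    by metis
  define nx where "nx = (\<lambda>i. \<mu>' (pick i))"
  have "nx ` S \<subseteq> S"
  proof
    fix i assume "i \<in> nx ` S"
    then obtain j where j: "j \<in> S" "i = \<mu>' (pick j)" by (auto simp: nx_def)
    have m0: "pick j \<in> A" "\<mu> (pick j) \<noteq> i" using pick[OF j(1)] j(2) by auto
    have iI: "i \<in> I" using lab(2) m0(1) j(2) by (auto simp: labelling_def)
    show "i \<in> S"
    proof (rule ccontr)
      assume "i \<notin> S"
      then have sub: "{m\<in>A. \<mu> m = i} \<subseteq> {m\<in>A. \<mu>' m = i}" by (auto simp: S_def)
      have "card {m\<in>A. \<mu> m = i} = card {m\<in>A. \<mu>' m = i}"
        using lab iI by (auto simp: labelling_def)
      then have "{m\<in>A. \<mu> m = i} = {m\<in>A. \<mu>' m = i}"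
        using sub fin by (intro card_subset_eq) auto
      then show False using m0 j(2) by blast
    qed
  qed
  moreover have "finite S" "S \<noteq> {}" using fin ne by (auto simp: S_def)
  ultimately obtain T where T: "T \<subseteq> S" "T \<noteq> {}" "nx ` T = T"
    using exists_invariant_subset by metis
  have injn: "inj_on nx T" using T \<open>finite S\<close>
    by (metis finite_subset finite_surj_inj order_refl)
  define P where "P = pick ` T"
  define \<mu>'' where "\<mu>'' = (\<lambda>m. if m \<in> P then \<mu>' m else \<mu> m)"
  have PT: "pick i \<in> A" "\<mu> (pick i) = i" "\<mu>' (pick i) \<noteq> i" if "i \<in> T" for i
    using that T pick by auto
  have injP: "inj_on \<mu> P" by (auto simp: inj_on_def P_def PT)
  have "card {m\<in>A. \<mu>'' m = i} = L i" if i: "i \<in> I" for i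
  proof (cases "i \<in> T")
    case True
    then obtain j where j: "j \<in> T" "nx j = i" using T(3) by (metis imageE)
    have 1: "{m\<in>A. \<mu>'' m = i} = insert (pick j) ({m\<in>A. \<mu> m = i} - {pick i})"
    proof (intro Set.set_eqI iffI)
      fix m assume "m \<in> {m\<in>A. \<mu>'' m = i}"
      then have m: "m \<in> A" "\<mu>'' m = i" by auto
      show "m \<in> insert (pick j) ({m\<in>A. \<mu> m = i} - {pick i})"
      proof (cases "m \<in> P")
        case True
        then obtain l where l: "l \<in> T" "m = pick l" by (auto simp: P_def)
        then have "nx l = i" using m True by (simp add: \<mu>''_def nx_def)
        then have "l = j" using injn l j by (auto simp: inj_on_def)
        then show ?thesis using l by simp
      next
        case False
        then show ?thesis using m \<open>i \<in> T\<close> by (auto simp: \<mu>''_def P_def)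
      qed
    next
      fix m assume "m \<in> insert (pick j) ({m\<in>A. \<mu> m = i} - {pick i})"
      then consider "m = pick j" | "m \<in> A" "\<mu> m = i" "m \<noteq> pick i" by auto
      then show "m \<in> {m\<in>A. \<mu>'' m = i}"
      proof cases
        case 1
        then show ?thesis using j PT by (auto simp: \<mu>''_def P_def nx_def)
      next
        case 2
        then have "m \<notin> P" using PT by (auto simp: P_def)
        then show ?thesis using 2 by (simp add: \<mu>''_def)
      qed
    qed
    have "pick j \<notin> {m\<in>A. \<mu> m = i} - {pick i}"
      using PT(2,3)[OF j(1)] j(2) by (auto simp: nx_def)
    then have "card {m\<in>A. \<mu>'' m = i} = Suc (card ({m\<in>A. \<mu> m = i} - {pick i}))"
      unfolding 1 using fin by simp
    also have "\<dots> = card {m\<in>A. \<mu> m = i}"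
      using fin PT(1,2)[OF True] by (intro card_Suc_Diff1) auto
    finally show ?thesis using lab i by (auto simp: labelling_def)
  next
    case False
    have "{m\<in>A. \<mu>'' m = i} = {m\<in>A. \<mu> m = i}"
      using False T(3) PT by (auto simp: \<mu>''_def P_def nx_def)
    then show ?thesis using lab i by (auto simp: labelling_def)
  qed
  then have "labelling A I near L \<mu>''" using lab by (auto simp: labelling_def \<mu>''_def)
  moreover have "\<mu> (pick i) \<noteq> \<mu>' (pick i)" if "i \<in> T" for i
    using PT(2,3)[OF that] by simp
  then have "P \<subseteq> {m\<in>A. \<mu> m \<noteq> \<mu>' m}" "P \<noteq> {}"
    using PT(1) T(2) by (auto simp: P_def)
  ultimately show ?thesis using injP \<mu>''_def by blast
qed

text \<open>
  A transitive relation on selections that holds between any two selections for the same labelling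
  holds between any two selections, provided each label has an element to spare.
\<close>

lemma relabelling_connected:
  assumes fin: "finite A"
    and cL: "\<And>i. i \<in> I \<Longrightarrow> c i < L i"
    and trans: "\<And>Q Q' Q''. C Q Q' \<Longrightarrow> C Q' Q'' \<Longrightarrow> C Q Q''"
    and step: "\<And>\<mu> Q Q'. labelling A I near L \<mu> \<Longrightarrow> selection A I c \<mu> Q \<Longrightarrow> selection A I c \<mu> Q' \<Longrightarrow> C Q Q'"
    and lab: "labelling A I near L \<mu>" "labelling A I near L \<mu>'"
    and sel: "selection A I c \<mu> Q" "selection A I c \<mu>' Q'"
  shows "C Q Q'"
  using lab(1) sel(1)
proof (induction "card {m\<in>A. \<mu> m \<noteq> \<mu>' m}" arbitrary: \<mu> Q rule: less_induct)
  case less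
  show ?case
  proof (cases "\<exists>m\<in>A. \<mu> m \<noteq> \<mu>' m")
    case False
    then have "{m\<in>A. \<mu> m = i} = {m\<in>A. \<mu>' m = i}" for i by auto
    then have "selection A I c \<mu>' Q" using less.prems(2) by (simp add: selection_def)
    then show ?thesis using step[OF lab(2)] sel(2) by blast
  next
    case True
    \<comment> \<open>\<open>P\<close> contains at most one element of each label, so a selection that avoids \<open>P\<close> exists;
      it is a selection for the old and for the corrected labelling.\<close>
    obtain P \<mu>'' where P: "P \<subseteq> {m\<in>A. \<mu> m \<noteq> \<mu>' m}" "P \<noteq> {}" "inj_on \<mu> P"
      and \<mu>'': "\<mu>'' = (\<lambda>m. if m \<in> P then \<mu>' m else \<mu> m)" "labelling A I near L \<mu>''"
      using labelling_cycle[OF fin less.prems(1) lab(2) True] by blast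
    have "\<exists>q. q \<subseteq> {m\<in>A. \<mu> m = i} - P \<and> card q = c i" if i: "i \<in> I" for i
    proof -
      have fP: "finite P" using P fin by (auto intro: finite_subset)
      have "card ({m\<in>A. \<mu> m = i} \<inter> P) \<le> 1"
        using P(3) fP by (auto simp: card_le_Suc0_iff_eq inj_on_def)
      moreover have "card ({m\<in>A. \<mu> m = i} - P) = card {m\<in>A. \<mu> m = i} - card ({m\<in>A. \<mu> m = i} \<inter> P)"
        using fin by (simp add: card_Diff_subset_Int)
      moreover have "card {m\<in>A. \<mu> m = i} = L i" using less.prems(1) i by (auto simp: labelling_def)
      ultimately have "c i \<le> card ({m\<in>A. \<mu> m = i} - P)" using cL[OF i] by linarith
      then show ?thesis by (meson obtain_subset_with_card_n)
    qed
    then obtain Q0 where Q0: "\<And>i. i \<in> I \<Longrightarrow> Q0 i \<subseteq> {m\<in>A. \<mu> m = i} - P \<and> card (Q0 i) = c i"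
      by metis
    have "selection A I c \<mu> Q0" using Q0 by (fastforce simp: selection_def)
    then have 1: "C Q Q0" using step less.prems by blast
    have 2: "selection A I c \<mu>'' Q0" using Q0 by (fastforce simp: selection_def \<mu>''(1))
    have "{m\<in>A. \<mu>'' m \<noteq> \<mu>' m} \<subset> {m\<in>A. \<mu> m \<noteq> \<mu>' m}"
      using P(1,2) by (auto simp: \<mu>''(1) split: if_splits)
    then have "card {m\<in>A. \<mu>'' m \<noteq> \<mu>' m} < card {m\<in>A. \<mu> m \<noteq> \<mu>' m}"
      using fin by (intro psubset_card_mono) auto
    then have "C Q0 Q'" using \<mu>''(2) 2 by (rule less.hyps)
    with 1 show ?thesis by (rule trans)
  qed
qed

lemma selection_permutation:
  assumes fin: "finite A" and lab: "\<And>m. m \<in> A \<Longrightarrow> \<mu> m \<in> I"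
    and sel: "selection A I c \<mu> Q" "selection A I c \<mu> Q'"
  shows "\<exists>\<rho>. bij_betw \<rho> A A \<and> (\<forall>m\<in>A. \<mu> (\<rho> m) = \<mu> m) \<and> (\<forall>i\<in>I. \<rho> ` Q i = Q' i)"
proof -
  have "\<exists>h. bij_betw h {m\<in>A. \<mu> m = i} {m\<in>A. \<mu> m = i} \<and> h ` Q i = Q' i" if i: "i \<in> I" for i
  proof -
    let ?F = "{m\<in>A. \<mu> m = i}"
    have q: "Q i \<subseteq> ?F" "Q' i \<subseteq> ?F" "card (Q i) = card (Q' i)"
      using sel i by (auto simp: selection_def)
    have f: "finite ?F" "finite (Q i)" "finite (Q' i)" using q fin by (auto intro: finite_subset)
    obtain f where f1: "bij_betw f (Q i) (Q' i)" using q f by (metis finite_same_card_bij)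
    have "card (?F - Q i) = card (?F - Q' i)" using q f by (simp add: card_Diff_subset)
    then obtain g where g: "bij_betw g (?F - Q i) (?F - Q' i)"
      using f by (metis finite_Diff finite_same_card_bij)
    let ?h = "\<lambda>x. if x \<in> Q i then f x else g x"
    have 1: "bij_betw ?h (Q i) (Q' i)" using f1 by (subst bij_betw_cong[of _ _ f]) auto
    have 2: "bij_betw ?h (?F - Q i) (?F - Q' i)" using g by (subst bij_betw_cong[of _ _ g]) auto
    have "bij_betw ?h (Q i \<union> (?F - Q i)) (Q' i \<union> (?F - Q' i))"
      using 1 2 by (rule bij_betw_combine) auto
    moreover have "Q i \<union> (?F - Q i) = ?F" "Q' i \<union> (?F - Q' i) = ?F" using q by auto
    ultimately have "bij_betw ?h ?F ?F" by (simp only:)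
    moreover have "?h ` Q i = Q' i" using 1 by (rule bij_betw_imp_surj_on)
    ultimately show ?thesis by blast
  qed
  then have "\<forall>i\<in>I. \<exists>h. bij_betw h {m\<in>A. \<mu> m = i} {m\<in>A. \<mu> m = i} \<and> h ` Q i = Q' i" by blast
  from bchoice[OF this] obtain h where
    h: "\<And>i. i \<in> I \<Longrightarrow> bij_betw (h i) {m\<in>A. \<mu> m = i} {m\<in>A. \<mu> m = i} \<and> h i ` Q i = Q' i"
    by blast
  define \<rho> where "\<rho> = (\<lambda>m. h (\<mu> m) m)"
  have \<rho>: "\<rho> m \<in> A" "\<mu> (\<rho> m) = \<mu> m" if "m \<in> A" for m
  proof -
    have "h (\<mu> m) m \<in> {x\<in>A. \<mu> x = \<mu> m}"
      using h[OF lab[OF that]] that by (intro bij_betw_apply[of "h (\<mu> m)" "{x\<in>A. \<mu> x = \<mu> m}"]) auto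
    then show "\<rho> m \<in> A" "\<mu> (\<rho> m) = \<mu> m" by (auto simp: \<rho>_def)
  qed
  have "inj_on \<rho> A"
  proof (rule inj_onI)
    fix x y assume xy: "x \<in> A" "y \<in> A" "\<rho> x = \<rho> y"
    then have "\<mu> x = \<mu> y" using \<rho> by metis
    moreover have "inj_on (h (\<mu> x)) {m\<in>A. \<mu> m = \<mu> x}"
      using h[OF lab[OF xy(1)]] by (auto dest: bij_betw_imp_inj_on)
    ultimately show "x = y" using xy by (auto simp: \<rho>_def dest: inj_onD)
  qed
  moreover from this have "\<rho> ` A = A" using fin \<rho>(1) by (intro endo_inj_surj) auto
  ultimately have "bij_betw \<rho> A A" by (simp add: bij_betw_def)
  moreover have "\<rho> ` Q i = Q' i" if "i \<in> I" for i
  proof -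
    have "\<rho> ` Q i = h i ` Q i"
      using sel that by (intro image_cong) (auto simp: \<rho>_def selection_def)
    then show ?thesis using h that by simp
  qed
  ultimately show ?thesis using \<rho> by blast
qed

section \<open>Vectors and orthonormal frames\<close>

text \<open>
  A vector of \<open>\<complex>\<^sup>N\<close> is a function on \<^typ>\<open>nat\<close> of which only the values below \<open>N\<close> matter, and likewise
  for matrices.  So \<open>N\<close> can vary inside a statement.  The inner product \<open>ip\<close> is linear in the second argument;
  \<open>nrm\<close> is its norm, \<open>mv\<close> applies a matrix to a vector, and \<open>adj\<close> is the adjoint matrix.
\<close>

definition ip :: "nat \<Rightarrow> (nat \<Rightarrow> complex) \<Rightarrow> (nat \<Rightarrow> complex) \<Rightarrow> complex" where
  "ip N u v = (\<Sum>r<N. cnj (u r) * v r)"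

definition nrm :: "nat \<Rightarrow> (nat \<Rightarrow> complex) \<Rightarrow> real" where
  "nrm N v = L2_set (\<lambda>r. cmod (v r)) {..<N}"

definition mv :: "nat \<Rightarrow> (nat \<Rightarrow> nat \<Rightarrow> complex) \<Rightarrow> (nat \<Rightarrow> complex) \<Rightarrow> nat \<Rightarrow> complex" where
  "mv N D v = (\<lambda>r. \<Sum>s<N. D r s * v s)"

definition adj :: "(nat \<Rightarrow> nat \<Rightarrow> complex) \<Rightarrow> nat \<Rightarrow> nat \<Rightarrow> complex" where
  "adj D = (\<lambda>r s. cnj (D s r))"

text \<open>
  The first \<open>m\<close> vectors of the sequence \<open>V\<close> are orthonormal in \<open>\<complex>\<^sup>N\<close>.  For \<open>m = N\<close> they form an
  orthonormal basis, called a frame below.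
\<close>

definition orthonormal :: "nat \<Rightarrow> nat \<Rightarrow> (nat \<Rightarrow> nat \<Rightarrow> complex) \<Rightarrow> bool" where
  "orthonormal N m V \<longleftrightarrow> (\<forall>i<m. \<forall>j<m. ip N (V i) (V j) = (if i = j then 1 else 0))"

lemma ip_cong: "(\<And>r. r < N \<Longrightarrow> u r = u' r) \<Longrightarrow> (\<And>r. r < N \<Longrightarrow> v r = v' r) \<Longrightarrow> ip N u v = ip N u' v'"
  by (simp add: ip_def)

lemma nrm_cong: "(\<And>r. r < N \<Longrightarrow> u r = u' r) \<Longrightarrow> nrm N u = nrm N u'"
  by (auto simp: nrm_def intro!: L2_set_cong)

lemma ip_add_right: "ip N u (\<lambda>r. x r + y r) = ip N u x + ip N u y"
  by (simp add: ip_def algebra_simps sum.distrib)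

lemma ip_diff_right: "ip N u (\<lambda>r. x r - y r) = ip N u x - ip N u y"
  by (simp add: ip_def algebra_simps sum_subtractf)

lemma ip_scale_right: "ip N u (\<lambda>r. c * x r) = c * ip N u x"
  by (simp add: ip_def sum_distrib_left algebra_simps)

lemma ip_sum_right: "ip N u (\<lambda>r. \<Sum>j\<in>J. f j r) = (\<Sum>j\<in>J. ip N u (f j))"
  unfolding ip_def by (subst sum.swap) (simp add: sum_distrib_left)

lemma ip_cnj: "cnj (ip N u v) = ip N v u"
  by (simp add: ip_def mult.commute)

lemma ip_add_left: "ip N (\<lambda>r. x r + y r) u = ip N x u + ip N y u"
  by (simp add: ip_def algebra_simps sum.distrib)

lemma ip_diff_left: "ip N (\<lambda>r. x r - y r) u = ip N x u - ip N y u"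
  by (simp add: ip_def algebra_simps sum_subtractf)

lemma ip_scale_left: "ip N (\<lambda>r. c * x r) u = cnj c * ip N x u"
  by (simp add: ip_def sum_distrib_left algebra_simps)

lemma ip_sum_left: "ip N (\<lambda>r. \<Sum>j\<in>J. f j r) u = (\<Sum>j\<in>J. ip N (f j) u)"
  unfolding ip_def by (subst sum.swap) (simp add: sum_distrib_right)

lemmas ip_linear = ip_add_right ip_diff_right ip_scale_right ip_sum_right
  ip_add_left ip_diff_left ip_scale_left ip_sum_left

lemma ip_self: "ip N v v = of_real ((nrm N v)\<^sup>2)"
proof -
  have "(nrm N v)\<^sup>2 = (\<Sum>r<N. (cmod (v r))\<^sup>2)" by (simp add: nrm_def L2_set_def sum_nonneg)
  then show ?thesis
    by (simp add: ip_def complex_norm_square mult.commute del: of_real_power)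
qed

lemma nrm_power2_eqI: "ip N v v = of_real x \<Longrightarrow> (nrm N v)\<^sup>2 = x"
  by (simp only: ip_self of_real_eq_iff)

lemma nrm_nonneg [simp]: "0 \<le> nrm N v"
  by (simp add: nrm_def)

lemma nrm_eq_0: "nrm N v = 0 \<longleftrightarrow> (\<forall>r<N. v r = 0)"
  by (auto simp: nrm_def L2_set_eq_0_iff)

lemma cmod_ip_le: "cmod (ip N u v) \<le> nrm N u * nrm N v"
proof -
  have "cmod (ip N u v) \<le> (\<Sum>r<N. \<bar>cmod (u r)\<bar> * \<bar>cmod (v r)\<bar>)"
    unfolding ip_def by (rule order_trans[OF norm_sum]) (simp add: norm_mult)
  also have "\<dots> \<le> nrm N u * nrm N v" unfolding nrm_def by (rule L2_set_mult_ineq)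
  finally show ?thesis .
qed

lemma nrm_scale: "nrm N (\<lambda>r. c * v r) = cmod c * nrm N v"
  by (simp add: nrm_def norm_mult L2_set_right_distrib)

lemma nrm_triangle: "nrm N (\<lambda>r. x r + y r) \<le> nrm N x + nrm N y"
proof -
  have "nrm N (\<lambda>r. x r + y r) \<le> L2_set (\<lambda>r. cmod (x r) + cmod (y r)) {..<N}"
    unfolding nrm_def by (rule L2_set_mono) (auto intro: norm_triangle_ineq)
  also have "\<dots> \<le> nrm N x + nrm N y" unfolding nrm_def by (rule L2_set_triangle_ineq)
  finally show ?thesis .
qed

lemma nrm_triangle_diff: "nrm N (\<lambda>r. x r - y r) \<le> nrm N x + nrm N y"
  using nrm_triangle[of N x "\<lambda>r. (-1) * y r"] nrm_scale[of N "-1" y] by simp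

lemma nrm_sum_le: "finite J \<Longrightarrow> nrm N (\<lambda>r. \<Sum>j\<in>J. f j r) \<le> (\<Sum>j\<in>J. nrm N (f j))"
proof (induction J rule: finite_induct)
  case empty
  then show ?case by (simp add: nrm_def L2_set_def)
next
  case (insert x F)
  then show ?case using nrm_triangle[of N "f x" "\<lambda>r. \<Sum>j\<in>F. f j r"] by simp
qed

lemma mv_add: "mv N D (\<lambda>s. x s + y s) = (\<lambda>r. mv N D x r + mv N D y r)"
  by (simp add: mv_def algebra_simps sum.distrib)

lemma mv_diff: "mv N D (\<lambda>s. x s - y s) = (\<lambda>r. mv N D x r - mv N D y r)"
  by (simp add: mv_def algebra_simps sum_subtractf)

lemma mv_scale: "mv N D (\<lambda>s. c * x s) = (\<lambda>r. c * mv N D x r)"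
  by (simp add: mv_def algebra_simps sum_distrib_left)

lemma mv_sum: "mv N D (\<lambda>s. \<Sum>j\<in>J. f j s) = (\<lambda>r. \<Sum>j\<in>J. mv N D (f j) r)"
proof
  fix r
  show "mv N D (\<lambda>s. \<Sum>j\<in>J. f j s) r = (\<Sum>j\<in>J. mv N D (f j) r)"
    unfolding mv_def by (subst sum.swap) (simp add: sum_distrib_left)
qed

lemma mv_cong: "(\<And>r. r < N \<Longrightarrow> x r = y r) \<Longrightarrow> mv N D x = mv N D y"
  by (simp add: mv_def)

lemma ip_mv: "ip N u (mv N D v) = ip N (mv N (adj D) u) v"
proof -
  have "ip N u (mv N D v) = (\<Sum>r<N. \<Sum>s<N. cnj (u r) * D r s * v s)"
    by (simp add: ip_def mv_def sum_distrib_left mult.assoc)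
  also have "\<dots> = (\<Sum>s<N. \<Sum>r<N. cnj (u r) * D r s * v s)" by (rule sum.swap)
  also have "\<dots> = ip N (mv N (adj D) u) v"
    by (simp add: ip_def mv_def adj_def sum_distrib_right sum_distrib_left mult.commute mult.left_commute)
  finally show ?thesis .
qed

lemma bessel_identity:
  assumes "orthonormal N m V"
  shows "(nrm N (\<lambda>r. w r - (\<Sum>j<m. ip N (V j) w * V j r)))\<^sup>2 = (nrm N w)\<^sup>2 - (\<Sum>j<m. (cmod (ip N (V j) w))\<^sup>2)"
    and "i < m \<Longrightarrow> ip N (V i) (\<lambda>r. w r - (\<Sum>j<m. ip N (V j) w * V j r)) = 0"
proof -
  let ?a = "\<lambda>j. ip N (V j) w"
  let ?w = "\<lambda>r. w r - (\<Sum>j<m. ?a j * V j r)"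
  have orth: "ip N (V i) ?w = 0" if i: "i < m" for i
  proof -
    have "ip N (V i) ?w = ?a i - (\<Sum>j<m. ?a j * ip N (V i) (V j))" by (simp add: ip_linear)
    also have "(\<Sum>j<m. ?a j * ip N (V i) (V j)) = (\<Sum>j<m. if j = i then ?a j else 0)"
      using assms i by (intro sum.cong) (auto simp: orthonormal_def)
    finally show ?thesis using i by simp
  qed
  then show "i < m \<Longrightarrow> ip N (V i) ?w = 0" .
  have "ip N ?w ?w = ip N w ?w - (\<Sum>j<m. cnj (?a j) * ip N (V j) ?w)"
    by (subst ip_diff_left) (simp only: ip_sum_left ip_scale_left)
  also have "(\<Sum>j<m. cnj (?a j) * ip N (V j) ?w) = 0" using orth by simp
  also have "ip N w ?w - 0 = ip N w w - (\<Sum>j<m. ?a j * ip N w (V j))" by (simp add: ip_linear)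
  also have "(\<Sum>j<m. ?a j * ip N w (V j)) = (\<Sum>j<m. of_real ((cmod (?a j))\<^sup>2))"
    by (intro sum.cong refl) (metis complex_norm_square ip_cnj)
  finally have "complex_of_real ((nrm N ?w)\<^sup>2) = of_real ((nrm N w)\<^sup>2 - (\<Sum>j<m. (cmod (?a j))\<^sup>2))"
    by (simp add: ip_self)
  then show "(nrm N ?w)\<^sup>2 = (nrm N w)\<^sup>2 - (\<Sum>j<m. (cmod (?a j))\<^sup>2)"
    using of_real_eq_iff by blast
qed

lemma nrm_orthonormal: "orthonormal N m V \<Longrightarrow> j < m \<Longrightarrow> nrm N (V j) = 1"
proof -
  assume "orthonormal N m V" "j < m"
  then have "(nrm N (V j))\<^sup>2 = 1\<^sup>2" by (intro nrm_power2_eqI) (simp add: orthonormal_def)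
  then show "nrm N (V j) = 1" by (metis abs_of_nonneg nrm_nonneg power2_eq_iff abs_1 abs_minus_cancel)
qed

text \<open>
  The squared distances of the standard basis vectors to the span of \<open>m\<close> orthonormal vectors add up to
  \<open>N - m\<close>.  This replaces a dimension count: the case \<open>m = N\<close> gives completeness of a frame, the case
  \<open>m < N\<close> a nonzero vector orthogonal to the span.
\<close>

lemma orthonormal_defect:
  assumes "orthonormal N m V"
  shows "(\<Sum>t<N. (nrm N (\<lambda>r. (if r = t then 1 else 0) - (\<Sum>j<m. cnj (V j t) * V j r)))\<^sup>2) = real N - real m"
proof -
  let ?e = "\<lambda>t r::nat. if r = t then (1::complex) else 0"
  have ipe: "ip N u (?e t) = cnj (u t)" if "t < N" for u t
    using that by (simp add: ip_def if_distrib[of "(*) _"] cong: if_cong)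
  have "(nrm N (\<lambda>r. ?e t r - (\<Sum>j<m. cnj (V j t) * V j r)))\<^sup>2 = 1 - (\<Sum>j<m. (cmod (V j t))\<^sup>2)" if t: "t < N" for t
  proof -
    have "(nrm N (?e t))\<^sup>2 = 1" using ipe[OF t, of "?e t"] by (intro nrm_power2_eqI) simp
    then show ?thesis using bessel_identity(1)[OF assms, of "?e t"] ipe[OF t] by simp
  qed
  then have "(\<Sum>t<N. (nrm N (\<lambda>r. ?e t r - (\<Sum>j<m. cnj (V j t) * V j r)))\<^sup>2)
      = real N - (\<Sum>t<N. \<Sum>j<m. (cmod (V j t))\<^sup>2)" by (simp add: sum_subtractf)
  also have "(\<Sum>t<N. \<Sum>j<m. (cmod (V j t))\<^sup>2) = (\<Sum>j<m. \<Sum>t<N. (cmod (V j t))\<^sup>2)" by (rule sum.swap)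
  also have "\<dots> = (\<Sum>j<m. (nrm N (V j))\<^sup>2)" by (simp add: nrm_def L2_set_def sum_nonneg)
  also have "\<dots> = real m" using assms by (simp add: nrm_orthonormal)
  finally show ?thesis .
qed

lemma orthonormal_complete:
  assumes "orthonormal N N V" "r < N" "t < N"
  shows "(\<Sum>j<N. V j r * cnj (V j t)) = (if r = t then 1 else 0)"
proof -
  have "\<forall>t\<in>{..<N}. (nrm N (\<lambda>r. (if r = t then 1 else 0) - (\<Sum>j<N. cnj (V j t) * V j r)))\<^sup>2 = 0"
    using orthonormal_defect[OF assms(1)] by (subst sum_nonneg_eq_0_iff[symmetric]) auto
  then have "(if r = t then 1 else 0) - (\<Sum>j<N. cnj (V j t) * V j r) = 0"
    using assms(2,3) by (auto simp: nrm_eq_0)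
  then show ?thesis by (simp add: mult.commute)
qed

lemma orthonormal_extend:
  assumes "orthonormal N m V" "m < N"
  shows "\<exists>w. nrm N w \<noteq> 0 \<and> (\<forall>j<m. ip N (V j) w = 0)"
proof -
  let ?w = "\<lambda>t r. (if r = t then 1 else 0) - (\<Sum>j<m. cnj (V j t) * V j r)"
  have "(\<Sum>t<N. (nrm N (?w t))\<^sup>2) \<noteq> 0" using orthonormal_defect[OF assms(1)] assms(2) by simp
  then obtain t where t: "t < N" "nrm N (?w t) \<noteq> 0"
    by (metis (no_types, lifting) lessThan_iff power_zero_numeral sum.neutral)
  have "ip N u (\<lambda>r. if r = t then 1 else 0) = cnj (u t)" for u
    using t by (simp add: ip_def if_distrib[of "(*) _"] cong: if_cong)
  then have "ip N (V i) (?w t) = 0" if "i < m" for i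
    using bessel_identity(2)[OF assms(1) that, of "\<lambda>r. if r = t then 1 else 0"] by simp
  then show ?thesis using t by blast
qed

lemma orthonormal_expand:
  assumes "orthonormal N N V" "r < N"
  shows "w r = (\<Sum>j<N. ip N (V j) w * V j r)"
proof -
  have "(\<Sum>j<N. ip N (V j) w * V j r) = (\<Sum>j<N. \<Sum>t<N. V j r * cnj (V j t) * w t)"
    by (simp add: ip_def sum_distrib_right sum_distrib_left mult.commute mult.left_commute)
  also have "\<dots> = (\<Sum>t<N. (\<Sum>j<N. V j r * cnj (V j t)) * w t)"
    by (subst sum.swap) (simp add: sum_distrib_right)
  also have "\<dots> = (\<Sum>t<N. if r = t then w t else 0)"
    using assms by (intro sum.cong refl) (simp add: orthonormal_complete)
  finally show ?thesis using assms by simp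
qed

lemma parseval:
  assumes "orthonormal N N V"
  shows "(nrm N w)\<^sup>2 = (\<Sum>j<N. (cmod (ip N (V j) w))\<^sup>2)"
proof -
  have "nrm N (\<lambda>r. w r - (\<Sum>j<N. ip N (V j) w * V j r)) = 0"
    using orthonormal_expand[OF assms] by (simp add: nrm_eq_0)
  then show ?thesis using bessel_identity(1)[OF assms, of w] by simp
qed

lemma ip_frame_sum:
  assumes "orthonormal N N V" "i < N"
  shows "ip N (V i) (\<lambda>r. \<Sum>j<N. c j * V j r) = c i"
proof -
  have "ip N (V i) (\<lambda>r. \<Sum>j<N. c j * V j r) = (\<Sum>j<N. if j = i then c j else 0)"
    unfolding ip_linear using assms by (intro sum.cong) (auto simp: orthonormal_def)
  then show ?thesis using assms by simp
qed

text \<open>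
  The operator that is diagonal in the frame \<open>V\<close> with eigenvalues \<open>\<beta>\<close>.
\<close>

definition diag_op :: "nat \<Rightarrow> (nat \<Rightarrow> nat \<Rightarrow> complex) \<Rightarrow> (nat \<Rightarrow> complex) \<Rightarrow> nat \<Rightarrow> nat \<Rightarrow> complex" where
  "diag_op N V \<beta> = (\<lambda>r s. \<Sum>j<N. \<beta> j * V j r * cnj (V j s))"

lemma mv_diag_op: "mv N (diag_op N V \<beta>) w = (\<lambda>r. \<Sum>j<N. (\<beta> j * ip N (V j) w) * V j r)"
proof
  fix r
  have "mv N (diag_op N V \<beta>) w r = (\<Sum>s<N. \<Sum>j<N. \<beta> j * V j r * cnj (V j s) * w s)"
    by (simp add: mv_def diag_op_def sum_distrib_right)
  also have "\<dots> = (\<Sum>j<N. \<Sum>s<N. \<beta> j * V j r * cnj (V j s) * w s)" by (rule sum.swap)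
  also have "\<dots> = (\<Sum>j<N. (\<beta> j * ip N (V j) w) * V j r)"
    by (simp add: ip_def sum_distrib_left sum_distrib_right mult.commute mult.left_commute)
  finally show "mv N (diag_op N V \<beta>) w r = (\<Sum>j<N. (\<beta> j * ip N (V j) w) * V j r)" .
qed

lemma nrm_frame_sum_le:
  assumes "orthonormal N N V" "\<And>j. j < N \<Longrightarrow> cmod (\<beta> j) \<le> e" "0 \<le> e"
  shows "nrm N (\<lambda>r. \<Sum>j<N. (\<beta> j * ip N (V j) w) * V j r) \<le> e * nrm N w"
proof (rule power2_le_imp_le)
  have "(nrm N (\<lambda>r. \<Sum>j<N. (\<beta> j * ip N (V j) w) * V j r))\<^sup>2 = (\<Sum>j<N. (cmod (\<beta> j * ip N (V j) w))\<^sup>2)"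
    by (subst parseval[OF assms(1)], intro sum.cong refl) (simp add: ip_frame_sum[OF assms(1)])
  also have "\<dots> \<le> (\<Sum>j<N. e\<^sup>2 * (cmod (ip N (V j) w))\<^sup>2)"
    using assms by (intro sum_mono) (auto simp: norm_mult power_mult_distrib intro!: mult_right_mono power_mono)
  also have "\<dots> = (e * nrm N w)\<^sup>2"
    by (simp add: parseval[OF assms(1), of w] power_mult_distrib sum_distrib_left)
  finally show "(nrm N (\<lambda>r. \<Sum>j<N. (\<beta> j * ip N (V j) w) * V j r))\<^sup>2 \<le> (e * nrm N w)\<^sup>2" .
qed (use assms in auto)

text \<open>
  The error of \<open>v\<close> as an eigenvector of \<open>D\<close> for the eigenvalue \<open>c\<close>.
\<close>

abbreviation eig_err :: "nat \<Rightarrow> (nat \<Rightarrow> nat \<Rightarrow> complex) \<Rightarrow> complex \<Rightarrow> (nat \<Rightarrow> complex) \<Rightarrow> real" where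
  "eig_err N D c v \<equiv> nrm N (\<lambda>r. mv N D v r - c * v r)"

lemma approx_eigenframe_op_bound:
  assumes V: "orthonormal N N V" and "\<And>j. j < N \<Longrightarrow> eig_err N D (\<gamma> j) (V j) \<le> d"
  shows "nrm N (\<lambda>r. mv N D w r - mv N (diag_op N V \<gamma>) w r) \<le> real N * d * nrm N w"
proof -
  let ?a = "\<lambda>j. ip N (V j) w"
  have "mv N D w = mv N D (\<lambda>r. \<Sum>j<N. ?a j * V j r)"
    by (rule mv_cong) (rule orthonormal_expand[OF V])
  also have "\<dots> = (\<lambda>r. \<Sum>j<N. ?a j * mv N D (V j) r)" by (simp add: mv_sum mv_scale)
  finally have "(\<lambda>r. mv N D w r - mv N (diag_op N V \<gamma>) w r)
      = (\<lambda>r. \<Sum>j<N. ?a j * (mv N D (V j) r - \<gamma> j * V j r))"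
    unfolding mv_diag_op by (simp add: fun_eq_iff sum_subtractf algebra_simps)
  then have "nrm N (\<lambda>r. mv N D w r - mv N (diag_op N V \<gamma>) w r)
      \<le> (\<Sum>j<N. nrm N (\<lambda>r. ?a j * (mv N D (V j) r - \<gamma> j * V j r)))"
    by (simp add: nrm_sum_le)
  also have "\<dots> \<le> (\<Sum>j<N. nrm N w * d)"
    unfolding nrm_scale
  proof (intro sum_mono mult_mono)
    fix j assume "j \<in> {..<N}"
    then show "cmod (?a j) \<le> nrm N w" "eig_err N D (\<gamma> j) (V j) \<le> d"
      using cmod_ip_le[of N "V j" w] nrm_orthonormal[OF V, of j] assms(2) by auto
  qed auto
  finally show ?thesis by (simp add: mult.commute mult.left_commute)
qed

lemma nrm_mv_entries_le:
  assumes "\<And>r s. r < N \<Longrightarrow> s < N \<Longrightarrow> cmod (D r s) \<le> d"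
  shows "nrm N (mv N D w) \<le> (real N)\<^sup>2 * d * nrm N w"
proof -
  have ws: "cmod (w s) \<le> nrm N w" if "s < N" for s
    unfolding nrm_def using that member_le_L2_set[of "{..<N}" s "\<lambda>r. cmod (w r)"] by simp
  have "nrm N (mv N D w) \<le> (\<Sum>r<N. cmod (mv N D w r))"
    unfolding nrm_def by (rule L2_set_le_sum) simp
  also have "\<dots> \<le> (\<Sum>r<N. \<Sum>s<N. d * nrm N w)"
  proof (rule sum_mono)
    fix r assume "r \<in> {..<N}"
    then have r: "r < N" by simp
    have "cmod (mv N D w r) \<le> (\<Sum>s<N. cmod (D r s * w s))" unfolding mv_def by (rule norm_sum)
    also have "\<dots> \<le> (\<Sum>s<N. d * nrm N w)"
      unfolding norm_mult using assms[OF r] ws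
      by (intro sum_mono mult_mono) (auto intro: order_trans[OF norm_ge_zero])
    finally show "cmod (mv N D w r) \<le> (\<Sum>s<N. d * nrm N w)" .
  qed
  finally show ?thesis by (simp add: power2_eq_square mult.assoc)
qed

section \<open>Moving an orthonormal frame\<close>

text \<open>
  The operator \<open>1 + (\<zeta> - 1) h h\<^sup>* / \<parallel>h\<parallel>\<^sup>2\<close>: it is unitary for \<open>\<bar>\<zeta>\<bar> = 1\<close>, the identity for \<open>\<zeta> = 1\<close>
  and the reflection in the hyperplane orthogonal to \<open>h\<close> for \<open>\<zeta> = -1\<close>.  For \<open>nrm N h = 0\<close> the
  division by zero makes it the identity.
\<close>

definition creflect :: "nat \<Rightarrow> (nat \<Rightarrow> complex) \<Rightarrow> complex \<Rightarrow> (nat \<Rightarrow> complex) \<Rightarrow> nat \<Rightarrow> complex" where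
  "creflect N h \<zeta> w = (\<lambda>r. w r + ((\<zeta> - 1) * ip N h w / of_real ((nrm N h)\<^sup>2)) * h r)"

lemma ip_creflect:
  assumes "cmod \<zeta> = 1"
  shows "ip N (creflect N h \<zeta> w) (creflect N h \<zeta> w') = ip N w w'"
proof (cases "nrm N h = 0")
  case True
  then show ?thesis by (simp add: creflect_def)
next
  case False
  define H where "H = complex_of_real ((nrm N h)\<^sup>2)"
  have H: "H \<noteq> 0" "cnj H = H" "ip N h h = H" using False by (auto simp: H_def ip_self)
  define a where "a = ip N h w"
  define b where "b = ip N h w'"
  have a': "ip N w h = cnj a" by (simp add: a_def ip_cnj)
  have z: "\<zeta> * cnj \<zeta> = 1" using assms complex_norm_square[of \<zeta>] by simp
  define p q where "p = (\<zeta> - 1) * a / H" and "q = (\<zeta> - 1) * b / H"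
  have "creflect N h \<zeta> w = (\<lambda>r. w r + p * h r)" "creflect N h \<zeta> w' = (\<lambda>r. w' r + q * h r)"
    by (simp_all only: creflect_def p_def q_def a_def b_def H_def)
  then have "ip N (creflect N h \<zeta> w) (creflect N h \<zeta> w') = ip N w w' + q * cnj a + cnj p * (b + q * H)"
    by (simp add: ip_linear H a' algebra_simps flip: b_def)
  also have "\<dots> = ip N w w' + ((\<zeta> - 1) * b / H) * cnj a + cnj ((\<zeta> - 1) * a / H) * (b + ((\<zeta> - 1) * b / H) * H)"
    by (simp only: p_def q_def)
  also have "\<dots> = ip N w w' + (cnj a * b / H) * ((\<zeta> - 1) + (cnj \<zeta> - 1) + (cnj \<zeta> - 1) * (\<zeta> - 1))"
    using H by (simp add: field_simps)
  also have "(\<zeta> - 1) + (cnj \<zeta> - 1) + (cnj \<zeta> - 1) * (\<zeta> - 1) = 0"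
    using z by (simp add: algebra_simps)
  finally show ?thesis by simp
qed

lemma creflect_1: "creflect N h 1 w = w"
  by (simp add: creflect_def)

lemma creflect_orthogonal: "ip N h w = 0 \<Longrightarrow> creflect N h \<zeta> w = w"
  by (simp add: creflect_def)

text \<open>
  A path of frames that carries \<open>V m\<close> to a multiple of a given unit vector \<open>x\<close> and fixes the vectors before
  it.  If all \<open>V j\<close> and \<open>x\<close> are approximate eigenvectors of \<open>D\<close>, with the same eigenvalue for \<open>V m\<close> and
  \<open>x\<close>, then the frames on the path consist of approximate eigenvectors for the same eigenvalues.  The
  estimate fails if the reflecting vector \<open>h\<close> is short, so \<open>x\<close> is first rotated by a phase that makes
  \<open>ip N x (V m)\<close> real and nonpositive.
\<close>

lemma frame_step:
  assumes V: "orthonormal N N V" and m: "m < N"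
    and x: "nrm N x = 1" "\<And>j. j < m \<Longrightarrow> ip N (V j) x = 0"
    and d: "0 \<le> d"
  shows "\<exists>(F :: real \<Rightarrow> nat \<Rightarrow> nat \<Rightarrow> complex) \<omega>.
    F 0 = V \<and> (\<forall>s. orthonormal N N (F s)) \<and> (\<forall>j r. continuous_on UNIV (\<lambda>s. F s j r)) \<and>
    cmod \<omega> = 1 \<and> F 1 m = (\<lambda>r. \<omega> * x r) \<and> (\<forall>s j. j < m \<longrightarrow> F s j = V j) \<and>
    (\<forall>D \<gamma> s j. (\<forall>j<N. eig_err N D (\<gamma> j) (V j) \<le> d) \<longrightarrow>
       eig_err N D (\<gamma> m) x \<le> d \<longrightarrow>
       eig_err N (adj D) (cnj (\<gamma> m)) x \<le> d \<longrightarrow> j < N \<longrightarrow>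
       eig_err N D (\<gamma> j) (F s j) \<le> 10 * d)"
proof -
  let ?c = "ip N x (V m)"
  define \<omega> where "\<omega> = (if ?c = 0 then 1 else - sgn ?c)"
  have \<omega>: "cmod \<omega> = 1" by (simp add: \<omega>_def norm_sgn)
  define x' where "x' = (\<lambda>r. \<omega> * x r)"
  define \<rho> where "\<rho> = cmod ?c"
  have \<rho>0: "0 \<le> \<rho>" by (simp add: \<rho>_def)
  have "ip N x' (V m) = cnj \<omega> * ?c" by (simp add: x'_def ip_linear)
  also have "\<dots> = - of_real \<rho>"
  proof (cases "?c = 0")
    case False
    have "cnj ?c * ?c = of_real \<rho> * of_real \<rho>"
      using complex_norm_square[of ?c] by (simp add: \<rho>_def power2_eq_square mult.commute)
    then show ?thesis using False by (simp add: \<omega>_def sgn_eq \<rho>_def field_simps)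
  qed (simp add: \<rho>_def)
  finally have xV: "ip N x' (V m) = - of_real \<rho>" .
  then have Vx: "ip N (V m) x' = - of_real \<rho>" by (metis complex_cnj_complex_of_real complex_cnj_minus ip_cnj)
  have Vm: "ip N (V m) (V m) = 1" using V m by (simp add: orthonormal_def)
  have nx': "nrm N x' = 1" using x \<omega> by (simp add: x'_def nrm_scale)
  then have xx: "ip N x' x' = 1" by (simp add: ip_self)
  define h where "h = (\<lambda>r. V m r - x' r)"
  have hh: "(nrm N h)\<^sup>2 = 2 + 2 * \<rho>"
    by (rule nrm_power2_eqI) (simp add: h_def ip_linear Vm xx xV Vx)
  have nh: "1 \<le> nrm N h"
    using hh \<rho>0 by (intro power2_le_imp_le[of 1]) auto
  have hV: "ip N h (V m) = 1 + of_real \<rho>" by (simp add: h_def ip_linear Vm xV)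
  have hVj: "ip N h (V j) = - ip N x' (V j)" if "j < N" "j \<noteq> m" for j
    using V m that by (simp add: h_def ip_linear orthonormal_def)
  define F where "F = (\<lambda>s::real. \<lambda>j. creflect N h (cis (pi * s)) (V j))"
  show ?thesis
  proof (intro exI[of _ F] exI[of _ \<omega>] conjI allI impI)
    show "F 0 = V" by (simp add: F_def creflect_1)
    show "orthonormal N N (F s)" for s
      using V by (simp add: orthonormal_def F_def ip_creflect)
    show "continuous_on UNIV (\<lambda>s. F s j r)" for j r
      unfolding F_def creflect_def cis_conv_exp using nh by (intro continuous_intros) auto
    show "cmod \<omega> = 1" by fact
    have "(- 2 * ip N h (V m)) / of_real ((nrm N h)\<^sup>2) = (-1::complex)"
    proof -
      have "complex_of_real (2 + 2 * \<rho>) \<noteq> 0" using \<rho>0 by (simp only: of_real_eq_0_iff)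
      then show ?thesis unfolding hV hh by (simp add: field_simps)
    qed
    then show "F 1 m = (\<lambda>r. \<omega> * x r)"
      by (simp add: F_def creflect_def h_def x'_def fun_eq_iff)
    show Fj: "F s j = V j" if "j < m" for s j
    proof -
      have "ip N x' (V j) = 0"
        using x(2)[OF that] ip_cnj[of N "V j" x] by (simp add: x'_def ip_linear)
      then show ?thesis unfolding F_def using that m hVj by (intro creflect_orthogonal) simp
    qed
    fix D \<gamma> s j
    assume "\<forall>j<N. eig_err N D (\<gamma> j) (V j) \<le> d"
      and dx: "eig_err N D (\<gamma> m) x \<le> d"
      and da: "eig_err N (adj D) (cnj (\<gamma> m)) x \<le> d" and j: "j < N"
    then have dV: "\<And>j. j < N \<Longrightarrow> eig_err N D (\<gamma> j) (V j) \<le> d" by blast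
    have dx': "eig_err N D (\<gamma> m) x' \<le> d"
    proof -
      have "(\<lambda>r. mv N D x' r - \<gamma> m * x' r) = (\<lambda>r. \<omega> * (mv N D x r - \<gamma> m * x r))"
        by (simp add: x'_def mv_scale algebra_simps)
      then show ?thesis using dx \<omega> by (simp add: nrm_scale)
    qed
    have dh: "eig_err N D (\<gamma> m) h \<le> 2 * d"
    proof -
      have "(\<lambda>r. mv N D h r - \<gamma> m * h r) = (\<lambda>r. (mv N D (V m) r - \<gamma> m * V m r) - (mv N D x' r - \<gamma> m * x' r))"
        by (simp add: h_def mv_diff algebra_simps)
      then show ?thesis
        using nrm_triangle_diff[of N "\<lambda>r. mv N D (V m) r - \<gamma> m * V m r" "\<lambda>r. mv N D x' r - \<gamma> m * x' r"]
          dV[OF m] dx' by simp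
    qed
    define \<kappa> where "\<kappa> = (cis (pi * s) - 1) * ip N h (V j) / of_real ((nrm N h)\<^sup>2)"
    have c2: "cmod (cis (pi * s) - 1) \<le> 2"
      using norm_triangle_ineq4[of "cis (pi * s)" 1] by simp
    have \<kappa>: "cmod \<kappa> = cmod (cis (pi * s) - 1) * cmod (ip N h (V j)) / (nrm N h)\<^sup>2"
      by (simp add: \<kappa>_def norm_mult norm_divide norm_power)
    have hVle: "cmod (ip N h (V j)) \<le> nrm N h"
      using cmod_ip_le[of N h "V j"] nrm_orthonormal[OF V j] by simp
    have \<kappa>2: "cmod \<kappa> \<le> 2"
    proof -
      have "cmod \<kappa> \<le> 2 * nrm N h / (nrm N h)\<^sup>2"
        unfolding \<kappa> using c2 hVle by (intro divide_right_mono mult_mono) auto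
      also have "\<dots> = 2 / nrm N h" using nh by (simp add: power2_eq_square)
      also have "\<dots> \<le> 2" using nh by (simp add: divide_le_eq)
      finally show ?thesis .
    qed
    \<comment> \<open>approximate eigenvectors for well separated eigenvalues are almost orthogonal\<close>
    have gap: "cmod (\<gamma> m - \<gamma> j) * cmod (ip N h (V j)) \<le> 2 * d"
    proof (cases "j = m")
      case True
      then show ?thesis using d by simp
    next
      case False
      have "ip N x (\<lambda>r. mv N D (V j) r - \<gamma> j * V j r) - ip N (\<lambda>r. mv N (adj D) x r - cnj (\<gamma> m) * x r) (V j)
          = (\<gamma> m - \<gamma> j) * ip N x (V j)"
        by (simp add: ip_diff_left ip_diff_right ip_scale_left ip_scale_right ip_mv left_diff_distrib)
      then have "cmod (\<gamma> m - \<gamma> j) * cmod (ip N x (V j)) \<le>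
          cmod (ip N x (\<lambda>r. mv N D (V j) r - \<gamma> j * V j r)) + cmod (ip N (\<lambda>r. mv N (adj D) x r - cnj (\<gamma> m) * x r) (V j))"
        by (metis norm_mult norm_triangle_ineq4)
      also have "\<dots> \<le> 1 * d + d * 1"
        using x(1) nrm_orthonormal[OF V j] dV[OF j] da d
        by (intro add_mono order_trans[OF cmod_ip_le] mult_mono) auto
      finally show ?thesis
        using hVj[OF j False] \<omega> by (simp add: x'_def ip_linear norm_mult)
    qed
    have \<kappa>g: "cmod \<kappa> * (cmod (\<gamma> m - \<gamma> j) * nrm N h) \<le> 4 * d"
    proof -
      have "cmod \<kappa> * (cmod (\<gamma> m - \<gamma> j) * nrm N h)
          = cmod (cis (pi * s) - 1) * (cmod (\<gamma> m - \<gamma> j) * cmod (ip N h (V j))) / nrm N h"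
        unfolding \<kappa> using nh by (simp add: power2_eq_square)
      also have "\<dots> \<le> 2 * (2 * d) / nrm N h"
        using nh by (intro divide_right_mono mult_mono[OF c2 gap]) auto
      also have "\<dots> \<le> 2 * (2 * d) / 1" using nh d by (intro divide_left_mono) auto
      finally show ?thesis by simp
    qed
    have "F s j = (\<lambda>r. V j r + \<kappa> * h r)" by (simp only: F_def creflect_def \<kappa>_def)
    then have "(\<lambda>r. mv N D (F s j) r - \<gamma> j * F s j r) =
       (\<lambda>r. (mv N D (V j) r - \<gamma> j * V j r) + \<kappa> * ((mv N D h r - \<gamma> m * h r) + (\<gamma> m - \<gamma> j) * h r))"
      by (simp add: mv_add mv_scale algebra_simps)
    then have "eig_err N D (\<gamma> j) (F s j)
       \<le> eig_err N D (\<gamma> j) (V j)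
         + cmod \<kappa> * nrm N (\<lambda>r. (mv N D h r - \<gamma> m * h r) + (\<gamma> m - \<gamma> j) * h r)"
      using nrm_triangle[of N "\<lambda>r. mv N D (V j) r - \<gamma> j * V j r"
          "\<lambda>r. \<kappa> * ((mv N D h r - \<gamma> m * h r) + (\<gamma> m - \<gamma> j) * h r)"]
      by (simp only: nrm_scale)
    also have "\<dots> \<le> d + cmod \<kappa> * (eig_err N D (\<gamma> m) h + cmod (\<gamma> m - \<gamma> j) * nrm N h)"
      using dV[OF j] nrm_triangle[of N "\<lambda>r. mv N D h r - \<gamma> m * h r" "\<lambda>r. (\<gamma> m - \<gamma> j) * h r"]
      by (intro add_mono mult_left_mono) (auto simp: nrm_scale)
    also have "\<dots> \<le> d + (2 * (2 * d) + 4 * d)"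
      using \<kappa>g \<kappa>2 dh d mult_mono[OF \<kappa>2 dh] by (simp add: distrib_left)
    finally show "eig_err N D (\<gamma> j) (F s j) \<le> 10 * d" using d by simp
  qed
qed

text \<open>
  The kernels of the projections onto the spans of the vectors \<open>V j\<close> with \<open>j \<in> Q i\<close>.  They are
  zero outside the relevant indices, so that families of projections are points of a function
  space, in which paths and path components make sense.
\<close>

definition projs :: "nat \<Rightarrow> 'i set \<Rightarrow> (nat \<Rightarrow> nat \<Rightarrow> complex) \<Rightarrow> ('i \<Rightarrow> nat set) \<Rightarrow> 'i \<Rightarrow> nat \<Rightarrow> nat \<Rightarrow> complex" where
  "projs N I V Q = (\<lambda>i r s. if i \<in> I \<and> r < N \<and> s < N then \<Sum>j\<in>Q i. V j r * cnj (V j s) else 0)"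

text \<open>
  Iterating \<open>frame_step\<close> over all \<open>N\<close> vectors moves \<open>V\<close> to \<open>V'\<close> up to phases, which the
  projections do not see; each step costs a factor 10 in the error.  For \<open>d = 0\<close> all frames on the
  path consist of exact eigenvectors.
\<close>

lemma frame_path:
  fixes S :: "('i \<Rightarrow> nat \<Rightarrow> nat \<Rightarrow> complex) set"
  assumes V': "orthonormal N N V'" and d: "0 \<le> d"
    and dV': "\<And>D \<gamma> j. (D, \<gamma>) \<in> \<D> \<Longrightarrow> j < N \<Longrightarrow> eig_err N D (\<gamma> j) (V' j) \<le> d"
    and daV': "\<And>D \<gamma> j. (D, \<gamma>) \<in> \<D> \<Longrightarrow> j < N \<Longrightarrow> eig_err N (adj D) (cnj (\<gamma> j)) (V' j) \<le> d"
    and V: "orthonormal N N V"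
    and dV: "\<And>D \<gamma> j. (D, \<gamma>) \<in> \<D> \<Longrightarrow> j < N \<Longrightarrow> eig_err N D (\<gamma> j) (V j) \<le> d"
    and Q: "\<And>i. i \<in> I \<Longrightarrow> Q i \<subseteq> {..<N}"
    and S: "\<And>W. orthonormal N N W \<Longrightarrow>
      (\<And>D \<gamma> j. (D, \<gamma>) \<in> \<D> \<Longrightarrow> j < N \<Longrightarrow> eig_err N D (\<gamma> j) (W j) \<le> 10 ^ N * d) \<Longrightarrow>
      projs N I W Q \<in> S"
  shows "path_component S (projs N I V Q) (projs N I V' Q)"
proof -
  have "path_component S (projs N I V Q) (projs N I V' Q)"
    \<comment> \<open>\<open>k\<close> is the number of vectors that still have to be moved\<close>
    if "k \<le> N" "orthonormal N N V"
      "\<And>D \<gamma> j. (D, \<gamma>) \<in> \<D> \<Longrightarrow> j < N \<Longrightarrow> eig_err N D (\<gamma> j) (V j) \<le> 10 ^ (N - k) * d"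
      "\<And>j. j < N - k \<Longrightarrow> \<exists>\<omega>. cmod \<omega> = 1 \<and> V j = (\<lambda>r. \<omega> * V' j r)" for k V
    using that
  proof (induction k arbitrary: V)
    case 0
    have eq: "V j r * cnj (V j s) = V' j r * cnj (V' j s)" if j: "j < N" for j r s
    proof -
      obtain \<omega> where "cmod \<omega> = 1" "V j = (\<lambda>r. \<omega> * V' j r)" using 0(4) j by auto
      moreover from this have "\<omega> * cnj \<omega> = 1" using complex_norm_square[of \<omega>] by simp
      ultimately show ?thesis by (simp add: algebra_simps)
    qed
    have "projs N I V Q = projs N I V' Q"
    proof (intro ext)
      fix i r s
      have "(\<Sum>j\<in>Q i. V j r * cnj (V j s)) = (\<Sum>j\<in>Q i. V' j r * cnj (V' j s))" if "i \<in> I"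
        using Q[OF that] eq by (intro sum.cong) auto
      then show "projs N I V Q i r s = projs N I V' Q i r s" by (simp add: projs_def)
    qed
    moreover have "projs N I V Q \<in> S" using 0 by (intro S) auto
    ultimately show ?case by (simp add: path_component_refl)
  next
    case (Suc k)
    define m where "m = N - Suc k"
    have m: "m < N" "N - k = Suc m" using Suc.prems(1) by (auto simp: m_def)
    define e where "e = 10 ^ m * d"
    have e: "0 \<le> e" "d \<le> e" using d by (auto simp: e_def mult_le_cancel_right1)
    have orth: "ip N (V j) (V' m) = 0" if j: "j < m" for j
    proof -
      obtain \<omega> where "V j = (\<lambda>r. \<omega> * V' j r)" using Suc.prems(4) j by (auto simp: m_def)
      then show ?thesis using V' j m by (simp add: ip_linear orthonormal_def)
    qed
    obtain F \<omega> where F: "F 0 = V" "\<forall>s. orthonormal N N (F s)" "\<forall>j r. continuous_on UNIV (\<lambda>s::real. F s j r)"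
      "cmod \<omega> = 1" "F 1 m = (\<lambda>r. \<omega> * V' m r)" "\<forall>s j. j < m \<longrightarrow> F s j = V j"
      and FD: "\<forall>D \<gamma> s j. (\<forall>j<N. eig_err N D (\<gamma> j) (V j) \<le> e) \<longrightarrow>
       eig_err N D (\<gamma> m) (V' m) \<le> e \<longrightarrow>
       eig_err N (adj D) (cnj (\<gamma> m)) (V' m) \<le> e \<longrightarrow> j < N \<longrightarrow>
       eig_err N D (\<gamma> j) (F s j) \<le> 10 * e"
      using frame_step[OF Suc.prems(2) m(1) nrm_orthonormal[OF V' m(1)] orth e(1)] by blast
    have FD': "eig_err N D (\<gamma> j) (F s j) \<le> 10 ^ Suc m * d"
      if D: "(D, \<gamma>) \<in> \<D>" and j: "j < N" for D \<gamma> s j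
    proof -
      have "eig_err N D (\<gamma> j) (V j) \<le> e" if "j < N" for j
        using Suc.prems(3)[OF D that] by (simp add: e_def m_def)
      then have "eig_err N D (\<gamma> j) (F s j) \<le> 10 * e"
        using FD[rule_format, of D \<gamma>, OF _ order_trans[OF dV'[OF D m(1)] e(2)] order_trans[OF daV'[OF D m(1)] e(2)] j]
        by blast
      then show ?thesis by (simp add: e_def mult.assoc)
    qed
    have pw: "(10::real) ^ Suc m * d \<le> 10 ^ N * d"
      using m d by (intro mult_right_mono power_increasing) auto
    have inS: "projs N I (F s) Q \<in> S" for s
      using F(2) by (intro S) (blast, rule order_trans[OF FD' pw])
    have "continuous_on {0..1} (\<lambda>s. projs N I (F s) Q i r t)" for i r t
    proof (cases "i \<in> I \<and> r < N \<and> t < N")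
      case True
      then show ?thesis
        by (simp add: projs_def) (intro continuous_intros continuous_on_subset[OF F(3)[rule_format] subset_UNIV])
    next
      case False
      then have "(\<lambda>s. projs N I (F s) Q i r t) = (\<lambda>s. 0)" by (auto simp: projs_def)
      then show ?thesis by (rule ssubst) (rule continuous_on_const)
    qed
    then have "path (\<lambda>s. projs N I (F s) Q)"
      unfolding path_def by (intro continuous_on_coordinatewise_then_product)
    then have "path_component S (projs N I V Q) (projs N I (F 1) Q)"
      unfolding path_component_def using inS F(1)
      by (intro exI[of _ "\<lambda>s. projs N I (F s) Q"]) (auto simp: path_image_def pathstart_def pathfinish_def)
    also have "path_component S (projs N I (F 1) Q) (projs N I V' Q)"
    proof (rule Suc.IH)
      show "k \<le> N" using Suc.prems by simp
      show "orthonormal N N (F 1)" using F(2) by blast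
      show "eig_err N D (\<gamma> j) (F 1 j) \<le> 10 ^ (N - k) * d"
        if "(D, \<gamma>) \<in> \<D>" "j < N" for D \<gamma> j using FD'[OF that] m by simp
      fix j assume "j < N - k"
      then consider "j < m" | "j = m" using m by linarith
      then show "\<exists>\<omega>. cmod \<omega> = 1 \<and> F 1 j = (\<lambda>r. \<omega> * V' j r)"
      proof cases
        case 1
        then show ?thesis using F(6) 1 Suc.prems(4)[of j] by (simp add: m_def)
      next
        case 2
        then show ?thesis using F(4,5) by auto
      qed
    qed
    finally (path_component_trans) show ?case .
  qed
  from this[of N V] show ?thesis using V dV by simp
qed

section \<open>Families of projections near a diagonal operator\<close>

lemma projs_comp:
  assumes "\<And>i. i \<in> I \<Longrightarrow> inj_on \<rho> (Q i)"
  shows "projs N I (\<lambda>j. V (\<rho> j)) Q = projs N I V (\<lambda>i. \<rho> ` Q i)"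
  using assms by (auto simp: projs_def fun_eq_iff sum.reindex)

lemma projs_cong: "(\<And>i. i \<in> I \<Longrightarrow> Q i = Q' i) \<Longrightarrow> projs N I V Q = projs N I V Q'"
  by (auto simp: projs_def fun_eq_iff)

lemma orthonormal_comp:
  assumes "orthonormal N N V" "bij_betw \<rho> {..<N} {..<N}"
  shows "orthonormal N N (\<lambda>j. V (\<rho> j))"
proof -
  have "\<rho> j < N" if "j < N" for j using bij_betw_apply[OF assms(2)] that by auto
  moreover have "\<rho> i = \<rho> j \<longleftrightarrow> i = j" if "i < N" "j < N" for i j
    using assms(2) that by (auto simp: bij_betw_def inj_on_def)
  ultimately show ?thesis using assms(1) by (simp add: orthonormal_def)
qed

lemma adj_diag_op: "adj (diag_op N V \<beta>) = diag_op N V (\<lambda>j. cnj (\<beta> j))"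
  by (simp add: adj_def diag_op_def fun_eq_iff mult_ac)

lemma mv_diag_op_frame:
  assumes "orthonormal N N V" "j < N"
  shows "mv N (diag_op N V \<beta>) (V j) = (\<lambda>r. \<beta> j * V j r)"
proof
  fix r
  have "(\<Sum>i<N. (\<beta> i * ip N (V i) (V j)) * V i r) = (\<Sum>i<N. if i = j then \<beta> j * V j r else 0)"
    using assms by (intro sum.cong) (auto simp: orthonormal_def)
  then show "mv N (diag_op N V \<beta>) (V j) r = \<beta> j * V j r"
    unfolding mv_diag_op using assms by simp
qed

lemma diag_op_diff_le:
  assumes "orthonormal N N V" "\<And>j. j < N \<Longrightarrow> cmod (\<beta> j - \<gamma> j) \<le> e" "0 \<le> e"
  shows "nrm N (\<lambda>r. mv N (diag_op N V \<beta>) w r - mv N (diag_op N V \<gamma>) w r) \<le> e * nrm N w"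
proof -
  have "(\<lambda>r. mv N (diag_op N V \<beta>) w r - mv N (diag_op N V \<gamma>) w r)
     = (\<lambda>r. \<Sum>j<N. ((\<beta> j - \<gamma> j) * ip N (V j) w) * V j r)"
    unfolding mv_diag_op by (simp add: algebra_simps flip: sum_subtractf)
  then show ?thesis using nrm_frame_sum_le[OF assms] by simp
qed

lemma nrm_diff_triangle: "nrm N (\<lambda>r. x r - y r) \<le> nrm N (\<lambda>r. x r - z r) + nrm N (\<lambda>r. z r - y r)"
  using nrm_triangle[of N "\<lambda>r. x r - z r" "\<lambda>r. z r - y r"] by simp

lemma nrm_minus_commute: "nrm N (\<lambda>r. x r - y r) = nrm N (\<lambda>r. y r - x r)"
  by (simp add: nrm_def norm_minus_commute)

text \<open>
  The operator norm of \<open>A - B\<close> is at most \<open>e\<close>.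
\<close>

definition op_close :: "nat \<Rightarrow> real \<Rightarrow> (nat \<Rightarrow> nat \<Rightarrow> complex) \<Rightarrow> (nat \<Rightarrow> nat \<Rightarrow> complex) \<Rightarrow> bool" where
  "op_close N e A B \<longleftrightarrow> (\<forall>w. nrm N (\<lambda>r. mv N A w r - mv N B w r) \<le> e * nrm N w)"

lemma op_close_trans: "op_close N e A B \<Longrightarrow> op_close N e' B C \<Longrightarrow> op_close N (e + e') A C"
  unfolding op_close_def
  by (auto simp: distrib_right intro!: order_trans[OF nrm_diff_triangle add_mono])

lemma op_close_sym: "op_close N e A B \<Longrightarrow> op_close N e B A"
  unfolding op_close_def by (metis nrm_minus_commute)

lemma op_close_mono: "op_close N e A B \<Longrightarrow> e \<le> e' \<Longrightarrow> op_close N e' A B"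
  unfolding op_close_def by (meson mult_right_mono nrm_nonneg order_trans)

text \<open>
  Families \<open>p\<close> of orthogonal projections of ranks \<open>c i\<close> for which some frame \<open>V\<close> with labels \<open>\<mu>\<close>
  exists such that \<open>p i\<close> projects onto the span of some vectors of label \<open>i\<close>, and such that each
  \<open>D g\<close> is within \<open>e\<close> of the operator with value \<open>\<alpha> g i\<close> on the vectors of label \<open>i\<close>.
\<close>

definition approx_family :: "nat \<Rightarrow> 'i set \<Rightarrow> 'g set \<Rightarrow> ('i \<Rightarrow> nat) \<Rightarrow> ('g \<Rightarrow> nat \<Rightarrow> nat \<Rightarrow> complex) \<Rightarrow>
    ('g \<Rightarrow> 'i \<Rightarrow> complex) \<Rightarrow> real \<Rightarrow> ('i \<Rightarrow> nat \<Rightarrow> nat \<Rightarrow> complex) \<Rightarrow> bool" where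
  "approx_family N I \<G> c D \<alpha> e p \<longleftrightarrow> (\<exists>V \<mu> Q. orthonormal N N V \<and> (\<forall>j<N. \<mu> j \<in> I) \<and> selection {..<N} I c \<mu> Q \<and>
     p = projs N I V Q \<and> (\<forall>g\<in>\<G>. op_close N e (D g) (diag_op N V (\<lambda>j. \<alpha> g (\<mu> j)))))"

lemma approx_familyI:
  assumes "orthonormal N N V" "\<And>j. j < N \<Longrightarrow> \<mu> j \<in> I" "selection {..<N} I c \<mu> Q"
    "\<And>g. g \<in> \<G> \<Longrightarrow> op_close N e (D g) (diag_op N V (\<lambda>j. \<alpha> g (\<mu> j)))"
  shows "approx_family N I \<G> c D \<alpha> e (projs N I V Q)"
  unfolding approx_family_def using assms by blast

lemma approx_family_perturb:
  assumes "approx_family N I \<G> c D \<alpha> e p" and "0 \<le> d'"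
    and "\<And>g. g \<in> \<G> \<Longrightarrow> op_close N d (D' g) (D g)"
    and "\<And>g i. g \<in> \<G> \<Longrightarrow> i \<in> I \<Longrightarrow> cmod (\<alpha> g i - \<alpha>' g i) \<le> d'"
  shows "approx_family N I \<G> c D' \<alpha>' (d + e + d') p"
proof -
  obtain V \<mu> Q where V: "orthonormal N N V" "\<And>j. j < N \<Longrightarrow> \<mu> j \<in> I" "selection {..<N} I c \<mu> Q"
     "p = projs N I V Q" "\<And>g. g \<in> \<G> \<Longrightarrow> op_close N e (D g) (diag_op N V (\<lambda>j. \<alpha> g (\<mu> j)))"
    using assms(1) unfolding approx_family_def by blast
  have "op_close N d' (diag_op N V (\<lambda>j. \<alpha> g (\<mu> j))) (diag_op N V (\<lambda>j. \<alpha>' g (\<mu> j)))" if "g \<in> \<G>" for g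
    unfolding op_close_def using V(1,2) assms(2,4) that by (intro allI diag_op_diff_le) auto
  then have "op_close N (d + e + d') (D' g) (diag_op N V (\<lambda>j. \<alpha>' g (\<mu> j)))" if "g \<in> \<G>" for g
    using op_close_trans[OF op_close_trans[OF assms(3) V(5)]] that by blast
  then show ?thesis unfolding V(4) using V by (intro approx_familyI)
qed

text \<open>
  Two selections for the same labelling differ by a permutation of the frame that preserves the
  labels.  The permuted frame is reached through eigenframes of the operators with value
  \<open>\<alpha> g i\<close> on label \<open>i\<close>, which therefore do not change on the way.
\<close>

lemma selection_connected:
  assumes V: "orthonormal N N V" and \<mu>: "\<And>j. j < N \<Longrightarrow> \<mu> j \<in> I"
    and Q: "selection {..<N} I c \<mu> Q" "selection {..<N} I c \<mu> Q'"
    and close: "\<And>g. g \<in> \<G> \<Longrightarrow> op_close N e (D g) (diag_op N V (\<lambda>j. \<alpha> g (\<mu> j)))"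
  shows "path_component {p. approx_family N I \<G> c D \<alpha> e p} (projs N I V Q) (projs N I V Q')"
proof -
  obtain \<rho> where \<rho>: "bij_betw \<rho> {..<N} {..<N}" "\<forall>m\<in>{..<N}. \<mu> (\<rho> m) = \<mu> m" "\<forall>i\<in>I. \<rho> ` Q i = Q' i"
    using selection_permutation[OF _ _ Q] \<mu> by blast
  have Qsub: "Q i \<subseteq> {..<N}" if "i \<in> I" for i using Q(1) that by (auto simp: selection_def)
  have \<rho>N: "\<rho> j < N" if "j < N" for j using bij_betw_apply[OF \<rho>(1)] that by auto
  define \<D> where "\<D> = (\<lambda>g. (diag_op N V (\<lambda>j. \<alpha> g (\<mu> j)), \<lambda>j. \<alpha> g (\<mu> j))) ` \<G>"
  have zero: "nrm N (\<lambda>r. 0) = 0" by (simp add: nrm_eq_0)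
  have "path_component {p. approx_family N I \<G> c D \<alpha> e p} (projs N I V Q) (projs N I (\<lambda>j. V (\<rho> j)) Q)"
  proof (rule frame_path[where d = 0 and \<D> = \<D>])
    show "orthonormal N N (\<lambda>j. V (\<rho> j))" by (rule orthonormal_comp[OF V \<rho>(1)])
    show "eig_err N B (\<gamma> j) (V (\<rho> j)) \<le> 0"
      and "eig_err N (adj B) (cnj (\<gamma> j)) (V (\<rho> j)) \<le> 0"
      and "eig_err N B (\<gamma> j) (V j) \<le> 0"
      if "(B, \<gamma>) \<in> \<D>" "j < N" for B \<gamma> j
      using that \<rho>(2) by (auto simp: \<D>_def adj_diag_op mv_diag_op_frame[OF V] \<rho>N zero)
    fix W assume W: "orthonormal N N W" and eig: "\<And>B \<gamma> j. (B, \<gamma>) \<in> \<D> \<Longrightarrow> j < N \<Longrightarrow>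
        eig_err N B (\<gamma> j) (W j) \<le> 10 ^ N * 0"
    have "op_close N 0 (diag_op N V (\<lambda>j. \<alpha> g (\<mu> j))) (diag_op N W (\<lambda>j. \<alpha> g (\<mu> j)))" if "g \<in> \<G>" for g
    proof -
      have "nrm N (\<lambda>r. mv N (diag_op N V (\<lambda>j. \<alpha> g (\<mu> j))) (W j) r - \<alpha> g (\<mu> j) * W j r) \<le> 0" if "j < N" for j
        using eig[of "diag_op N V (\<lambda>j. \<alpha> g (\<mu> j))" "\<lambda>j. \<alpha> g (\<mu> j)" j] \<open>g \<in> \<G>\<close> that by (auto simp: \<D>_def)
      from approx_eigenframe_op_bound[OF W this] show ?thesis by (simp add: op_close_def)
    qed
    then have "op_close N (e + 0) (D g) (diag_op N W (\<lambda>j. \<alpha> g (\<mu> j)))" if "g \<in> \<G>" for g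
      using close op_close_trans that by blast
    then have "approx_family N I \<G> c D \<alpha> e (projs N I W Q)" using W \<mu> Q by (intro approx_familyI) auto
    then show "projs N I W Q \<in> {p. approx_family N I \<G> c D \<alpha> e p}" by simp
  qed (use V Qsub in auto)
  also have "projs N I (\<lambda>j. V (\<rho> j)) Q = projs N I V (\<lambda>i. \<rho> ` Q i)"
    using \<rho>(1) Qsub by (intro projs_comp) (meson bij_betw_imp_inj_on inj_on_subset)
  also have "\<dots> = projs N I V Q'" using \<rho>(3) by (intro projs_cong) auto
  finally show ?thesis .
qed

text \<open>
  For a fixed frame, any two admissible labellings and selections are joined by a path of families,
  if every label has a vector to spare (\<open>c i < L i\<close>): when the labels change in
  \<open>relabelling_connected\<close>, the selected vectors, and with them the projections, stay the same.
\<close>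

lemma relabel_connected:
  assumes V: "orthonormal N N V"
    and close: "\<And>g. g \<in> \<G> \<Longrightarrow> op_close N e1 (D g) (diag_op N V (\<gamma> g))"
    and e: "e1 + e2 \<le> e" "0 \<le> e2" and cL: "\<And>i. i \<in> I \<Longrightarrow> c i < L i"
    and lab: "labelling {..<N} I (\<lambda>j i. \<forall>g\<in>\<G>. cmod (\<gamma> g j - \<alpha> g i) \<le> e2) L \<mu>"
      "labelling {..<N} I (\<lambda>j i. \<forall>g\<in>\<G>. cmod (\<gamma> g j - \<alpha> g i) \<le> e2) L \<mu>'"
    and sel: "selection {..<N} I c \<mu> Q" "selection {..<N} I c \<mu>' Q'"
  shows "path_component {p. approx_family N I \<G> c D \<alpha> e p} (projs N I V Q) (projs N I V Q')"
proof (rule relabelling_connected[where C = "\<lambda>Q Q'. path_component {p. approx_family N I \<G> c D \<alpha> e p} (projs N I V Q) (projs N I V Q')",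
      OF _ cL _ _ lab sel])
  fix \<mu> Q Q' assume l: "labelling {..<N} I (\<lambda>j i. \<forall>g\<in>\<G>. cmod (\<gamma> g j - \<alpha> g i) \<le> e2) L \<mu>"
    and s: "selection {..<N} I c \<mu> Q" "selection {..<N} I c \<mu> Q'"
  show "path_component {p. approx_family N I \<G> c D \<alpha> e p} (projs N I V Q) (projs N I V Q')"
  proof (rule selection_connected[OF V _ s])
    show "\<mu> j \<in> I" if "j < N" for j using l that by (auto simp: labelling_def)
    fix g assume g: "g \<in> \<G>"
    have "op_close N e2 (diag_op N V (\<gamma> g)) (diag_op N V (\<lambda>j. \<alpha> g (\<mu> j)))"
      unfolding op_close_def using l g e by (intro allI diag_op_diff_le[OF V]) (auto simp: labelling_def)
    then show "op_close N e (D g) (diag_op N V (\<lambda>j. \<alpha> g (\<mu> j)))"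
      using op_close_mono[OF op_close_trans[OF close[OF g]] e(1)] by blast
  qed
qed (auto intro: path_component_trans)

text \<open>
  Exact joint eigenvectors \<open>V j\<close> and approximate ones \<open>V' m\<close> of the same operators: the eigenvalues
  correspond under a permutation \<open>\<pi>\<close> along which \<open>\<bar>\<langle>V j, V' (\<pi> j)\<rangle>\<bar> > 1 / (N + 1)\<close>, as
  \<open>(\<gamma> g j - \<gamma>' g m) \<langle>V j, V' m\<rangle>\<close> is small for all \<open>j\<close> and \<open>m\<close>.
\<close>

lemma eigenframe_matching:
  assumes V: "orthonormal N N V" and V': "orthonormal N N V'" and d: "0 \<le> d"
    and eig: "\<And>g j r. g \<in> \<G> \<Longrightarrow> j < N \<Longrightarrow> r < N \<Longrightarrow> mv N (adj (D g)) (V j) r = cnj (\<gamma> g j) * V j r"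
    and eig': "\<And>g j. g \<in> \<G> \<Longrightarrow> j < N \<Longrightarrow> eig_err N (D g) (\<gamma>' g j) (V' j) \<le> d"
  shows "\<exists>\<pi>. bij_betw \<pi> {..<N} {..<N} \<and>
     (\<forall>j<N. \<forall>g\<in>\<G>. cmod (\<gamma> g j - \<gamma>' g (\<pi> j)) \<le> d * (real N + 1))"
proof -
  let ?w = "\<lambda>j m. (cmod (ip N (V j) (V' m)))\<^sup>2"
  define \<theta> where "\<theta> = 1 / (real N + 1)\<^sup>2"
  have "\<exists>f. bij_betw f {..<N} {..<N} \<and> (\<forall>a\<in>{..<N}. ?w a (f a) > \<theta>)"
  proof (rule doubly_stochastic_matching)
    show "(\<Sum>b<N. ?w a b) = 1" if "a \<in> {..<N}" for a
      using parseval[OF V', of "V a"] nrm_orthonormal[OF V, of a] that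
      by (simp add: ip_cnj[of N "V a", symmetric])
    show "(\<Sum>a<N. ?w a b) = 1" if "b \<in> {..<N}" for b
      using parseval[OF V, of "V' b"] nrm_orthonormal[OF V', of b] that by simp
    show "\<theta> * (real (card {..<N}))\<^sup>2 < 1"
      by (simp add: \<theta>_def divide_less_eq power_strict_mono)
  qed (auto simp: \<theta>_def)
  then obtain \<pi> where \<pi>: "bij_betw \<pi> {..<N} {..<N}" "\<And>j. j < N \<Longrightarrow> ?w j (\<pi> j) > \<theta>" by auto
  have "cmod (\<gamma> g j - \<gamma>' g (\<pi> j)) \<le> d * (real N + 1)" if j: "j < N" and g: "g \<in> \<G>" for j g
  proof -
    have m: "\<pi> j < N" using bij_betw_apply[OF \<pi>(1)] j by auto
    let ?c = "ip N (V j) (V' (\<pi> j))"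
    have "(1 / (real N + 1))\<^sup>2 < (cmod ?c)\<^sup>2" using \<pi>(2)[OF j] by (simp add: \<theta>_def power_divide)
    then have c: "1 / (real N + 1) < cmod ?c" using power2_less_imp_less norm_ge_zero by blast
    have "ip N (V j) (\<lambda>r. mv N (D g) (V' (\<pi> j)) r - \<gamma>' g (\<pi> j) * V' (\<pi> j) r)
        = ip N (mv N (adj (D g)) (V j)) (V' (\<pi> j)) - \<gamma>' g (\<pi> j) * ?c"
      by (simp add: ip_diff_right ip_scale_right ip_mv)
    also have "ip N (mv N (adj (D g)) (V j)) (V' (\<pi> j)) = ip N (\<lambda>r. cnj (\<gamma> g j) * V j r) (V' (\<pi> j))"
      by (intro ip_cong) (simp_all add: eig[OF g j])
    also have "\<dots> = \<gamma> g j * ?c" by (simp add: ip_scale_left)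
    finally have "cmod (\<gamma> g j - \<gamma>' g (\<pi> j)) * cmod ?c
        = cmod (ip N (V j) (\<lambda>r. mv N (D g) (V' (\<pi> j)) r - \<gamma>' g (\<pi> j) * V' (\<pi> j) r))"
      by (simp add: norm_mult flip: left_diff_distrib)
    also have "\<dots> \<le> d"
      using cmod_ip_le[of N "V j"] eig'[OF g m] nrm_orthonormal[OF V j] by (metis mult_1 order_trans)
    finally have "cmod (\<gamma> g j - \<gamma>' g (\<pi> j)) * cmod ?c \<le> d" .
    moreover have "cmod (\<gamma> g j - \<gamma>' g (\<pi> j)) * (1 / (real N + 1)) \<le> cmod (\<gamma> g j - \<gamma>' g (\<pi> j)) * cmod ?c"
      using c by (intro mult_left_mono) auto
    ultimately have "cmod (\<gamma> g j - \<gamma>' g (\<pi> j)) / (real N + 1) \<le> d" by simp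
    then show ?thesis by (simp add: pos_divide_le_eq)
  qed
  then show ?thesis using \<pi>(1) by blast
qed

text \<open>
  Frames of eigenvectors of two close families of operators \<open>D\<close> and \<open>D'\<close>, each with an admissible labelling
  and a selection, give families of projections in the same path component.  The first part of
  the path moves the frame \<open>V\<close> to a permutation of \<open>V'\<close>, the second one changes the labels.
\<close>

lemma eigenframes_connected:
  assumes V: "orthonormal N N V" and V': "orthonormal N N V'" and d: "0 \<le> d"
    and eig: "\<And>g j r. g \<in> \<G> \<Longrightarrow> j < N \<Longrightarrow> r < N \<Longrightarrow> mv N (D g) (V j) r = \<gamma> g j * V j r"
    and eig': "\<And>g j r. g \<in> \<G> \<Longrightarrow> j < N \<Longrightarrow> r < N \<Longrightarrow> mv N (D' g) (V' j) r = \<gamma>' g j * V' j r"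
    and star: "\<And>g. g \<in> \<G> \<Longrightarrow> st g \<in> \<G>"
      "\<And>g r s. g \<in> \<G> \<Longrightarrow> r < N \<Longrightarrow> s < N \<Longrightarrow> D (st g) r s = cnj (D g s r)"
      "\<And>g j. g \<in> \<G> \<Longrightarrow> j < N \<Longrightarrow> \<gamma> (st g) j = cnj (\<gamma> g j)"
    and DD': "\<And>g. g \<in> \<G> \<Longrightarrow> op_close N d (D g) (D' g)"
    and small: "d * (real N + 2) \<le> e" "real N * (10 ^ N * (d * (real N + 2))) \<le> e"
    and cL: "\<And>i. i \<in> I \<Longrightarrow> c i < L i"
    and lab: "labelling {..<N} I (\<lambda>j i. \<forall>g\<in>\<G>. cmod (\<gamma> g j - \<alpha> g i) \<le> e) L \<mu>"
      "labelling {..<N} I (\<lambda>j i. \<forall>g\<in>\<G>. cmod (\<gamma>' g j - \<alpha> g i) \<le> 2 * e) L \<mu>'"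
    and sel: "selection {..<N} I c \<mu> Q" "selection {..<N} I c \<mu>' Q'"
  shows "path_component {p. approx_family N I \<G> c D \<alpha> (3 * e) p} (projs N I V Q) (projs N I V' Q')"
proof -
  have e: "0 \<le> e" "d \<le> e" using d small(1) mult_left_mono[of 1 "real N + 2" d] by auto
  have adjD: "mv N (adj (D g)) w r = mv N (D (st g)) w r" if "g \<in> \<G>" "r < N" for g w r
    using star(2)[OF that(1)] that(2) by (simp add: mv_def adj_def)
  have eiga: "mv N (adj (D g)) (V j) r = cnj (\<gamma> g j) * V j r" if "g \<in> \<G>" "j < N" "r < N" for g j r
    using adjD eig star that by simp
  have app': "eig_err N (D g) (\<gamma>' g j) (V' j) \<le> d" if g: "g \<in> \<G>" and j: "j < N" for g j
  proof -
    have "eig_err N (D g) (\<gamma>' g j) (V' j) = nrm N (\<lambda>r. mv N (D g) (V' j) r - mv N (D' g) (V' j) r)"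
      using eig'[OF g j] by (intro nrm_cong) simp
    also have "\<dots> \<le> d * nrm N (V' j)" using DD'[OF g] by (simp add: op_close_def)
    finally show ?thesis using nrm_orthonormal[OF V' j] by simp
  qed
  obtain \<pi> where \<pi>: "bij_betw \<pi> {..<N} {..<N}"
    and \<pi>\<gamma>: "\<And>j g. j < N \<Longrightarrow> g \<in> \<G> \<Longrightarrow> cmod (\<gamma> g j - \<gamma>' g (\<pi> j)) \<le> d * (real N + 1)"
    using eigenframe_matching[of N V V' d \<G> D \<gamma> \<gamma>', OF V V' d eiga app'] by blast
  have \<pi>N: "\<pi> j < N" if "j < N" for j using bij_betw_apply[OF \<pi>] that by auto
  let ?W = "\<lambda>j. V' (\<pi> j)"
  have W: "orthonormal N N ?W" by (rule orthonormal_comp[OF V' \<pi>])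
  define d2 where "d2 = d * (real N + 2)"
  have d2: "0 \<le> d2" using d by (simp add: d2_def)
  have appW: "eig_err N (D g) (\<gamma> g j) (?W j) \<le> d2" if g: "g \<in> \<G>" and j: "j < N" for g j
  proof -
    have "eig_err N (D g) (\<gamma> g j) (?W j)
       \<le> eig_err N (D g) (\<gamma>' g (\<pi> j)) (?W j) + nrm N (\<lambda>r. \<gamma>' g (\<pi> j) * ?W j r - \<gamma> g j * ?W j r)"
      by (rule nrm_diff_triangle)
    also have "nrm N (\<lambda>r. \<gamma>' g (\<pi> j) * ?W j r - \<gamma> g j * ?W j r) = cmod (\<gamma>' g (\<pi> j) - \<gamma> g j)"
      using nrm_scale[of N "\<gamma>' g (\<pi> j) - \<gamma> g j" "?W j"] nrm_orthonormal[OF W j] by (simp add: left_diff_distrib)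
    also have "eig_err N (D g) (\<gamma>' g (\<pi> j)) (?W j) + cmod (\<gamma>' g (\<pi> j) - \<gamma> g j) \<le> d + d * (real N + 1)"
      using app'[OF g \<pi>N[OF j]] \<pi>\<gamma>[OF j g] by (intro add_mono) (auto simp: norm_minus_commute)
    also have "\<dots> = d2" by (simp add: d2_def algebra_simps)
    finally show ?thesis .
  qed
  define \<D> where "\<D> = (\<lambda>g. (D g, \<gamma> g)) ` \<G>"
  have "path_component {p. approx_family N I \<G> c D \<alpha> (3 * e) p} (projs N I V Q) (projs N I ?W Q)"
  proof (rule frame_path[where d = d2 and \<D> = \<D>, OF W d2 _ _ V])
    show "eig_err N B (\<beta> j) (?W j) \<le> d2" if "(B, \<beta>) \<in> \<D>" "j < N" for B \<beta> j
      using that appW by (auto simp: \<D>_def)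
    show "eig_err N (adj B) (cnj (\<beta> j)) (?W j) \<le> d2" if B: "(B, \<beta>) \<in> \<D>" and j: "j < N" for B \<beta> j
    proof -
      obtain g where g: "g \<in> \<G>" "B = D g" "\<beta> = \<gamma> g" using B by (auto simp: \<D>_def)
      have "eig_err N (adj B) (cnj (\<beta> j)) (?W j)
          = eig_err N (D (st g)) (\<gamma> (st g) j) (?W j)"
        by (intro nrm_cong) (simp add: g adjD star(3)[OF g(1) j])
      then show ?thesis using appW[OF star(1)[OF g(1)] j] by simp
    qed
    show "eig_err N B (\<beta> j) (V j) \<le> d2" if B: "(B, \<beta>) \<in> \<D>" and j: "j < N" for B \<beta> j
    proof -
      have "eig_err N B (\<beta> j) (V j) = 0"
        using B eig[OF _ j] by (auto simp: nrm_eq_0 \<D>_def)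
      then show ?thesis using d2 by simp
    qed
    show "Q i \<subseteq> {..<N}" if "i \<in> I" for i using sel(1) that by (auto simp: selection_def)
    fix U assume U: "orthonormal N N U" and appU: "\<And>B \<beta> j. (B, \<beta>) \<in> \<D> \<Longrightarrow> j < N \<Longrightarrow>
        eig_err N B (\<beta> j) (U j) \<le> 10 ^ N * d2"
    have "op_close N (3 * e) (D g) (diag_op N U (\<lambda>j. \<alpha> g (\<mu> j)))" if g: "g \<in> \<G>" for g
    proof -
      have "op_close N (real N * (10 ^ N * d2)) (D g) (diag_op N U (\<gamma> g))"
        unfolding op_close_def using g appU[of "D g" "\<gamma> g"]
        by (intro allI approx_eigenframe_op_bound[OF U]) (auto simp: \<D>_def)
      then have "op_close N e (D g) (diag_op N U (\<gamma> g))"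
        using small(2) by (auto simp: d2_def intro: op_close_mono)
      moreover have "op_close N e (diag_op N U (\<gamma> g)) (diag_op N U (\<lambda>j. \<alpha> g (\<mu> j)))"
        unfolding op_close_def using lab(1) g e by (intro allI diag_op_diff_le[OF U]) (auto simp: labelling_def)
      ultimately show ?thesis using e by (auto intro: op_close_mono[OF op_close_trans])
    qed
    then have "approx_family N I \<G> c D \<alpha> (3 * e) (projs N I U Q)"
      using U lab(1) sel(1) by (intro approx_familyI) (auto simp: labelling_def)
    then show "projs N I U Q \<in> {p. approx_family N I \<G> c D \<alpha> (3 * e) p}" by simp
  qed
  also have "projs N I ?W Q = projs N I V' (\<lambda>i. \<pi> ` Q i)"
    using \<pi> sel(1) by (intro projs_comp) (auto simp: selection_def bij_betw_def intro: inj_on_subset)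
  also have "path_component {p. approx_family N I \<G> c D \<alpha> (3 * e) p} (projs N I V' (\<lambda>i. \<pi> ` Q i)) (projs N I V' Q')"
  proof -
    define \<iota> where "\<iota> = the_inv_into {..<N} \<pi>"
    have \<iota>: "\<iota> (\<pi> j) = j" if "j < N" for j
      using \<pi> that by (auto simp: \<iota>_def bij_betw_def the_inv_into_f_f)
    have \<iota>2: "\<iota> m < N" "\<pi> (\<iota> m) = m" if "m < N" for m
    proof -
      have "m \<in> \<pi> ` {..<N}" using bij_betw_imp_surj_on[OF \<pi>] that by simp
      then obtain j where "j < N" "m = \<pi> j" by blast
      then show "\<iota> m < N" "\<pi> (\<iota> m) = m" using \<iota> by auto
    qed
    have img: "{m \<in> {..<N}. \<mu> (\<iota> m) = i} = \<pi> ` {j \<in> {..<N}. \<mu> j = i}" for i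
    proof (intro Set.set_eqI iffI)
      fix m assume "m \<in> {m \<in> {..<N}. \<mu> (\<iota> m) = i}"
      then show "m \<in> \<pi> ` {j \<in> {..<N}. \<mu> j = i}" using \<iota>2[of m] by (intro image_eqI[of _ _ "\<iota> m"]) auto
    qed (use \<iota> \<pi>N in auto)
    have inj: "inj_on \<pi> A" if "A \<subseteq> {..<N}" for A
      using bij_betw_imp_inj_on[OF \<pi>] that by (rule inj_on_subset)
    have lab': "labelling {..<N} I (\<lambda>j i. \<forall>g\<in>\<G>. cmod (\<gamma>' g j - \<alpha> g i) \<le> 2 * e) L (\<lambda>m. \<mu> (\<iota> m))"
      unfolding labelling_def
    proof (intro conjI ballI)
      fix m assume "m \<in> {..<N}"
      then have m: "\<iota> m < N" "\<pi> (\<iota> m) = m" using \<iota>2 by auto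
      show "\<mu> (\<iota> m) \<in> I" using lab(1) m by (auto simp: labelling_def)
      fix g assume g: "g \<in> \<G>"
      have "cmod (\<gamma>' g m - \<alpha> g (\<mu> (\<iota> m))) \<le> cmod (\<gamma> g (\<iota> m) - \<gamma>' g m) + cmod (\<gamma> g (\<iota> m) - \<alpha> g (\<mu> (\<iota> m)))"
        by (metis dist_norm dist_triangle3)
      also have "\<dots> \<le> d * (real N + 1) + e"
        using \<pi>\<gamma>[OF m(1) g] m lab(1) g by (intro add_mono) (auto simp: labelling_def)
      also have "\<dots> \<le> 2 * e" using small(1) d by (simp add: algebra_simps)
      finally show "cmod (\<gamma>' g m - \<alpha> g (\<mu> (\<iota> m))) \<le> 2 * e" .
    next
      fix i assume "i \<in> I"
      then show "card {m \<in> {..<N}. \<mu> (\<iota> m) = i} = L i"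
        unfolding img using lab(1) by (subst card_image[OF inj]) (auto simp: labelling_def)
    qed
    have sel': "selection {..<N} I c (\<lambda>m. \<mu> (\<iota> m)) (\<lambda>i. \<pi> ` Q i)"
      unfolding selection_def img
    proof (intro ballI conjI)
      fix i assume "i \<in> I"
      then have Qi: "Q i \<subseteq> {j \<in> {..<N}. \<mu> j = i}" "card (Q i) = c i" using sel(1) by (auto simp: selection_def)
      show "\<pi> ` Q i \<subseteq> \<pi> ` {j \<in> {..<N}. \<mu> j = i}" using Qi by blast
      show "card (\<pi> ` Q i) = c i" using Qi by (subst card_image[OF inj]) auto
    qed
    have "op_close N d (D g) (diag_op N V' (\<gamma>' g))" if g: "g \<in> \<G>" for g
    proof -
      have "op_close N (real N * 0) (D' g) (diag_op N V' (\<gamma>' g))"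
        unfolding op_close_def
      proof (intro allI approx_eigenframe_op_bound[OF V'])
        fix j assume "j < N"
        then have "eig_err N (D' g) (\<gamma>' g j) (V' j) = 0" by (simp add: nrm_eq_0 eig'[OF g])
        then show "eig_err N (D' g) (\<gamma>' g j) (V' j) \<le> 0" by simp
      qed
      from op_close_trans[OF DD'[OF g] this] show ?thesis by simp
    qed
    then show ?thesis
    proof (rule relabel_connected[OF V'])
      show "d + 2 * e \<le> 3 * e" "0 \<le> 2 * e" using e by simp_all
    qed (use cL lab' lab(2) sel' sel(2) in auto)
  qed
  finally (path_component_trans) show ?thesis .
qed

section \<open>Joining families along the interval\<close>

text \<open>
  Families of projections obtained from a frame of exact joint eigenvectors of the operators \<open>D g\<close>,
  labelled so that the eigenvalues of a vector with label \<open>i\<close> are within \<open>e\<close> of \<open>\<alpha> g i\<close>.  The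
  map \<open>st\<close> on the index set stands for taking adjoints.
\<close>

definition spectral_family :: "nat \<Rightarrow> 'i set \<Rightarrow> 'g set \<Rightarrow> ('g \<Rightarrow> 'g) \<Rightarrow> ('i \<Rightarrow> nat) \<Rightarrow> ('i \<Rightarrow> nat) \<Rightarrow>
    ('g \<Rightarrow> nat \<Rightarrow> nat \<Rightarrow> complex) \<Rightarrow> ('g \<Rightarrow> 'i \<Rightarrow> complex) \<Rightarrow> real \<Rightarrow> ('i \<Rightarrow> nat \<Rightarrow> nat \<Rightarrow> complex) \<Rightarrow> bool" where
  "spectral_family N I \<G> st c L D \<alpha> e p \<longleftrightarrow> (\<exists>V \<gamma> \<mu> Q. orthonormal N N V \<and>
     (\<forall>g\<in>\<G>. \<forall>j<N. \<forall>r<N. mv N (D g) (V j) r = \<gamma> g j * V j r) \<and>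
     (\<forall>g\<in>\<G>. \<forall>j<N. \<gamma> (st g) j = cnj (\<gamma> g j)) \<and>
     labelling {..<N} I (\<lambda>j i. \<forall>g\<in>\<G>. cmod (\<gamma> g j - \<alpha> g i) \<le> e) L \<mu> \<and>
     selection {..<N} I c \<mu> Q \<and> p = projs N I V Q)"

lemma spectral_families_connected:
  assumes p: "spectral_family N I \<G> st c L D \<alpha> e p" and p': "spectral_family N I \<G> st c L D' \<alpha>' e p'" and d: "0 \<le> d"
    and star: "\<And>g. g \<in> \<G> \<Longrightarrow> st g \<in> \<G>"
      "\<And>g r s. g \<in> \<G> \<Longrightarrow> r < N \<Longrightarrow> s < N \<Longrightarrow> D (st g) r s = cnj (D g s r)"
    and DD': "\<And>g. g \<in> \<G> \<Longrightarrow> op_close N d (D g) (D' g)"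
    and \<alpha>: "\<And>g i. g \<in> \<G> \<Longrightarrow> i \<in> I \<Longrightarrow> cmod (\<alpha> g i - \<alpha>' g i) \<le> e"
    and small: "d * (real N + 2) \<le> e" "real N * (10 ^ N * (d * (real N + 2))) \<le> e"
    and cL: "\<And>i. i \<in> I \<Longrightarrow> c i < L i"
  shows "path_component {p. approx_family N I \<G> c D \<alpha> (3 * e) p} p p'"
proof -
  obtain V \<gamma> \<mu> Q where V: "orthonormal N N V"
     "\<forall>g\<in>\<G>. \<forall>j<N. \<forall>r<N. mv N (D g) (V j) r = \<gamma> g j * V j r"
     "\<forall>g\<in>\<G>. \<forall>j<N. \<gamma> (st g) j = cnj (\<gamma> g j)"
     "labelling {..<N} I (\<lambda>j i. \<forall>g\<in>\<G>. cmod (\<gamma> g j - \<alpha> g i) \<le> e) L \<mu>"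
     "selection {..<N} I c \<mu> Q" "p = projs N I V Q"
    using p unfolding spectral_family_def by blast
  obtain V' \<gamma>' \<mu>' Q' where V': "orthonormal N N V'"
     "\<forall>g\<in>\<G>. \<forall>j<N. \<forall>r<N. mv N (D' g) (V' j) r = \<gamma>' g j * V' j r"
     "labelling {..<N} I (\<lambda>j i. \<forall>g\<in>\<G>. cmod (\<gamma>' g j - \<alpha>' g i) \<le> e) L \<mu>'"
     "selection {..<N} I c \<mu>' Q'" "p' = projs N I V' Q'"
    using p' unfolding spectral_family_def by blast
  have lab': "labelling {..<N} I (\<lambda>j i. \<forall>g\<in>\<G>. cmod (\<gamma>' g j - \<alpha> g i) \<le> 2 * e) L \<mu>'"
    unfolding labelling_def
  proof (intro conjI ballI)
    fix j g assume j: "j \<in> {..<N}" and g: "g \<in> \<G>"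
    have "\<mu>' j \<in> I" using V'(3) j by (auto simp: labelling_def)
    have "cmod (\<gamma>' g j - \<alpha> g (\<mu>' j)) \<le> cmod (\<gamma>' g j - \<alpha>' g (\<mu>' j)) + cmod (\<alpha> g (\<mu>' j) - \<alpha>' g (\<mu>' j))"
      by (metis dist_norm dist_triangle2)
    also have "\<dots> \<le> e + e"
      using V'(3) j g \<alpha>[OF g \<open>\<mu>' j \<in> I\<close>] by (intro add_mono) (auto simp: labelling_def)
    finally show "cmod (\<gamma>' g j - \<alpha> g (\<mu>' j)) \<le> 2 * e" by simp
  qed (use V'(3) in \<open>auto simp: labelling_def\<close>)
  show ?thesis unfolding V(6) V'(5)
  proof (rule eigenframes_connected[OF V(1) V'(1) d])
    show "mv N (D g) (V j) r = \<gamma> g j * V j r" if "g \<in> \<G>" "j < N" "r < N" for g j r using V(2) that by blast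
    show "mv N (D' g) (V' j) r = \<gamma>' g j * V' j r" if "g \<in> \<G>" "j < N" "r < N" for g j r using V'(2) that by blast
    show "\<gamma> (st g) j = cnj (\<gamma> g j)" if "g \<in> \<G>" "j < N" for g j using V(3) that by blast
  qed (fact | use star DD' small cL V(4,5) lab' V'(4) in blast)+
qed

lemma uniform_near_point:
  fixes f :: "'k \<Rightarrow> real \<Rightarrow> complex"
  assumes "finite K" "\<And>k. k \<in> K \<Longrightarrow> continuous_on {0..1} (f k)" "x \<in> {0..1}" "0 < d"
  shows "\<exists>\<delta>>0. \<forall>y\<in>{0..1}. \<bar>y - x\<bar> < \<delta> \<longrightarrow> (\<forall>k\<in>K. cmod (f k y - f k x) \<le> d)"
proof -
  have "\<forall>k\<in>K. \<exists>\<delta>>0. \<forall>y\<in>{0..1}. \<bar>y - x\<bar> < \<delta> \<longrightarrow> cmod (f k y - f k x) \<le> d"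
    using assms(2-4) unfolding continuous_on_iff dist_norm real_norm_def by (meson less_imp_le)
  from bchoice[OF this] obtain \<delta> where
    \<delta>: "\<forall>k\<in>K. 0 < \<delta> k \<and> (\<forall>y\<in>{0..1}. \<bar>y - x\<bar> < \<delta> k \<longrightarrow> cmod (f k y - f k x) \<le> d)" by blast
  show ?thesis
  proof (cases "K = {}")
    case True
    then show ?thesis by (intro exI[of _ 1]) auto
  next
    case False
    then have "0 < Min (\<delta> ` K)" using \<delta> assms(1) by (subst Min_gr_iff) auto
    moreover have "Min (\<delta> ` K) \<le> \<delta> k" if "k \<in> K" for k using assms(1) that by (intro Min_le) auto
    ultimately show ?thesis using \<delta> by (intro exI[of _ "Min (\<delta> ` K)"]) fastforce
  qed
qed

text \<open>
  If spectral families exist at every point of the interval, then any two of them at the end points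
  are joined by a continuous path whose value at \<open>y\<close> is an approximate family at \<open>y\<close>.  The size of
  a neighbourhood on which bisection stops depends on \<open>N\<close> and on the moduli of continuity of \<open>D\<close> and \<open>\<alpha>\<close>, but the
  bound \<open>5 * e\<close> does not.
\<close>

theorem spectral_families_joined:
  fixes D :: "'g \<Rightarrow> real \<Rightarrow> nat \<Rightarrow> nat \<Rightarrow> complex" and \<alpha> :: "'g \<Rightarrow> 'i \<Rightarrow> real \<Rightarrow> complex"
  assumes fin: "finite \<G>" "finite I" and e: "0 < e"
    and contD: "\<And>g r s. g \<in> \<G> \<Longrightarrow> r < N \<Longrightarrow> s < N \<Longrightarrow> continuous_on {0..1} (\<lambda>y. D g y r s)"
    and cont\<alpha>: "\<And>g i. g \<in> \<G> \<Longrightarrow> i \<in> I \<Longrightarrow> continuous_on {0..1} (\<alpha> g i)"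
    and star: "\<And>g. g \<in> \<G> \<Longrightarrow> st g \<in> \<G>"
      "\<And>g y r s. g \<in> \<G> \<Longrightarrow> y \<in> {0..1} \<Longrightarrow> r < N \<Longrightarrow> s < N \<Longrightarrow> D (st g) y r s = cnj (D g y s r)"
    and cL: "\<And>i. i \<in> I \<Longrightarrow> c i < L i"
    and ex: "\<And>y. y \<in> {0..1} \<Longrightarrow> \<exists>p. spectral_family N I \<G> st c L (\<lambda>g. D g y) (\<lambda>g i. \<alpha> g i y) e p"
    and p0: "spectral_family N I \<G> st c L (\<lambda>g. D g 0) (\<lambda>g i. \<alpha> g i 0) e p0"
    and p1: "spectral_family N I \<G> st c L (\<lambda>g. D g 1) (\<lambda>g i. \<alpha> g i 1) e p1"
  shows "\<exists>q. continuous_on {0..1} q \<and> q 0 = p0 \<and> q 1 = p1 \<and>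
     (\<forall>y\<in>{0..1}. approx_family N I \<G> c (\<lambda>g. D g y) (\<lambda>g i. \<alpha> g i y) (5 * e) (q y))"
proof -
  let ?fam = "\<lambda>y. spectral_family N I \<G> st c L (\<lambda>g. D g y) (\<lambda>g i. \<alpha> g i y) e"
  let ?good = "\<lambda>y. approx_family N I \<G> c (\<lambda>g. D g y) (\<lambda>g i. \<alpha> g i y)"
  let ?P = "\<lambda>a b. 0 \<le> a \<longrightarrow> b \<le> 1 \<longrightarrow> a < b \<longrightarrow> (\<forall>p p'. ?fam a p \<longrightarrow> ?fam b p' \<longrightarrow>
      (\<exists>q. continuous_on {a..b} q \<and> q a = p \<and> q b = p' \<and> (\<forall>y\<in>{a..b}. ?good y (5 * e) (q y))))"
  \<comment> \<open>\<open>d\<close> is so small that an error \<open>d\<close> in each operator, amplified by \<open>N\<close> steps with factor 10 and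
    by the passage from single eigenvectors to the operator norm, stays below \<open>e\<close>\<close>
  define M where "M = real N * 10 ^ N + 1"
  have M: "M \<ge> 1" by (simp add: M_def)
  define d where "d = e / (M * (real N + 2))"
  have d: "0 < d" using e M by (simp add: d_def)
  have dM: "d * (real N + 2) = e / M"
  proof -
    have "real N + 2 \<noteq> 0" by linarith
    then show ?thesis by (simp add: d_def)
  qed
  have small: "d * (real N + 2) \<le> e" "real N * (10 ^ N * (d * (real N + 2))) \<le> e"
  proof -
    show "d * (real N + 2) \<le> e" unfolding dM using e M by (simp add: divide_le_eq)
    have "real N * (10 ^ N * (e / M)) = (real N * 10 ^ N) * e / M" by simp
    also have "\<dots> \<le> M * e / M" using e M by (intro divide_right_mono mult_right_mono) (auto simp: M_def)
    finally show "real N * (10 ^ N * (d * (real N + 2))) \<le> e" unfolding dM using M by simp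
  qed
  have "d * 1 \<le> d * (real N + 2)" using d by (intro mult_left_mono) auto
  then have de: "d \<le> e" using small(1) by linarith
  have "?P u v" if uv: "u \<le> v" "0 \<le> u" "v \<le> 1" for u v
    using uv(1)
  proof (induction rule: Bolzano)
    case (trans a b c)
    show ?case
    proof (intro impI allI)
      fix p p' assume ac: "0 \<le> a" "c \<le> 1" "a < c" and pp': "?fam a p" "?fam c p'"
      consider "a = b" | "b = c" | "a < b" "b < c" using trans by linarith
      then show "\<exists>q. continuous_on {a..c} q \<and> q a = p \<and> q c = p' \<and> (\<forall>y\<in>{a..c}. ?good y (5 * e) (q y))"
      proof cases
        case 1
        then show ?thesis using trans ac pp' by blast
      next
        case 2
        then show ?thesis using trans ac pp' by blast
      next
        case 3
        have "b \<in> {0..1}" using 3 ac by simp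
        then obtain pb where pb: "?fam b pb" using ex by blast
        obtain q1 where q1: "continuous_on {a..b} q1" "q1 a = p" "q1 b = pb" "\<forall>y\<in>{a..b}. ?good y (5 * e) (q1 y)"
          using trans(1) ac 3 pp'(1) pb by fastforce
        obtain q2 where q2: "continuous_on {b..c} q2" "q2 b = pb" "q2 c = p'" "\<forall>y\<in>{b..c}. ?good y (5 * e) (q2 y)"
          using trans(2) ac 3 pp'(2) pb by fastforce
        have "continuous_on ({a..b} \<union> {b..c}) (\<lambda>y. if y \<le> b then q1 y else q2 y)"
          using q1(1,3) q2(1,2) by (intro continuous_on_If) (auto intro: arg_cong dest: antisym)
        moreover have "{a..b} \<union> {b..c} = {a..c}" using 3 by auto
        ultimately show ?thesis using q1 q2 3
          by (intro exI[of _ "\<lambda>y. if y \<le> b then q1 y else q2 y"]) auto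
      qed
    qed
  next
    case (local x)
    then have x: "x \<in> {0..1}" using uv by simp
    define d' where "d' = d / ((real N)\<^sup>2 + 1)"
    have d': "0 < d'" using d unfolding d'_def by (intro divide_pos_pos add_nonneg_pos) auto
    have fD: "finite (\<G> \<times> {..<N} \<times> {..<N})" using fin by simp
    obtain \<delta>1 where \<delta>1: "0 < \<delta>1" "\<And>y k. y \<in> {0..1} \<Longrightarrow> \<bar>y - x\<bar> < \<delta>1 \<Longrightarrow> k \<in> \<G> \<times> {..<N} \<times> {..<N} \<Longrightarrow>
        cmod (D (fst k) y (fst (snd k)) (snd (snd k)) - D (fst k) x (fst (snd k)) (snd (snd k))) \<le> d'"
      using uniform_near_point[OF fD, of "\<lambda>k y. D (fst k) y (fst (snd k)) (snd (snd k))", OF _ x d'] contD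
      by auto
    have f\<alpha>: "finite (\<G> \<times> I)" using fin by simp
    obtain \<delta>2 where \<delta>2: "0 < \<delta>2" "\<And>y k. y \<in> {0..1} \<Longrightarrow> \<bar>y - x\<bar> < \<delta>2 \<Longrightarrow> k \<in> \<G> \<times> I \<Longrightarrow>
        cmod (\<alpha> (fst k) (snd k) y - \<alpha> (fst k) (snd k) x) \<le> e"
      using uniform_near_point[OF f\<alpha>, of "\<lambda>k. \<alpha> (fst k) (snd k)", OF _ x e] cont\<alpha> by auto
    define \<delta> where "\<delta> = min \<delta>1 \<delta>2"
    have closeD: "op_close N d (D g y) (D g x)" if y: "y \<in> {0..1}" "\<bar>y - x\<bar> < \<delta>" and g: "g \<in> \<G>" for y g
      unfolding op_close_def
    proof
      fix w
      have "nrm N (\<lambda>r. mv N (D g y) w r - mv N (D g x) w r) = nrm N (mv N (\<lambda>r s. D g y r s - D g x r s) w)"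
        by (simp add: mv_def left_diff_distrib sum_subtractf)
      also have "\<dots> \<le> (real N)\<^sup>2 * d' * nrm N w"
        using y g \<delta>1(2)[of y] by (intro nrm_mv_entries_le) (force simp: \<delta>_def)
      also have "\<dots> \<le> d * nrm N w"
      proof (rule mult_right_mono)
        have n: "(real N)\<^sup>2 + 1 \<noteq> 0" using zero_le_power2[of "real N"] by linarith
        have "(real N)\<^sup>2 * d' \<le> ((real N)\<^sup>2 + 1) * d'" using d' by (intro mult_right_mono) auto
        also have "\<dots> = d" unfolding d'_def using n by simp
        finally show "(real N)\<^sup>2 * d' \<le> d" .
      qed simp
      finally show "nrm N (\<lambda>r. mv N (D g y) w r - mv N (D g x) w r) \<le> d * nrm N w" .
    qed
    have close\<alpha>: "cmod (\<alpha> g i y - \<alpha> g i x) \<le> e" if "y \<in> {0..1}" "\<bar>y - x\<bar> < \<delta>" "g \<in> \<G>" "i \<in> I" for y g i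
      using \<delta>2(2)[of y "(g, i)"] that by (simp add: \<delta>_def)
    obtain px where px: "?fam x px" using ex[OF x] by blast
    have conn: "path_component {p. ?good x (3 * e) p} px p" if y: "y \<in> {0..1}" "\<bar>y - x\<bar> < \<delta>" and p: "?fam y p" for y p
    proof (rule spectral_families_connected[OF px p, of d])
      show "op_close N d (D g x) (D g y)" if "g \<in> \<G>" for g by (rule op_close_sym[OF closeD[OF y that]])
      show "cmod (\<alpha> g i x - \<alpha> g i y) \<le> e" if "g \<in> \<G>" "i \<in> I" for g i
        using close\<alpha>[OF y that] by (simp add: norm_minus_commute)
    qed (use d star x small cL in auto)
    show ?case
    proof (intro exI[of _ \<delta>] conjI allI impI)
      show "0 < \<delta>" using \<delta>1(1) \<delta>2(1) by (simp add: \<delta>_def)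
      fix a b p p' assume ab: "a \<le> x \<and> x \<le> b \<and> b - a < \<delta>" "0 \<le> a" "b \<le> 1" "a < b" and pp': "?fam a p" "?fam b p'"
      have "path_component {p. ?good x (3 * e) p} p p'"
        using conn[of a p] conn[of b p'] ab pp'
        by (auto intro: path_component_trans path_component_sym)
      then obtain h where h: "path h" "path_image h \<subseteq> {p. ?good x (3 * e) p}" "pathstart h = p" "pathfinish h = p'"
        by (auto simp: path_component_def)
      define q where "q = (\<lambda>y. h ((y - a) / (b - a)))"
      have unit: "(y - a) / (b - a) \<in> {0..1}" if "y \<in> {a..b}" for y using that ab by (auto simp: divide_le_eq)
      have "continuous_on {a..b} (h \<circ> (\<lambda>y. (y - a) / (b - a)))"
      proof (rule continuous_on_compose)
        show "continuous_on {a..b} (\<lambda>y. (y - a) / (b - a))" using ab by (intro continuous_intros) auto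
        show "continuous_on ((\<lambda>y. (y - a) / (b - a)) ` {a..b}) h"
          using h(1) unit unfolding path_def by (auto intro: continuous_on_subset)
      qed
      then have "continuous_on {a..b} q" by (simp add: q_def o_def)
      moreover have "q a = p" "q b = p'" using h(3,4) ab by (auto simp: q_def pathstart_def pathfinish_def)
      moreover have "?good y (5 * e) (q y)" if y: "y \<in> {a..b}" for y
      proof -
        have "q y \<in> path_image h" using unit[OF y] by (auto simp: q_def path_image_def)
        then have g: "?good x (3 * e) (q y)" using h(2) by auto
        have y': "y \<in> {0..1}" "\<bar>y - x\<bar> < \<delta>" using y ab by auto
        have "?good y (e + 3 * e + e) (q y)"
          using closeD[OF y'] close\<alpha>[OF y'] de e
          by (intro approx_family_perturb[OF g]) (auto intro: op_close_mono simp: norm_minus_commute)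
        then show ?thesis by simp
      qed
      ultimately show "\<exists>q. continuous_on {a..b} q \<and> q a = p \<and> q b = p' \<and> (\<forall>y\<in>{a..b}. ?good y (5 * e) (q y))"
        by blast
    qed
  qed
  from this[of 0 1] show ?thesis using p0 p1 by simp
qed

section \<open>Spectra and ampliated eigenbases\<close>

text \<open>
  The entries of a matrix as a function of two indices.
\<close>

definition entries :: "complex Matrix.mat \<Rightarrow> nat \<Rightarrow> nat \<Rightarrow> complex" where
  "entries A = (\<lambda>r s. A $$ (r, s))"

lemma entries_mult:
  "A \<in> carrier_mat N N \<Longrightarrow> B \<in> carrier_mat N N \<Longrightarrow> r < N \<Longrightarrow> s < N \<Longrightarrow>
    entries (A * B) r s = (\<Sum>t<N. entries A r t * entries B t s)"
  by (simp add: entries_def scalar_prod_def atLeast0LessThan)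

lemma entries_adjoint:
  "A \<in> carrier_mat N N \<Longrightarrow> r < N \<Longrightarrow> s < N \<Longrightarrow> entries (mat_adjoint A) r s = cnj (entries A s r)"
  by (simp add: entries_def mat_adjoint_def mat_of_rows_def)

lemma rank_nonzero_entry:
  assumes "A \<in> carrier_mat N N" "vec_space.rank N A \<noteq> (0::nat)"
  shows "\<exists>r<N. \<exists>s<N. entries A r s \<noteq> (0::complex)"
proof (rule ccontr)
  assume "\<not> ?thesis"
  then have "A = 0\<^sub>m N N" using assms(1) by (intro eq_matI) (auto simp: entries_def)
  moreover have "vec_space.rank N (0\<^sub>m N N :: complex mat) = 0" by (rule vec_space.rank_0I)
  ultimately show False using assms(2) by simp
qed

lemma ip_normalized:
  assumes "nrm N w \<noteq> 0" "c = of_real (inverse (nrm N w))"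
  shows "ip N (\<lambda>r. c * w r) (\<lambda>r. c * w r) = 1"
proof -
  have "ip N (\<lambda>r. c * w r) (\<lambda>r. c * w r) = of_real (inverse (nrm N w) * (inverse (nrm N w) * (nrm N w)\<^sup>2))"
    unfolding ip_scale_left ip_scale_right ip_self assms(2) by simp
  also have "inverse (nrm N w) * (inverse (nrm N w) * (nrm N w)\<^sup>2) = 1"
    using assms(1) by (simp add: power2_eq_square field_simps)
  finally show ?thesis by simp
qed

lemma eigenframe_coefficient:
  assumes V: "orthonormal N N V" and eig: "\<And>j r. j < N \<Longrightarrow> r < N \<Longrightarrow> mv N B (V j) r = \<beta> j * V j r"
  shows "r < N \<Longrightarrow> mv N B x r = (\<Sum>j<N. (\<beta> j * ip N (V j) x) * V j r)"
    and "j < N \<Longrightarrow> ip N (V j) (mv N B x) = \<beta> j * ip N (V j) x"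
proof -
  have diag: "mv N B x r = (\<Sum>j<N. (\<beta> j * ip N (V j) x) * V j r)" if "r < N" for r
  proof -
    have "mv N B x r = mv N B (\<lambda>t. \<Sum>j<N. ip N (V j) x * V j t) r"
      by (rule fun_cong[OF mv_cong]) (rule orthonormal_expand[OF V])
    also have "\<dots> = (\<Sum>j<N. ip N (V j) x * mv N B (V j) r)" by (simp add: mv_sum mv_scale)
    also have "\<dots> = (\<Sum>j<N. (\<beta> j * ip N (V j) x) * V j r)"
      using eig that by (intro sum.cong) auto
    finally show ?thesis .
  qed
  then show "r < N \<Longrightarrow> mv N B x r = (\<Sum>j<N. (\<beta> j * ip N (V j) x) * V j r)" .
  assume j: "j < N"
  have "ip N (V j) (mv N B x) = ip N (V j) (\<lambda>r. \<Sum>j<N. (\<beta> j * ip N (V j) x) * V j r)"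
    using diag by (intro ip_cong) auto
  then show "ip N (V j) (mv N B x) = \<beta> j * ip N (V j) x" using ip_frame_sum[OF V j] by simp
qed

text \<open>
  A nonzero column of each of the rank one projections, normalised, gives an eigenframe.
\<close>

lemma spectrum_eigenframe:
  assumes "is_spectrum X N \<phi> y xs"
  shows "\<exists>V. orthonormal N N V \<and>
     (\<forall>f\<in>cont_alg X. \<forall>j<N. \<forall>r<N. mv N (entries (\<phi> f y)) (V j) r = f (xs ! j) * V j r)"
proof -
  obtain q where q0: "(\<forall>j<N. projection_mat N (q j) \<and> vec_space.rank N (q j) = 1) \<and>
      (\<forall>i<N. \<forall>j<N. i \<noteq> j \<longrightarrow> q i * q j = 0\<^sub>m N N) \<and> msum N q {..<N} = 1\<^sub>m N \<and>
      (\<forall>f\<in>cont_alg X. \<phi> f y = msum N (\<lambda>j. f (xs ! j) \<cdot>\<^sub>m q j) {..<N})"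
    using assms unfolding is_spectrum_def by (elim conjE exE) (rule that, intro conjI)
  have q: "\<And>j. j < N \<Longrightarrow> projection_mat N (q j)" "\<And>j. j < N \<Longrightarrow> vec_space.rank N (q j) = 1"
    "\<And>i j. i < N \<Longrightarrow> j < N \<Longrightarrow> i \<noteq> j \<Longrightarrow> q i * q j = 0\<^sub>m N N"
    and \<phi>: "\<And>f. f \<in> cont_alg X \<Longrightarrow> \<phi> f y = msum N (\<lambda>j. f (xs ! j) \<cdot>\<^sub>m q j) {..<N}"
    using q0 by simp_all
  have qc: "q j \<in> carrier_mat N N" "q j * q j = q j" "mat_adjoint (q j) = q j" if "j < N" for j
    using q(1)[OF that] by (auto simp: projection_mat_def)
  have qq: "(\<Sum>t<N. entries (q i) r t * entries (q j) t s) = (if i = j then entries (q j) r s else 0)"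
    if "i < N" "j < N" "r < N" "s < N" for i j r s
  proof (cases "i = j")
    case True
    then show ?thesis using entries_mult[OF qc(1) qc(1), of j j r s] qc(2)[of j] that by simp
  next
    case False
    then show ?thesis
      using entries_mult[OF qc(1) qc(1), of i j r s] q(3)[of i j] that by (simp add: entries_def)
  qed
  have "\<forall>j\<in>{..<N}. \<exists>s<N. \<exists>r<N. entries (q j) r s \<noteq> 0"
  proof
    fix j assume "j \<in> {..<N}"
    then have j: "j < N" by simp
    have "vec_space.rank N (q j) \<noteq> 0" using q(2)[OF j] by simp
    from rank_nonzero_entry[OF qc(1)[OF j] this] show "\<exists>s<N. \<exists>r<N. entries (q j) r s \<noteq> 0" by blast
  qed
  from bchoice[OF this] obtain sc where sc: "\<And>j. j < N \<Longrightarrow> sc j < N \<and> (\<exists>r<N. entries (q j) r (sc j) \<noteq> 0)"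
    by auto
  define w where "w = (\<lambda>j r. entries (q j) r (sc j))"
  have nw: "nrm N (w j) \<noteq> 0" if "j < N" for j using sc[OF that] by (auto simp: nrm_eq_0 w_def)
  have qw: "mv N (entries (q i)) (w j) r = (if i = j then w j r else 0)" if "i < N" "j < N" "r < N" for i j r
    using qq[OF that, of "sc j"] sc[OF that(2)] by (simp add: mv_def w_def)
  define V where "V = (\<lambda>j r. of_real (inverse (nrm N (w j))) * w j r)"
  have qV: "mv N (entries (q i)) (V j) r = (if i = j then V j r else 0)" if "i < N" "j < N" "r < N" for i j r
    using qw[OF that] unfolding V_def mv_scale by simp
  have "ip N (V i) (V j) = (if i = j then 1 else 0)" if ij: "i < N" "j < N" for i j
  proof (cases "i = j")
    case True
    have "ip N (V j) (V j) = 1" unfolding V_def by (rule ip_normalized[OF nw[OF ij(2)] refl])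
    then show ?thesis using True by simp
  next
    case False
    have "ip N (V i) (V j) = ip N (mv N (adj (entries (q i))) (V i)) (V j)"
    proof (rule ip_cong)
      fix r assume r: "r < N"
      have "mv N (adj (entries (q i))) (V i) r = mv N (entries (q i)) (V i) r"
        unfolding mv_def adj_def
      proof (intro sum.cong refl)
        fix s assume "s \<in> {..<N}"
        then have "entries (mat_adjoint (q i)) r s = cnj (entries (q i) s r)"
          using entries_adjoint[OF qc(1)[OF ij(1)] r] by simp
        then show "cnj (entries (q i) s r) * V i s = entries (q i) r s * V i s"
          unfolding qc(3)[OF ij(1)] by simp
      qed
      then show "V i r = mv N (adj (entries (q i))) (V i) r" using qV[OF ij(1) ij(1) r] by simp
    qed simp
    also have "\<dots> = ip N (V i) (mv N (entries (q i)) (V j))" by (rule ip_mv[symmetric])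
    also have "\<dots> = ip N (V i) (\<lambda>r. 0)" using qV ij False by (intro ip_cong) auto
    finally show ?thesis using False by (simp add: ip_def)
  qed
  moreover have "mv N (entries (\<phi> f y)) (V j) r = f (xs ! j) * V j r"
    if f: "f \<in> cont_alg X" and j: "j < N" and r: "r < N" for f j r
  proof -
    have "entries (\<phi> f y) r s = (\<Sum>i<N. f (xs ! i) * entries (q i) r s)" if "s < N" for s
    proof -
      have "entries (\<phi> f y) r s = (\<Sum>i<N. (f (xs ! i) \<cdot>\<^sub>m q i) $$ (r, s))"
        unfolding \<phi>[OF f] entries_def msum_def using r that by simp
      also have "\<dots> = (\<Sum>i<N. f (xs ! i) * entries (q i) r s)"
      proof (intro sum.cong refl)
        fix i assume "i \<in> {..<N}"
        then have "dim_row (q i) = N" "dim_col (q i) = N" using qc(1)[of i] by auto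
        then show "(f (xs ! i) \<cdot>\<^sub>m q i) $$ (r, s) = f (xs ! i) * entries (q i) r s"
          using r that by (simp add: entries_def)
      qed
      finally show ?thesis .
    qed
    then have "mv N (entries (\<phi> f y)) (V j) r = (\<Sum>s<N. \<Sum>i<N. f (xs ! i) * (entries (q i) r s * V j s))"
      by (simp add: mv_def sum_distrib_right mult.assoc)
    also have "\<dots> = (\<Sum>i<N. f (xs ! i) * mv N (entries (q i)) (V j) r)"
      by (subst sum.swap) (simp add: mv_def sum_distrib_left)
    also have "\<dots> = (\<Sum>i<N. if i = j then f (xs ! j) * V j r else 0)"
      using qV j r by (intro sum.cong) auto
    finally show ?thesis using j by simp
  qed
  ultimately show ?thesis unfolding orthonormal_def by blast
qed

lemma sum_blocks:
  fixes f :: "nat \<Rightarrow> 'b::comm_monoid_add"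
  shows "(\<Sum>q<n*k. f q) = (\<Sum>i<n. \<Sum>r<k. f (i * k + r))"
proof -
  have "sum f {i * k..<i * k + k} = (\<Sum>r<k. f (i * k + r))" for i
    using sum.shift_bounds_nat_ivl[of f 0 "i * k" k] by (simp add: atLeast0LessThan add.commute)
  then show ?thesis using sum.nat_group[of f k n] by simp
qed

lemma block_index_less: "i < (n::nat) \<Longrightarrow> r < k \<Longrightarrow> i * k + r < n * k"
proof -
  assume i: "i < n" and r: "r < k"
  have "i * k + r < Suc i * k" using r by simp
  also have "\<dots> \<le> n * k" using i by (intro mult_right_mono) auto
  finally show ?thesis .
qed

text \<open>
  The vector \<open>u \<otimes> e\<^sub>\<kappa>\<close> of \<open>\<complex>\<^sup>n \<otimes> \<complex>\<^sup>k\<close>, where the index \<open>i * k + r\<close> stands for the pair \<open>(i, r)\<close>.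
\<close>

definition ampliate :: "nat \<Rightarrow> (nat \<Rightarrow> complex) \<Rightarrow> nat \<Rightarrow> nat \<Rightarrow> complex" where
  "ampliate k u \<kappa> = (\<lambda>q. if q mod k = \<kappa> then u (q div k) else 0)"

lemma ip_ampliate:
  assumes "\<kappa> < k" "\<kappa>' < k"
  shows "ip (n * k) (ampliate k u \<kappa>) (ampliate k u' \<kappa>') = (if \<kappa> = \<kappa>' then ip n u u' else 0)"
proof -
  have "ip (n * k) (ampliate k u \<kappa>) (ampliate k u' \<kappa>') = (\<Sum>i<n. \<Sum>r<k. if r = \<kappa> then (if \<kappa> = \<kappa>' then cnj (u i) * u' i else 0) else 0)"
    unfolding ip_def sum_blocks by (intro sum.cong refl) (auto simp: ampliate_def)
  then show ?thesis using assms by (simp add: ip_def)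
qed

lemma nrm_ampliate: "\<kappa> < k \<Longrightarrow> nrm (n * k) (ampliate k u \<kappa>) = nrm n u"
proof -
  assume \<kappa>: "\<kappa> < k"
  have "(nrm (n * k) (ampliate k u \<kappa>))\<^sup>2 = (nrm n u)\<^sup>2"
    using ip_ampliate[OF \<kappa> \<kappa>, of n u u] by (intro nrm_power2_eqI) (simp add: ip_self)
  then show ?thesis by (simp add: power2_eq_iff_nonneg)
qed

lemma mv_ampliate:
  assumes B: "\<And>p q. p < n * k \<Longrightarrow> q < n * k \<Longrightarrow> B p q = (if p mod k = q mod k then b (p div k) (q div k) else 0)"
    and "\<kappa> < k" "p < n * k"
  shows "mv (n * k) B (ampliate k u \<kappa>) p = ampliate k (mv n b u) \<kappa> p"
proof -
  have "mv (n * k) B (ampliate k u \<kappa>) p = (\<Sum>i<n. \<Sum>r<k. if r = \<kappa> then (if p mod k = \<kappa> then b (p div k) i * u i else 0) else 0)"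
    unfolding mv_def sum_blocks
  proof (intro sum.cong refl)
    fix i r assume "i \<in> {..<n}" "r \<in> {..<k}"
    then have ir: "i < n" "r < k" by auto
    then have "i * k + r < n * k" by (rule block_index_less)
    then show "B p (i * k + r) * ampliate k u \<kappa> (i * k + r) = (if r = \<kappa> then (if p mod k = \<kappa> then b (p div k) i * u i else 0) else 0)"
      using ir assms by (auto simp: ampliate_def)
  qed
  then show ?thesis using assms by (simp add: ampliate_def mv_def)
qed

text \<open>
  If the operators \<open>\<Phi> f = \<psi> f \<otimes> 1\<close> are diagonal in a frame with eigenvalues \<open>f (pt j)\<close>, then the
  operators \<open>\<psi> f\<close> have orthonormal joint eigenvectors \<open>u j\<close> with eigenvalues \<open>f (z j)\<close>.  In the
  induction step, a vector \<open>w\<close> orthogonal to the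
  eigenvectors found so far is replaced by its image under \<open>\<psi> h\<close>, where \<open>h\<close> vanishes on all
  points of the spectrum except one; \<open>\<psi> h\<close> is self-adjoint, so the image is still orthogonal to them.
\<close>

lemma joint_eigenbasis_of_block:
  fixes X :: "'a::metric_space set"
  assumes k: "0 < k" and V: "orthonormal (n * k) (n * k) V"
    and eig: "\<And>f j r. f \<in> cont_alg X \<Longrightarrow> j < n * k \<Longrightarrow> r < n * k \<Longrightarrow> mv (n * k) (\<Phi> f) (V j) r = f (pt j) * V j r"
    and star: "\<And>f r s. f \<in> cont_alg X \<Longrightarrow> r < n * k \<Longrightarrow> s < n * k \<Longrightarrow> \<Phi> (\<lambda>x. cnj (f x)) r s = cnj (\<Phi> f s r)"
    and block: "\<And>f p q. f \<in> cont_alg X \<Longrightarrow> p < n * k \<Longrightarrow> q < n * k \<Longrightarrow>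
        \<Phi> f p q = (if p mod k = q mod k then \<psi> f (p div k) (q div k) else 0)"
  shows "m \<le> n \<Longrightarrow> \<exists>u z. orthonormal n m u \<and>
     (\<forall>f\<in>cont_alg X. \<forall>j<m. \<forall>i<n. mv n (\<psi> f) (u j) i = f (z j) * u j i)"
proof (induction m)
  case 0
  then show ?case by (auto simp: orthonormal_def)
next
  case (Suc m)
  let ?N = "n * k"
  obtain u z where u: "orthonormal n m u"
    and uz: "\<And>f j i. f \<in> cont_alg X \<Longrightarrow> j < m \<Longrightarrow> i < n \<Longrightarrow> mv n (\<psi> f) (u j) i = f (z j) * u j i"
  proof -
    have "m \<le> n" using Suc.prems by simp
    from Suc.IH[OF this] show ?thesis using that by blast
  qed
  have psi: "mv n (\<psi> f) w i = mv ?N (\<Phi> f) (ampliate k w 0) (i * k)" if "f \<in> cont_alg X" "i < n" for f w i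
  proof -
    have "i * k < ?N" using that k by simp
    then show ?thesis
      using mv_ampliate[of n k "\<Phi> f" "\<psi> f", OF block[OF that(1)] k, of "i * k" w] k by (simp add: ampliate_def)
  qed
  obtain w where w: "nrm n w \<noteq> 0" "\<And>j. j < m \<Longrightarrow> ip n (u j) w = 0"
    using orthonormal_extend[OF u] Suc.prems by auto
  let ?W = "ampliate k w 0"
  have "nrm ?N ?W \<noteq> 0" using w nrm_ampliate[OF k] by simp
  then have "(\<Sum>j<?N. (cmod (ip ?N (V j) ?W))\<^sup>2) \<noteq> 0" using parseval[OF V, of ?W] by auto
  then obtain j0 where j0: "j0 < ?N" "ip ?N (V j0) ?W \<noteq> 0"
    by (metis (no_types, lifting) lessThan_iff norm_zero power_zero_numeral sum.neutral)
  define Z where "Z = pt ` {..<?N}"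
  have Z: "finite Z" "pt j0 \<in> Z" using j0 by (auto simp: Z_def)
  \<comment> \<open>a continuous function that separates the chosen point from the rest of the spectrum\<close>
  define h :: "'a \<Rightarrow> complex" where "h = (\<lambda>x. of_real (\<Prod>v\<in>Z - {pt j0}. dist x v))"
  have h: "h \<in> cont_alg X" unfolding h_def cont_alg_def by (auto intro!: continuous_intros)
  have hcnj: "(\<lambda>x. cnj (h x)) = h" by (simp add: h_def)
  have h0: "h (pt j0) \<noteq> 0" using Z by (simp add: h_def)
  have hz: "h (pt j) = 0" if "j < ?N" "pt j \<noteq> pt j0" for j
    using Z that by (auto simp: h_def Z_def intro!: prod_zero bexI[of _ "pt j"])
  have diag: "mv ?N (\<Phi> f) x r = (\<Sum>j<?N. (f (pt j) * ip ?N (V j) x) * V j r)" if "f \<in> cont_alg X" "r < ?N" for f x r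
    by (rule eigenframe_coefficient(1)[OF V eig]) (use that in simp_all)
  have coef: "ip ?N (V j) (mv ?N (\<Phi> f) x) = f (pt j) * ip ?N (V j) x" if "f \<in> cont_alg X" "j < ?N" for f j x
    by (rule eigenframe_coefficient(2)[OF V eig]) (use that in simp_all)
  define w' where "w' = mv n (\<psi> h) w"
  have W': "mv ?N (\<Phi> h) ?W p = ampliate k w' 0 p" if "p < ?N" for p
    unfolding w'_def using mv_ampliate[of n k "\<Phi> h" "\<psi> h", OF block[OF h] k that] .
  have "nrm n w' \<noteq> 0"
  proof
    assume "nrm n w' = 0"
    then have "nrm ?N (ampliate k w' 0) = 0" using nrm_ampliate[OF k] by simp
    then have "ip ?N (V j0) (mv ?N (\<Phi> h) ?W) = 0" using W' by (simp add: nrm_eq_0 ip_def)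
    then show False using coef[OF h j0(1)] h0 j0(2) by simp
  qed
  have eigW: "mv ?N (\<Phi> f) (mv ?N (\<Phi> h) ?W) r = f (pt j0) * mv ?N (\<Phi> h) ?W r" if f: "f \<in> cont_alg X" and r: "r < ?N" for f r
  proof -
    have "mv ?N (\<Phi> f) (mv ?N (\<Phi> h) ?W) r = (\<Sum>j<?N. (f (pt j) * (h (pt j) * ip ?N (V j) ?W)) * V j r)"
      unfolding diag[OF f r] using coef[OF h] by (intro sum.cong) auto
    also have "\<dots> = (\<Sum>j<?N. f (pt j0) * ((h (pt j) * ip ?N (V j) ?W) * V j r))"
    proof (intro sum.cong refl)
      fix j assume "j \<in> {..<?N}"
      then show "(f (pt j) * (h (pt j) * ip ?N (V j) ?W)) * V j r = f (pt j0) * ((h (pt j) * ip ?N (V j) ?W) * V j r)"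
        using hz[of j] by (cases "pt j = pt j0") auto
    qed
    also have "\<dots> = f (pt j0) * mv ?N (\<Phi> h) ?W r" unfolding diag[OF h r] by (simp add: sum_distrib_left)
    finally show ?thesis .
  qed
  have eigw: "mv n (\<psi> f) w' i = f (pt j0) * w' i" if f: "f \<in> cont_alg X" and i: "i < n" for f i
  proof -
    have ik: "i * k < ?N" using i k by simp
    have "mv n (\<psi> f) w' i = mv ?N (\<Phi> f) (ampliate k w' 0) (i * k)" by (rule psi[OF f i])
    also have "\<dots> = mv ?N (\<Phi> f) (mv ?N (\<Phi> h) ?W) (i * k)" using W' by (intro fun_cong[OF mv_cong]) simp
    also have "\<dots> = f (pt j0) * ampliate k w' 0 (i * k)" using eigW[OF f ik] W'[OF ik] by simp
    finally show ?thesis using k by (simp add: ampliate_def)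
  qed
  have orth: "ip n (u j) w' = 0" if j: "j < m" for j
  proof -
    have adjh: "mv n (adj (\<psi> h)) (u j) i = mv n (\<psi> h) (u j) i" if i: "i < n" for i
      unfolding mv_def
    proof (intro sum.cong refl)
      fix s assume "s \<in> {..<n}"
      then have s: "s < n" by simp
      have iss: "i * k < ?N" "s * k < ?N" using i s k by auto
      have "adj (\<psi> h) i s = cnj (\<Phi> h (s * k) (i * k))" using block[OF h iss(2) iss(1)] k by (simp add: adj_def)
      also have "\<dots> = \<Phi> h (i * k) (s * k)" using star[OF h iss] by (simp add: hcnj)
      also have "\<dots> = \<psi> h i s" using block[OF h iss] k by simp
      finally show "adj (\<psi> h) i s * u j s = \<psi> h i s * u j s" by simp
    qed
    have "ip n (u j) w' = ip n (mv n (adj (\<psi> h)) (u j)) w" unfolding w'_def by (rule ip_mv)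
    also have "\<dots> = ip n (\<lambda>i. h (z j) * u j i) w" using adjh uz[OF h j] by (intro ip_cong) auto
    also have "\<dots> = 0" using w(2)[OF j] by (simp add: ip_scale_left)
    finally show ?thesis .
  qed
  define c where "c = complex_of_real (inverse (nrm n w'))"
  define u' where "u' = (\<lambda>j. if j = m then (\<lambda>i. c * w' i) else u j)"
  define z' where "z' = (\<lambda>j. if j = m then pt j0 else z j)"
  have "orthonormal n (Suc m) u'"
    unfolding orthonormal_def
  proof (intro allI impI)
    fix i j assume "i < Suc m" "j < Suc m"
    then consider "i < m" "j < m" | "i = m" "j = m" | "i < m" "j = m" | "i = m" "j < m" by linarith
    then show "ip n (u' i) (u' j) = (if i = j then 1 else 0)"
    proof cases
      case 1
      then show ?thesis using u by (simp add: u'_def orthonormal_def)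
    next
      case 2
      then show ?thesis using ip_normalized[OF \<open>nrm n w' \<noteq> 0\<close> c_def] by (simp add: u'_def)
    next
      case 3
      then show ?thesis using orth by (simp add: u'_def ip_scale_right)
    next
      case 4
      then show ?thesis using orth[of j] ip_cnj[of n "u j" w'] by (simp add: u'_def ip_scale_left)
    qed
  qed
  moreover have "\<forall>f\<in>cont_alg X. \<forall>j<Suc m. \<forall>i<n. mv n (\<psi> f) (u' j) i = f (z' j) * u' j i"
    using uz eigw by (auto simp: u'_def z'_def mv_scale less_Suc_eq)
  ultimately show ?case by blast
qed

lemma selection_exists:
  assumes "labelling A I near L \<mu>" "\<And>i. i \<in> I \<Longrightarrow> c i \<le> L i"
  shows "\<exists>Q. selection A I c \<mu> Q"
proof -
  have ex: "\<exists>q. q \<subseteq> {m\<in>A. \<mu> m = i} \<and> card q = c i" if i: "i \<in> I" for i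
  proof -
    have "c i \<le> card {m\<in>A. \<mu> m = i}" using assms i by (simp add: labelling_def)
    then show ?thesis by (meson obtain_subset_with_card_n)
  qed
  define Q where "Q = (\<lambda>i. SOME q. q \<subseteq> {m\<in>A. \<mu> m = i} \<and> card q = c i)"
  have "Q i \<subseteq> {m\<in>A. \<mu> m = i} \<and> card (Q i) = c i" if "i \<in> I" for i
    unfolding Q_def by (rule someI_ex[OF ex[OF that]])
  then have "selection A I c \<mu> Q" unfolding selection_def by (intro ballI)
  then show ?thesis by blast
qed

lemma card_blocks:
  assumes "B \<subseteq> {..<n}"
  shows "card {q \<in> {..<n * k}. q div k \<in> B} = card B * k"
proof -
  have "card {q \<in> {..<n * k}. q div k \<in> B} = (\<Sum>q<n*k. if q div k \<in> B then 1 else 0)"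
    by (simp add: sum.If_cases Int_def)
  also have "\<dots> = (\<Sum>i<n. \<Sum>r<k. if i \<in> B then 1 else 0)"
    unfolding sum_blocks by (intro sum.cong) auto
  also have "\<dots> = (\<Sum>i<n. if i \<in> B then k else 0)" by (intro sum.cong) auto
  also have "\<dots> = card ({..<n} \<inter> B) * k" by (simp add: sum.If_cases)
  finally show ?thesis using assms by (simp add: Int_absorb1)
qed

lemma projs_ampliate:
  assumes k: "0 < k" and Q: "\<And>i. i \<in> I \<Longrightarrow> Q i \<subseteq> {..<n}" and i: "i \<in> I" and rs: "r < n * k" "s < n * k"
  shows "projs (n * k) I (\<lambda>q. ampliate k (u (q div k)) (q mod k)) (\<lambda>i. {q \<in> {..<n * k}. q div k \<in> Q i}) i r s =
     (if r mod k = s mod k then \<Sum>m\<in>Q i. u m (r div k) * cnj (u m (s div k)) else 0)"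
proof -
  let ?U = "\<lambda>q. ampliate k (u (q div k)) (q mod k)"
  have "(\<Sum>q\<in>{q \<in> {..<n * k}. q div k \<in> Q i}. ?U q r * cnj (?U q s))
     = (\<Sum>q<n*k. if q div k \<in> Q i then ?U q r * cnj (?U q s) else 0)"
    by (rule sum.inter_filter) simp
  also have "\<dots> = (\<Sum>m<n. \<Sum>\<kappa><k. if \<kappa> = r mod k then
      (if m \<in> Q i \<and> r mod k = s mod k then u m (r div k) * cnj (u m (s div k)) else 0) else 0)"
    unfolding sum_blocks by (intro sum.cong refl) (auto simp: ampliate_def)
  also have "\<dots> = (\<Sum>m<n. if m \<in> Q i then (if r mod k = s mod k then u m (r div k) * cnj (u m (s div k)) else 0) else 0)"
    using k by (intro sum.cong refl) auto
  also have "\<dots> = (\<Sum>m\<in>Q i. if r mod k = s mod k then u m (r div k) * cnj (u m (s div k)) else 0)"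
    using Q[OF i] by (simp add: sum.If_cases Int_absorb1)
  finally show ?thesis using i rs by (simp add: projs_def)
qed

text \<open>
  For operators of the form \<open>\<psi> f \<otimes> 1\<close> a spectral family can be chosen in the form
  \<open>P i \<otimes> 1\<close>.  The labels of the basis vectors \<open>u m\<close> come from a matching between the indices \<open>m\<close>
  and \<open>n\<close> slots, of which \<open>l i\<close> carry the label \<open>i\<close>: the weight of \<open>m\<close> and a slot with label \<open>i\<close> is
  the total squared overlap of the vectors \<open>u m \<otimes> e\<^sub>\<kappa>\<close> with the vectors \<open>V j\<close> of label \<open>i\<close>,
  divided by \<open>l i * k\<close>.
\<close>

lemma ampliated_spectral_family:
  fixes X :: "'a::metric_space set"
  assumes k: "0 < k" and V: "orthonormal (n * k) (n * k) V"
    and eig: "\<And>f j r. f \<in> cont_alg X \<Longrightarrow> j < n * k \<Longrightarrow> r < n * k \<Longrightarrow> mv (n * k) (\<Phi> f) (V j) r = f (pt j) * V j r"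
    and star: "\<And>f r s. f \<in> cont_alg X \<Longrightarrow> r < n * k \<Longrightarrow> s < n * k \<Longrightarrow> \<Phi> (\<lambda>x. cnj (f x)) r s = cnj (\<Phi> f s r)"
    and block: "\<And>f p q. f \<in> cont_alg X \<Longrightarrow> p < n * k \<Longrightarrow> q < n * k \<Longrightarrow>
        \<Phi> f p q = (if p mod k = q mod k then \<psi> f (p div k) (q div k) else 0)"
    and \<G>: "\<G> \<subseteq> cont_alg X" and fin: "finite I"
    and lab: "labelling {..<n * k} I (\<lambda>j i. \<forall>g\<in>\<G>. cmod (g (pt j) - \<alpha> g i) \<le> e) (\<lambda>i. l i * k) \<mu>"
    and lab0: "\<And>b. b < n \<Longrightarrow> lab0 b \<in> I" "\<And>i. i \<in> I \<Longrightarrow> card {b \<in> {..<n}. lab0 b = i} = l i"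
    and l0: "\<And>i. i \<in> I \<Longrightarrow> 0 < l i" and c0: "\<And>i. i \<in> I \<Longrightarrow> c0 i \<le> l i"
  shows "\<exists>p P. spectral_family (n * k) I \<G> (\<lambda>g x. cnj (g x)) (\<lambda>i. c0 i * k) (\<lambda>i. l i * k) \<Phi> \<alpha> e p \<and>
     (\<forall>i\<in>I. \<forall>r<n*k. \<forall>s<n*k. p i r s = (if r mod k = s mod k then P i (r div k) (s div k) else 0))"
proof -
  let ?N = "n * k"
  obtain u z where u: "orthonormal n n u"
    and uz: "\<forall>f\<in>cont_alg X. \<forall>j<n. \<forall>i<n. mv n (\<psi> f) (u j) i = f (z j) * u j i"
  proof -
    have "\<exists>u z. orthonormal n n u \<and> (\<forall>f\<in>cont_alg X. \<forall>j<n. \<forall>i<n. mv n (\<psi> f) (u j) i = f (z j) * u j i)"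
      by (rule joint_eigenbasis_of_block[OF k V, where \<Phi> = \<Phi> and pt = pt]) (assumption | rule eig star block order_refl)+
    then show ?thesis using that by blast
  qed
  define U where "U = (\<lambda>q. ampliate k (u (q div k)) (q mod k))"
  have dm: "q div k < n" "q mod k < k" if "q < ?N" for q using that k by (auto simp: less_mult_imp_div_less)
  have U: "orthonormal ?N ?N U"
    unfolding orthonormal_def
  proof (intro allI impI)
    fix i j assume ij: "i < ?N" "j < ?N"
    have "i = j \<longleftrightarrow> i div k = j div k \<and> i mod k = j mod k" by (metis div_mult_mod_eq)
    then show "ip ?N (U i) (U j) = (if i = j then 1 else 0)"
      using ip_ampliate[OF dm(2) dm(2), OF ij] u dm(1) ij by (simp add: U_def orthonormal_def)
  qed
  have eigU: "mv ?N (\<Phi> f) (U j) r = f (z (j div k)) * U j r" if "f \<in> cont_alg X" "j < ?N" "r < ?N" for f j r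
  proof -
    have "mv ?N (\<Phi> f) (U j) r = ampliate k (mv n (\<psi> f) (u (j div k))) (j mod k) r"
      unfolding U_def by (rule mv_ampliate) (use block that dm in auto)
    also have "\<dots> = f (z (j div k)) * U j r"
      using uz that(1) dm(1)[OF that(2)] dm(1)[OF that(3)] by (simp add: U_def ampliate_def)
    finally show ?thesis .
  qed
  have same: "f (pt j) = f (z (q div k))" if "f \<in> cont_alg X" "j < ?N" "q < ?N" "ip ?N (V j) (U q) \<noteq> 0" for f j q
  proof -
    have "f (pt j) * ip ?N (V j) (U q) = ip ?N (V j) (mv ?N (\<Phi> f) (U q))"
      by (rule eigenframe_coefficient(2)[OF V eig, symmetric]) (use that in simp_all)
    also have "\<dots> = ip ?N (V j) (\<lambda>r. f (z (q div k)) * U q r)"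
      using eigU that by (intro ip_cong) auto
    finally show ?thesis using that(4) by (simp add: ip_scale_right)
  qed
  define S where "S = (\<lambda>m j. \<Sum>\<kappa><k. (cmod (ip ?N (V j) (U (m * k + \<kappa>))))\<^sup>2)"
  define T where "T = (\<lambda>m i. \<Sum>j\<in>{j\<in>{..<?N}. \<mu> j = i}. S m j)"
  define w where "w = (\<lambda>m b. T m (lab0 b) / (real (l (lab0 b)) * real k))"
  have \<mu>I: "\<mu> j \<in> I" if "j < ?N" for j using lab that by (auto simp: labelling_def)
  note mk = block_index_less
  have "\<exists>\<pi>. bij_betw \<pi> {..<n} {..<n} \<and> (\<forall>m\<in>{..<n}. w m (\<pi> m) > 0)"
  proof (rule doubly_stochastic_matching)
    fix m assume m: "m \<in> {..<n}"
    have "(\<Sum>b<n. w m b) = (\<Sum>i\<in>I. \<Sum>b\<in>{b\<in>{..<n}. lab0 b = i}. w m b)"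
      using lab0(1) fin by (intro sum.group[symmetric]) auto
    also have "\<dots> = (\<Sum>i\<in>I. T m i / real k)"
    proof (intro sum.cong refl)
      fix i assume i: "i \<in> I"
      have "(\<Sum>b\<in>{b\<in>{..<n}. lab0 b = i}. w m b) = (\<Sum>b\<in>{b\<in>{..<n}. lab0 b = i}. T m i / (real (l i) * real k))"
        by (intro sum.cong) (auto simp: w_def)
      also have "\<dots> = T m i / real k" using lab0(2)[OF i] l0[OF i] by simp
      finally show "(\<Sum>b\<in>{b\<in>{..<n}. lab0 b = i}. w m b) = T m i / real k" .
    qed
    also have "\<dots> = (\<Sum>i\<in>I. T m i) / real k" by (simp add: sum_divide_distrib)
    also have "(\<Sum>i\<in>I. T m i) = (\<Sum>j<?N. S m j)"
      unfolding T_def using \<mu>I fin by (intro sum.group) auto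
    also have "\<dots> = (\<Sum>\<kappa><k. \<Sum>j<?N. (cmod (ip ?N (V j) (U (m * k + \<kappa>))))\<^sup>2)"
      unfolding S_def by (rule sum.swap)
    also have "\<dots> = (\<Sum>\<kappa><k. 1)"
      using m nrm_orthonormal[OF U mk] by (intro sum.cong) (auto simp flip: parseval[OF V])
    finally show "(\<Sum>b<n. w m b) = 1" using k by simp
  next
    fix b assume b: "b \<in> {..<n}"
    let ?J = "{j\<in>{..<?N}. \<mu> j = lab0 b}"
    have "(\<Sum>m<n. w m b) = (\<Sum>m<n. T m (lab0 b)) / (real (l (lab0 b)) * real k)"
      by (simp add: w_def sum_divide_distrib)
    have sym: "cmod (ip ?N (V j) (U q)) = cmod (ip ?N (U q) (V j))" for j q
      by (metis complex_mod_cnj ip_cnj)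
    note \<open>(\<Sum>m<n. w m b) = _\<close>
    also have "(\<Sum>m<n. T m (lab0 b)) = (\<Sum>j\<in>?J. \<Sum>m<n. S m j)"
      unfolding T_def by (rule sum.swap)
    also have "\<dots> = (\<Sum>j\<in>?J. \<Sum>q<?N. (cmod (ip ?N (U q) (V j)))\<^sup>2)"
      unfolding S_def sum_blocks by (simp only: sym)
    also have "\<dots> = (\<Sum>j\<in>?J. 1)"
      using nrm_orthonormal[OF V] by (intro sum.cong) (auto simp flip: parseval[OF U])
    also have "\<dots> = real (l (lab0 b)) * real k"
      using lab lab0(1)[of b] b by (simp add: labelling_def)
    finally show "(\<Sum>m<n. w m b) = 1" using k l0[OF lab0(1), of b] b by simp
  qed (auto simp: w_def T_def S_def intro!: divide_nonneg_nonneg sum_nonneg)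
  then obtain \<pi> where \<pi>: "bij_betw \<pi> {..<n} {..<n}" "\<And>m. m < n \<Longrightarrow> w m (\<pi> m) > 0" by auto
  have \<pi>n: "\<pi> m < n" if "m < n" for m using bij_betw_apply[OF \<pi>(1)] that by auto
  define \<nu> where "\<nu> = (\<lambda>m. lab0 (\<pi> m))"
  have \<nu>I: "\<nu> m \<in> I" if "m < n" for m using lab0(1) \<pi>n that by (simp add: \<nu>_def)
  have near: "cmod (g (z m) - \<alpha> g (\<nu> m)) \<le> e" if m: "m < n" and g: "g \<in> \<G>" for m g
  proof -
    have "T m (\<nu> m) \<noteq> 0" using \<pi>(2)[OF m] by (auto simp: w_def \<nu>_def)
    then obtain j where j: "j < ?N" "\<mu> j = \<nu> m" "S m j \<noteq> 0"
      unfolding T_def by (auto elim: sum.not_neutral_contains_not_neutral)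
    from j(3) obtain \<kappa> where \<kappa>: "\<kappa> < k" "ip ?N (V j) (U (m * k + \<kappa>)) \<noteq> 0"
      unfolding S_def by (auto elim: sum.not_neutral_contains_not_neutral)
    have "g (pt j) = g (z m)"
      using same[of g j "m * k + \<kappa>"] g \<G> j(1) mk[OF m \<kappa>(1)] \<kappa> by auto
    moreover have "cmod (g (pt j) - \<alpha> g (\<mu> j)) \<le> e" using lab j(1) g by (auto simp: labelling_def)
    ultimately show ?thesis using j(2) by simp
  qed
  have count: "card {m \<in> {..<n}. \<nu> m = i} = l i" if i: "i \<in> I" for i
  proof -
    have "bij_betw \<pi> {m \<in> {..<n}. \<nu> m = i} {b \<in> {..<n}. lab0 b = i}"
      unfolding bij_betw_def
    proof
      show "inj_on \<pi> {m \<in> {..<n}. \<nu> m = i}"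
        using bij_betw_imp_inj_on[OF \<pi>(1)] by (rule inj_on_subset) auto
      show "\<pi> ` {m \<in> {..<n}. \<nu> m = i} = {b \<in> {..<n}. lab0 b = i}"
      proof (intro Set.set_eqI iffI)
        fix b assume b: "b \<in> {b \<in> {..<n}. lab0 b = i}"
        then have "b \<in> \<pi> ` {..<n}" using bij_betw_imp_surj_on[OF \<pi>(1)] by simp
        then show "b \<in> \<pi> ` {m \<in> {..<n}. \<nu> m = i}" using b by (auto simp: \<nu>_def)
      qed (use \<pi>n in \<open>auto simp: \<nu>_def\<close>)
    qed
    then show ?thesis using lab0(2)[OF i] by (simp add: bij_betw_same_card)
  qed
  have lab\<nu>: "labelling {..<n} I (\<lambda>m i. True) l \<nu>" using \<nu>I count by (simp add: labelling_def)
  obtain Q where Q: "selection {..<n} I c0 \<nu> Q" using selection_exists[OF lab\<nu> c0] by auto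
  have Qn: "Q i \<subseteq> {..<n}" "Q i \<subseteq> {m \<in> {..<n}. \<nu> m = i}" "card (Q i) = c0 i" if "i \<in> I" for i
    using Q that by (auto simp: selection_def)
  define Q' where "Q' = (\<lambda>i. {q \<in> {..<?N}. q div k \<in> Q i})"
  have "labelling {..<?N} I (\<lambda>q i. \<forall>g\<in>\<G>. cmod (g (z (q div k)) - \<alpha> g i) \<le> e) (\<lambda>i. l i * k) (\<lambda>q. \<nu> (q div k))"
    unfolding labelling_def
  proof (intro conjI ballI)
    fix i assume i: "i \<in> I"
    have "{q \<in> {..<?N}. \<nu> (q div k) = i} = {q \<in> {..<?N}. q div k \<in> {m \<in> {..<n}. \<nu> m = i}}" using dm by auto
    then show "card {q \<in> {..<?N}. \<nu> (q div k) = i} = l i * k"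
      using card_blocks[of "{m \<in> {..<n}. \<nu> m = i}" n k] count[OF i] by auto
  qed (use near \<nu>I dm in auto)
  moreover have "selection {..<?N} I (\<lambda>i. c0 i * k) (\<lambda>q. \<nu> (q div k)) Q'"
    unfolding selection_def
  proof (intro ballI conjI)
    fix i assume i: "i \<in> I"
    show "Q' i \<subseteq> {q \<in> {..<?N}. \<nu> (q div k) = i}" using Qn(2)[OF i] by (auto simp: Q'_def)
    show "card (Q' i) = c0 i * k" unfolding Q'_def using card_blocks[OF Qn(1)[OF i], of k] Qn(3)[OF i] by simp
  qed
  ultimately have "spectral_family ?N I \<G> (\<lambda>g x. cnj (g x)) (\<lambda>i. c0 i * k) (\<lambda>i. l i * k) \<Phi> \<alpha> e (projs ?N I U Q')"
    unfolding spectral_family_def using U eigU \<G>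
    by (intro exI[of _ U] exI[of _ "\<lambda>g q. g (z (q div k))"] exI[of _ "\<lambda>q. \<nu> (q div k)"] exI[of _ Q']) auto
  moreover have "\<forall>i\<in>I. \<forall>r<?N. \<forall>s<?N. projs ?N I U Q' i r s =
      (if r mod k = s mod k then \<Sum>m\<in>Q i. u m (r div k) * cnj (u m (s div k)) else 0)"
    unfolding U_def Q'_def by (intro ballI allI impI projs_ampliate[OF k Qn(1)])
  ultimately show ?thesis
    by (intro exI[of _ "projs ?N I U Q'"] exI[of _ "\<lambda>i r s. \<Sum>m\<in>Q i. u m r * cnj (u m s)"] conjI)
qed

text \<open>
  The indices of the maps \<open>a i\<close> in the order in which they occur in \<^const>\<open>Theta\<close>, and the number of
  occurrences of each index, divided by \<open>k\<close>.
\<close>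

definition labels :: "nat \<Rightarrow> nat \<Rightarrow> nat \<Rightarrow> nat \<Rightarrow> nat list" where
  "labels k l1 l2 r = concat (map (\<lambda>i. replicate (l2 * k) i) [1..<l1]) @ replicate ((l2 + r) * k) l1"

definition block_mult :: "nat \<Rightarrow> nat \<Rightarrow> nat \<Rightarrow> nat \<Rightarrow> nat" where
  "block_mult l1 l2 r i = (if i = l1 then l2 + r else l2)"

lemma Theta_eq_map_labels: "Theta k l1 l2 r a y = map (\<lambda>i. a i y) (labels k l1 l2 r)"
  by (simp add: Theta_def labels_def map_concat o_def)

lemma length_labels: "1 \<le> l1 \<Longrightarrow> length (labels k l1 l2 r) = (l1 * l2 + r) * k"
  by (cases l1) (simp_all add: labels_def length_concat o_def sum_list_triv algebra_simps)

lemma set_labels: "1 \<le> l1 \<Longrightarrow> set (labels k l1 l2 r) \<subseteq> {1..l1}"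
  by (auto simp: labels_def)

lemma card_labels:
  assumes "i \<in> {1..l1}"
  shows "card {j. j < length (labels k l1 l2 r) \<and> labels k l1 l2 r ! j = i} = block_mult l1 l2 r i * k"
proof -
  have concat: "length (filter (\<lambda>x. x = i) (concat (map (\<lambda>i. replicate m i) [1..<l]))) = (if i \<in> {1..<l} then m else 0)" for l m
  proof (induction l)
    case (Suc l)
    then show ?case using assms by (cases "l = 0") (auto simp: less_Suc_eq)
  qed simp
  have "length (filter (\<lambda>x. x = i) (labels k l1 l2 r)) = block_mult l1 l2 r i * k"
    using assms concat[of "l2 * k" l1] by (auto simp: labels_def block_mult_def)
  then show ?thesis by (simp add: length_filter_conv_card)
qed

lemma labelling_of_pairing:
  assumes pair: "paired_within K \<eta> xs (Theta k l1 l2 r a y)" and l1: "1 \<le> l1"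
    and xs: "set xs \<subseteq> \<Union>K" and a: "\<And>i. i \<in> {1..l1} \<Longrightarrow> a i y \<in> \<Union>K"
    and close: "\<And>g x x'. g \<in> \<G> \<Longrightarrow> x \<in> \<Union>K \<Longrightarrow> x' \<in> \<Union>K \<Longrightarrow> std_dist K x x' < ennreal \<eta> \<Longrightarrow> cmod (g x - g x') \<le> e"
  shows "\<exists>\<mu>. labelling {..<(l1 * l2 + r) * k} {1..l1} (\<lambda>j i. \<forall>g\<in>\<G>. cmod (g (xs ! j) - g (a i y)) \<le> e)
     (\<lambda>i. block_mult l1 l2 r i * k) \<mu>"
proof -
  let ?N = "(l1 * l2 + r) * k" and ?lab = "labels k l1 l2 r"
  have len: "length ?lab = ?N" by (rule length_labels[OF l1])
  obtain \<sigma> where \<sigma>: "\<sigma> permutes {..<length xs}" "length xs = ?N"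
    "\<And>j. j < length xs \<Longrightarrow> std_dist K (xs ! j) (map (\<lambda>i. a i y) ?lab ! \<sigma> j) < ennreal \<eta>"
    using pair len unfolding paired_within_def Theta_eq_map_labels by auto
  have \<sigma>N: "\<sigma> j < ?N" if "j < ?N" for j using permutes_in_image[OF \<sigma>(1), of j] \<sigma>(2) that by simp
  have labI: "?lab ! j \<in> {1..l1}" if "j < ?N" for j
  proof (rule set_labels[OF l1, THEN subsetD])
    show "?lab ! j \<in> set ?lab" using that len by (intro nth_mem) simp
  qed
  show ?thesis
  proof (intro exI[of _ "\<lambda>j. ?lab ! \<sigma> j"], unfold labelling_def, intro conjI ballI)
    fix j g assume "j \<in> {..<?N}" and g: "g \<in> \<G>"
    then have j: "j < ?N" by simp
    have "xs ! j \<in> \<Union>K" using xs j \<sigma>(2) nth_mem by (metis subsetD)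
    moreover have "a (?lab ! \<sigma> j) y \<in> \<Union>K" using a[OF labI[OF \<sigma>N[OF j]]] .
    ultimately show "cmod (g (xs ! j) - g (a (?lab ! \<sigma> j) y)) \<le> e"
      using \<sigma>(3)[of j] j \<sigma>(2) \<sigma>N[OF j] len by (intro close[OF g]) auto
  next
    fix j assume "j \<in> {..<?N}"
    then show "?lab ! \<sigma> j \<in> {1..l1}" using labI \<sigma>N by simp
  next
    fix i assume i: "i \<in> {1..l1}"
    have "\<sigma> ` {j \<in> {..<?N}. ?lab ! \<sigma> j = i} = {j. j < ?N \<and> ?lab ! j = i}"
    proof (intro Set.set_eqI iffI)
      fix m assume m: "m \<in> {j. j < ?N \<and> ?lab ! j = i}"
      then have "m \<in> \<sigma> ` {..<?N}" using permutes_image[OF \<sigma>(1)] \<sigma>(2) by simp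
      then show "m \<in> \<sigma> ` {j \<in> {..<?N}. ?lab ! \<sigma> j = i}" using m by auto
    qed (use \<sigma>N in auto)
    moreover have "inj_on \<sigma> {j \<in> {..<?N}. ?lab ! \<sigma> j = i}"
      using permutes_inj[OF \<sigma>(1)] by (rule inj_on_subset) simp
    ultimately have "card {j \<in> {..<?N}. ?lab ! \<sigma> j = i} = card {j. j < ?N \<and> ?lab ! j = i}"
      using card_image[of \<sigma> "{j \<in> {..<?N}. ?lab ! \<sigma> j = i}"] by simp
    then show "card {j \<in> {..<?N}. ?lab ! \<sigma> j = i} = block_mult l1 l2 r i * k"
      using card_labels[OF i, of k l2 r] by (simp only: len)
  qed
qed

section \<open>The standard metric controls continuous functions\<close>

lemma finite_complex_vertices: "simplicial_complex K \<Longrightarrow> finite (complex_vertices K)"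
proof -
  assume "simplicial_complex K"
  then have "finite ((\<lambda>v. {v}) -` K)"
    by (intro finite_vimageI) (simp_all add: simplicial_complex_def)
  then show ?thesis by (simp add: complex_vertices_def vimage_def)
qed

lemma compact_simplicial_complex:
  assumes "simplicial_complex K"
  shows "compact (\<Union>K)"
proof (rule compact_Union)
  show "finite K" using assms by (simp add: simplicial_complex_def)
  fix S assume "S \<in> K"
  then obtain n where "n simplex S" using assms by (auto simp: simplicial_complex_def)
  then show "compact S" by (auto simp: simplex intro: compact_convex_hull finite_imp_compact)
qed

lemma barycentric_exists:
  assumes K: "simplicial_complex K" and x: "x \<in> \<Union>K"
  shows "\<exists>u. (\<forall>v. 0 \<le> u v) \<and> {v. u v \<noteq> 0} \<subseteq> complex_vertices K \<and> convex hull {v. u v \<noteq> 0} \<in> K \<and>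
     (\<Sum>v\<in>complex_vertices K. u v) = 1 \<and> (\<Sum>v\<in>complex_vertices K. u v *\<^sub>R v) = x"
proof -
  obtain S where S: "S \<in> K" "x \<in> S" using x by auto
  obtain n where "n simplex S" using K S(1) by (auto simp: simplicial_complex_def)
  then obtain C where C: "finite C" "\<not> affine_dependent C" "S = convex hull C" by (auto simp: simplex)
  obtain u where u: "\<forall>v\<in>C. 0 \<le> u v" "sum u C = 1" "(\<Sum>v\<in>C. u v *\<^sub>R v) = x"
    using S(2) C by (auto simp: convex_hull_finite)
  have face: "convex hull A \<in> K" if "A \<subseteq> C" for A
  proof -
    have "(convex hull A) face_of S"
      unfolding C(3) using that by (auto simp: face_of_convex_hull_affine_independent[OF C(2)])
    then show ?thesis using K S(1) by (auto simp: simplicial_complex_def)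
  qed
  have CV: "C \<subseteq> complex_vertices K"
    using face[of "{v}" for v] by (auto simp: complex_vertices_def)
  define u' where "u' = (\<lambda>v. if v \<in> C then u v else 0)"
  have fin: "finite (complex_vertices K)" by (rule finite_complex_vertices[OF K])
  have "sum u' (complex_vertices K) = sum u' C"
    using CV fin by (intro sum.mono_neutral_right) (auto simp: u'_def)
  moreover have "(\<Sum>v\<in>complex_vertices K. u' v *\<^sub>R v) = (\<Sum>v\<in>C. u' v *\<^sub>R v)"
    using CV fin by (intro sum.mono_neutral_right) (auto simp: u'_def)
  moreover have "{v. u' v \<noteq> 0} \<subseteq> C" by (auto simp: u'_def split: if_splits)
  ultimately show ?thesis using u CV face[of "{v. u' v \<noteq> 0}"]
    by (intro exI[of _ u']) (auto simp: u'_def)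
qed

text \<open>
  The support of a barycentric coordinate function consists of the vertices of a simplex of \<open>K\<close>,
  and the point lies in its relative interior; two simplices of \<open>K\<close> whose relative interiors meet
  are equal.
\<close>

lemma barycentric_unique:
  assumes K: "simplicial_complex K"
    and u: "\<forall>v. 0 \<le> u v" "{v. u v \<noteq> 0} \<subseteq> complex_vertices K" "convex hull {v. u v \<noteq> 0} \<in> K"
      "(\<Sum>v\<in>complex_vertices K. u v) = 1" "(\<Sum>v\<in>complex_vertices K. u v *\<^sub>R v) = x"
    and u': "\<forall>v. 0 \<le> u' v" "{v. u' v \<noteq> 0} \<subseteq> complex_vertices K" "convex hull {v. u' v \<noteq> 0} \<in> K"
      "(\<Sum>v\<in>complex_vertices K. u' v) = 1" "(\<Sum>v\<in>complex_vertices K. u' v *\<^sub>R v) = x"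
  shows "u = u'"
proof -
  have fin: "finite (complex_vertices K)" by (rule finite_complex_vertices[OF K])
  have supp: "\<not> affine_dependent {v. w v \<noteq> 0} \<and> x \<in> rel_interior (convex hull {v. w v \<noteq> 0}) \<and>
      (\<Sum>v | w v \<noteq> 0. w v) = 1 \<and> (\<Sum>v | w v \<noteq> 0. w v *\<^sub>R v) = x"
    if w: "\<forall>v. 0 \<le> w v" "{v. w v \<noteq> 0} \<subseteq> complex_vertices K" "convex hull {v. w v \<noteq> 0} \<in> K"
      "(\<Sum>v\<in>complex_vertices K. w v) = 1" "(\<Sum>v\<in>complex_vertices K. w v *\<^sub>R v) = x" for w :: "'a \<Rightarrow> real"
  proof -
    let ?A = "{v. w v \<noteq> 0}"
    obtain n where "n simplex (convex hull ?A)" using K w(3) by (auto simp: simplicial_complex_def)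
    then obtain C where C: "finite C" "\<not> affine_dependent C" "convex hull ?A = convex hull C"
      by (auto simp: simplex)
    have "?A \<subseteq> C"
    proof
      fix v assume v: "v \<in> ?A"
      then have "{v} \<in> K" using w(2) by (auto simp: complex_vertices_def)
      then have "(convex hull ?A \<inter> {v}) face_of (convex hull ?A)" using K w(3) by (auto simp: simplicial_complex_def)
      moreover have "convex hull ?A \<inter> {v} = {v}" using hull_inc[OF v] by auto
      ultimately have "v extreme_point_of (convex hull C)" using C(3) by (simp add: face_of_singleton)
      then show "v \<in> C" using extreme_point_of_convex_hull by blast
    qed
    then have ind: "\<not> affine_dependent ?A" using C(2) affine_dependent_subset by blast
    have s: "(\<Sum>v\<in>?A. w v) = 1" "(\<Sum>v\<in>?A. w v *\<^sub>R v) = x"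
    proof -
      have "(\<Sum>v\<in>complex_vertices K. w v) = (\<Sum>v\<in>?A. w v)"
        using fin w(2) by (intro sum.mono_neutral_right) auto
      then show "(\<Sum>v\<in>?A. w v) = 1" using w(4) by simp
      have "(\<Sum>v\<in>complex_vertices K. w v *\<^sub>R v) = (\<Sum>v\<in>?A. w v *\<^sub>R v)"
        using fin w(2) by (intro sum.mono_neutral_right) auto
      then show "(\<Sum>v\<in>?A. w v *\<^sub>R v) = x" using w(5) by simp
    qed
    have "x \<in> rel_interior (convex hull ?A)"
      unfolding rel_interior_convex_hull_explicit[OF ind] using s w(1)
      by (auto intro!: exI[of _ w] simp: less_le)
    then show ?thesis using ind s by simp
  qed
  let ?A = "{v. u v \<noteq> 0}" and ?B = "{v. u' v \<noteq> 0}"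
  note A = supp[OF u] and B = supp[OF u']
  have sub: "convex hull S \<subseteq> convex hull T"
    if "convex hull S \<in> K" "convex hull T \<in> K" "x \<in> rel_interior (convex hull S)" "x \<in> rel_interior (convex hull T)" for S T :: "'a set"
  proof -
    have "(convex hull S \<inter> convex hull T) face_of (convex hull S)" using K that by (auto simp: simplicial_complex_def)
    moreover have "x \<in> convex hull S \<inter> convex hull T" using that rel_interior_subset by blast
    ultimately have "convex hull S \<subseteq> convex hull S \<inter> convex hull T"
      using that(3) by (intro subset_of_face_of[where T = "convex hull S \<inter> convex hull T" and S = "convex hull S"]) blast+
    then show ?thesis by auto
  qed
  have "convex hull ?A = convex hull ?B"
    using sub[of ?A ?B] sub[of ?B ?A] u(3) u'(3) A B by blast
  then have AB: "?A = ?B"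
    using extreme_point_of_convex_hull_affine_independent[of ?A] extreme_point_of_convex_hull_affine_independent[of ?B] A B
    by (intro Set.set_eqI) metis
  have "\<forall>v\<in>?A. u v - u' v = 0"
  proof (rule ccontr)
    assume "\<not> ?thesis"
    moreover have "finite ?A" using fin u(2) by (rule rev_finite_subset)
    moreover have "sum (\<lambda>v. u v - u' v) ?A = 0" "(\<Sum>v\<in>?A. (u v - u' v) *\<^sub>R v) = 0"
      using A B unfolding AB[symmetric] by (simp_all add: sum_subtractf scaleR_diff_left)
    ultimately have "affine_dependent ?A"
      unfolding affine_dependent_explicit_finite[OF \<open>finite ?A\<close>] by (intro exI[of _ "\<lambda>v. u v - u' v"]) auto
    then show False using A by blast
  qed
  moreover have "u v = u' v" if "v \<notin> ?A" for v
  proof -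
    have "v \<notin> ?B" using that AB by blast
    then show ?thesis using that by simp
  qed
  ultimately show ?thesis by (intro ext) (metis eq_iff_diff_eq_0)
qed

lemma barycentric_combination:
  assumes K: "simplicial_complex K" and x: "x \<in> \<Union>K"
  shows "(\<Sum>v\<in>complex_vertices K. barycentric K x v *\<^sub>R v) = x"
proof -
  let ?P = "\<lambda>u. (\<forall>v. 0 \<le> u v) \<and> {v. u v \<noteq> 0} \<subseteq> complex_vertices K \<and> convex hull {v. u v \<noteq> 0} \<in> K \<and>
     (\<Sum>v\<in>complex_vertices K. u v) = 1 \<and> (\<Sum>v\<in>complex_vertices K. u v *\<^sub>R v) = x"
  obtain u where u: "?P u" using barycentric_exists[OF K x] by blast
  have "?P (barycentric K x)"
    unfolding barycentric_def
  proof (rule theI[of ?P, OF u])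
    fix w assume "?P w"
    then show "w = u" using barycentric_unique[OF K, of w x u] u by blast
  qed
  then show ?thesis by blast
qed

lemma dist_le_chord:
  assumes K: "simplicial_complex K" and x: "x \<in> \<Union>K" and x': "x' \<in> \<Union>K"
  shows "dist x x' \<le> sqrt 2 * L2_set norm (complex_vertices K) * chord K x x'"
proof -
  let ?V = "complex_vertices K" and ?d = "\<lambda>v. barycentric K x v - barycentric K x' v"
  have "x - x' = (\<Sum>v\<in>?V. ?d v *\<^sub>R v)"
    by (simp add: scaleR_diff_left sum_subtractf barycentric_combination[OF K x] barycentric_combination[OF K x'])
  then have "dist x x' \<le> (\<Sum>v\<in>?V. \<bar>?d v\<bar> * \<bar>norm v\<bar>)"
    unfolding dist_norm by (simp add: sum_norm_le)
  also have "\<dots> \<le> L2_set ?d ?V * L2_set norm ?V" by (rule L2_set_mult_ineq)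
  finally show ?thesis by (simp add: chord_def field_simps)
qed

lemma chord_le_std_dist: "ennreal (chord K x x') \<le> std_dist K x x'"
  unfolding std_dist_def
proof (rule INF_greatest)
  fix \<gamma> assume "\<gamma> \<in> {\<gamma>. path \<gamma> \<and> path_image \<gamma> \<subseteq> \<Union>K \<and> pathstart \<gamma> = x \<and> pathfinish \<gamma> = x'}"
  then have \<gamma>: "\<gamma> 0 = x" "\<gamma> 1 = x'" by (auto simp: pathstart_def pathfinish_def)
  show "ennreal (chord K x x') \<le> path_length K \<gamma>"
    unfolding path_length_def by (rule SUP_upper2[of "[0,1]"]) (auto simp: \<gamma>)
qed

lemma std_dist_small_imp_close:
  fixes g :: "'a::euclidean_space \<Rightarrow> complex"
  assumes K: "simplicial_complex K" and g: "continuous_on (\<Union>K) g" and e: "0 < e"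
  shows "\<exists>\<eta>>0. \<forall>x\<in>\<Union>K. \<forall>x'\<in>\<Union>K. std_dist K x x' < ennreal \<eta> \<longrightarrow> cmod (g x - g x') < e"
proof -
  have "uniformly_continuous_on (\<Union>K) g"
    using g compact_simplicial_complex[OF K] by (rule compact_uniformly_continuous)
  then obtain d where d: "0 < d" "\<forall>x\<in>\<Union>K. \<forall>x'\<in>\<Union>K. dist x' x < d \<longrightarrow> dist (g x') (g x) < e"
    using e unfolding uniformly_continuous_on_def by meson
  define C where "C = sqrt 2 * L2_set norm (complex_vertices K) + 1"
  have C: "0 < C" by (simp add: C_def add_nonneg_pos)
  show ?thesis
  proof (intro exI[of _ "d / C"] conjI ballI impI)
    show "0 < d / C" using d C by simp
    fix x x' assume x: "x \<in> \<Union>K" and x': "x' \<in> \<Union>K" and s: "std_dist K x x' < ennreal (d / C)"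
    have "ennreal (chord K x x') < ennreal (d / C)" using chord_le_std_dist s by (rule le_less_trans)
    moreover have c0: "0 \<le> chord K x x'" by (simp add: chord_def)
    ultimately have "chord K x x' < d / C" by (simp add: ennreal_less_iff)
    then have "C * chord K x x' < d" using C by (simp add: field_simps)
    moreover have "dist x x' \<le> C * chord K x x'"
      using dist_le_chord[OF K x x'] c0 by (simp add: C_def distrib_right)
    ultimately show "cmod (g x - g x') < e" using d(2) x x' by (metis dist_norm order_le_less_trans)
  qed
qed

section \<open>From families to projection matrices\<close>

text \<open>
  The operator with eigenvalues \<open>\<beta>\<close> in the frame \<open>V\<close>, as a matrix of size \<open>N\<close>.
\<close>

definition frame_mat :: "nat \<Rightarrow> (nat \<Rightarrow> nat \<Rightarrow> complex) \<Rightarrow> (nat \<Rightarrow> complex) \<Rightarrow> complex Matrix.mat" where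
  "frame_mat N V \<beta> = Matrix.mat N N (\<lambda>(r, s). diag_op N V \<beta> r s)"

lemma frame_mat_carrier [simp]: "frame_mat N V \<beta> \<in> carrier_mat N N"
  by (simp add: frame_mat_def)

lemma frame_mat_index [simp]: "r < N \<Longrightarrow> s < N \<Longrightarrow> frame_mat N V \<beta> $$ (r, s) = diag_op N V \<beta> r s"
  by (simp add: frame_mat_def)

lemma frame_mat_cong: "(\<And>j. j < N \<Longrightarrow> \<beta> j = \<gamma> j) \<Longrightarrow> frame_mat N V \<beta> = frame_mat N V \<gamma>"
proof -
  assume "\<And>j. j < N \<Longrightarrow> \<beta> j = \<gamma> j"
  then have "diag_op N V \<beta> = diag_op N V \<gamma>" by (simp add: diag_op_def)
  then show ?thesis by (simp add: frame_mat_def)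
qed

lemma frame_mat_add: "frame_mat N V \<beta> + frame_mat N V \<gamma> = frame_mat N V (\<lambda>j. \<beta> j + \<gamma> j)"
  by (rule eq_matI) (simp_all add: frame_mat_def diag_op_def distrib_right sum.distrib)

lemma frame_mat_diff: "frame_mat N V \<beta> - frame_mat N V \<gamma> = frame_mat N V (\<lambda>j. \<beta> j - \<gamma> j)"
  by (rule eq_matI) (simp_all add: frame_mat_def diag_op_def left_diff_distrib sum_subtractf)

lemma frame_mat_scale: "c \<cdot>\<^sub>m frame_mat N V \<beta> = frame_mat N V (\<lambda>j. c * \<beta> j)"
  by (rule eq_matI) (simp_all add: frame_mat_def diag_op_def sum_distrib_left mult.assoc)

lemma frame_mat_msum: "msum N (\<lambda>i. frame_mat N V (\<beta> i)) I = frame_mat N V (\<lambda>j. \<Sum>i\<in>I. \<beta> i j)"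
proof (rule eq_matI)
  fix r s assume "r < dim_row (frame_mat N V (\<lambda>j. \<Sum>i\<in>I. \<beta> i j))" "s < dim_col (frame_mat N V (\<lambda>j. \<Sum>i\<in>I. \<beta> i j))"
  then have rs: "r < N" "s < N" by (auto simp: frame_mat_def)
  have "(\<Sum>i\<in>I. diag_op N V (\<beta> i) r s) = diag_op N V (\<lambda>j. \<Sum>i\<in>I. \<beta> i j) r s"
    unfolding diag_op_def by (subst sum.swap) (simp add: sum_distrib_right)
  then show "msum N (\<lambda>i. frame_mat N V (\<beta> i)) I $$ (r, s) = frame_mat N V (\<lambda>j. \<Sum>i\<in>I. \<beta> i j) $$ (r, s)"
    using rs by (simp add: msum_def)
qed (simp_all add: msum_def frame_mat_def)

lemma frame_mat_adjoint: "mat_adjoint (frame_mat N V \<beta>) = frame_mat N V (\<lambda>j. cnj (\<beta> j))"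
proof (rule eq_matI)
  fix r s assume "r < dim_row (frame_mat N V (\<lambda>j. cnj (\<beta> j)))" "s < dim_col (frame_mat N V (\<lambda>j. cnj (\<beta> j)))"
  then have rs: "r < N" "s < N" by (auto simp: frame_mat_def)
  have "mat_adjoint (frame_mat N V \<beta>) $$ (r, s) = adj (diag_op N V \<beta>) r s"
    using entries_adjoint[OF frame_mat_carrier rs, of V \<beta>] rs by (simp add: entries_def adj_def)
  then show "mat_adjoint (frame_mat N V \<beta>) $$ (r, s) = frame_mat N V (\<lambda>j. cnj (\<beta> j)) $$ (r, s)"
    using rs by (simp add: adj_diag_op)
qed (simp_all add: mat_adjoint_def frame_mat_def)

lemma frame_mat_mult:
  assumes V: "orthonormal N N V"
  shows "frame_mat N V \<beta> * frame_mat N V \<gamma> = frame_mat N V (\<lambda>j. \<beta> j * \<gamma> j)"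
proof (rule eq_matI)
  fix r s assume "r < dim_row (frame_mat N V (\<lambda>j. \<beta> j * \<gamma> j))" "s < dim_col (frame_mat N V (\<lambda>j. \<beta> j * \<gamma> j))"
  then have rs: "r < N" "s < N" by (auto simp: frame_mat_def)
  have "(frame_mat N V \<beta> * frame_mat N V \<gamma>) $$ (r, s) = (\<Sum>t<N. diag_op N V \<beta> r t * diag_op N V \<gamma> t s)"
    using entries_mult[OF frame_mat_carrier frame_mat_carrier rs, of V \<beta> V \<gamma>] rs by (simp add: entries_def)
  also have "\<dots> = mv N (diag_op N V \<beta>) (\<lambda>t. \<Sum>l<N. (\<gamma> l * cnj (V l s)) * V l t) r"
    unfolding mv_def by (intro sum.cong refl arg_cong2[where f = "(*)"]) (simp add: diag_op_def mult_ac)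
  also have "\<dots> = (\<Sum>j<N. (\<beta> j * (\<gamma> j * cnj (V j s))) * V j r)"
    unfolding mv_diag_op by (intro sum.cong refl) (simp add: ip_frame_sum[OF V])
  also have "\<dots> = frame_mat N V (\<lambda>j. \<beta> j * \<gamma> j) $$ (r, s)" using rs by (simp add: diag_op_def mult_ac)
  finally show "(frame_mat N V \<beta> * frame_mat N V \<gamma>) $$ (r, s) = frame_mat N V (\<lambda>j. \<beta> j * \<gamma> j) $$ (r, s)" .
qed (simp_all add: frame_mat_def)

lemma frame_mat_one:
  assumes "orthonormal N N V"
  shows "frame_mat N V (\<lambda>j. 1) = 1\<^sub>m N"
  by (rule eq_matI) (simp_all add: frame_mat_def diag_op_def orthonormal_complete[OF assms])

lemma rank_dmat_le:
  assumes "finite B" "B \<subseteq> {..<N}"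
  shows "vec_space.rank N (frame_mat N V (\<lambda>j. of_bool (j \<in> B))) \<le> card B"
  using assms
proof (induction B rule: finite_induct)
  case empty
  have "frame_mat N V (\<lambda>j. of_bool (j \<in> {})) = 0\<^sub>m N N"
    by (rule eq_matI) (simp_all add: frame_mat_def diag_op_def)
  moreover have "vec_space.rank N (0\<^sub>m N N :: complex mat) = 0" by (rule vec_space.rank_0I)
  ultimately show ?case by simp
next
  case (insert b B)
  let ?A = "frame_mat N V (\<lambda>j. of_bool (j = b))" and ?B = "frame_mat N V (\<lambda>j. of_bool (j \<in> B))"
  have "frame_mat N V (\<lambda>j. of_bool (j \<in> insert b B)) = ?A + ?B"
    unfolding frame_mat_add using insert(2) by (intro frame_mat_cong) auto
  moreover have "vec_space.rank N (?A + ?B) \<le> vec_space.rank N ?A + vec_space.rank N ?B"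
    by (rule vec_space.rank_subadditive[OF frame_mat_carrier frame_mat_carrier])
  moreover have "vec_space.rank N ?A \<le> 1"
  proof (rule vec_space.rank_le_1_product_entries[OF frame_mat_carrier, where f = "V b" and g = "\<lambda>s. cnj (V b s)"])
    fix r s assume "r < dim_row ?A" "s < dim_col ?A"
    then have rs: "r < N" "s < N" by (auto simp: frame_mat_def)
    have "diag_op N V (\<lambda>j. of_bool (j = b)) r s = (\<Sum>j<N. if j = b then V b r * cnj (V b s) else 0)"
      unfolding diag_op_def by (intro sum.cong) auto
    then show "?A $$ (r, s) = V b r * cnj (V b s)" using rs insert.prems by simp
  qed
  moreover have "vec_space.rank N ?B \<le> card B" using insert by simp
  ultimately show ?case using insert(1,2) by simp
qed

text \<open>
  Both projections in \<open>P + (1 - P) = 1\<close> have rank at most the number of basis vectors they use, and by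
  subadditivity of the rank neither bound can be strict.
\<close>

lemma rank_frame_mat:
  assumes V: "orthonormal N N V" and B: "B \<subseteq> {..<N}"
  shows "vec_space.rank N (frame_mat N V (\<lambda>j. of_bool (j \<in> B))) = card B"
proof -
  let ?P = "\<lambda>B. frame_mat N V (\<lambda>j. of_bool (j \<in> B))"
  have fin: "finite B" using B by (rule finite_subset) simp
  have sum1: "?P B + ?P ({..<N} - B) = 1\<^sub>m N"
    unfolding frame_mat_add frame_mat_one[OF V, symmetric] by (intro frame_mat_cong) auto
  have "vec_space.rank N (?P B + ?P ({..<N} - B)) \<le> vec_space.rank N (?P B) + vec_space.rank N (?P ({..<N} - B))"
    by (rule vec_space.rank_subadditive[OF frame_mat_carrier frame_mat_carrier])
  moreover have "vec_space.rank N (1\<^sub>m N :: complex mat) = N"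
    using vec_space.det_rank_iff[of "1\<^sub>m N :: complex mat" N] by simp
  ultimately have "N \<le> vec_space.rank N (?P B) + vec_space.rank N (?P ({..<N} - B))"
    unfolding sum1 by simp
  moreover have "vec_space.rank N (?P B) \<le> card B" by (rule rank_dmat_le[OF fin B])
  moreover have "vec_space.rank N (?P ({..<N} - B)) \<le> card ({..<N} - B)" by (rule rank_dmat_le) auto
  moreover have "card ({..<N} - B) = N - card B" "card B \<le> N"
    using B fin card_mono[of "{..<N}" B] by (simp_all add: card_Diff_subset)
  ultimately show ?thesis by linarith
qed

lemma op_norm_le:
  assumes A: "A \<in> carrier_mat N N" and c: "0 \<le> c"
    and bound: "\<And>w. nrm N (mv N (entries A) w) \<le> c * nrm N w"
  shows "op_norm A \<le> c"
  unfolding op_norm_def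
proof (rule cSUP_least)
  have "0\<^sub>v (dim_col A) \<in> {v \<in> carrier_vec (dim_col A). vec_l2norm v \<le> 1}"
    by (auto simp: vec_l2norm_def L2_set_def)
  then show "{v \<in> carrier_vec (dim_col A). vec_l2norm v \<le> 1} \<noteq> {}" by blast
  fix v assume "v \<in> {v \<in> carrier_vec (dim_col A). vec_l2norm v \<le> 1}"
  then have v: "v \<in> carrier_vec N" "vec_l2norm v \<le> 1" using A by auto
  have dim: "dim_vec v = N" using v by simp
  have "vec_index (A *\<^sub>v v) r = mv N (entries A) (vec_index v) r" if "r < N" for r
    using A that dim by (simp add: scalar_prod_def mv_def entries_def atLeast0LessThan)
  then have "vec_l2norm (A *\<^sub>v v) = nrm N (mv N (entries A) (vec_index v))"
    using A by (auto simp: vec_l2norm_def nrm_def intro!: L2_set_cong)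
  also have "\<dots> \<le> c * nrm N (vec_index v)" by (rule bound)
  also have "nrm N (vec_index v) = vec_l2norm v" by (simp add: vec_l2norm_def nrm_def dim)
  also have "c * vec_l2norm v \<le> c * 1" using c v(2) by (rule mult_left_mono[rotated])
  finally show "vec_l2norm (A *\<^sub>v v) \<le> c" by simp
qed

lemma mv_entries_minus:
  assumes "A \<in> carrier_mat N N" "B \<in> carrier_mat N N" "r < N"
  shows "mv N (entries (A - B)) w r = mv N (entries A) w r - mv N (entries B) w r"
proof -
  have "mv N (entries (A - B)) w r = (\<Sum>s<N. entries A r s * w s - entries B r s * w s)"
    unfolding mv_def using assms by (intro sum.cong refl) (auto simp: entries_def left_diff_distrib)
  then show ?thesis by (simp add: mv_def sum_subtractf)
qed

lemma nrm_mv_diff_conj_le: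
  assumes V: "orthonormal N N V" and e: "0 \<le> e"
    and E: "E \<in> carrier_mat N N" "\<And>w. nrm N (mv N (entries E) w) \<le> e * nrm N w"
    and R: "\<And>j. j < N \<Longrightarrow> cmod (\<rho> j) \<le> 1"
  shows "nrm N (mv N (entries (E - frame_mat N V \<rho> * E * frame_mat N V \<rho>)) w) \<le> 2 * e * nrm N w"
proof -
  let ?P = "frame_mat N V \<rho>"
  have P: "nrm N (mv N (entries ?P) x) \<le> nrm N x" for x
  proof -
    have "nrm N (mv N (entries ?P) x) = nrm N (mv N (diag_op N V \<rho>) x)"
      by (rule nrm_cong) (simp add: mv_def entries_def)
    also have "\<dots> \<le> 1 * nrm N x" unfolding mv_diag_op using R by (intro nrm_frame_sum_le[OF V]) auto
    finally show ?thesis by simp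
  qed
  have mult: "mv N (entries (A * B)) x r = mv N (entries A) (mv N (entries B) x) r"
    if "A \<in> carrier_mat N N" "B \<in> carrier_mat N N" "r < N" for A B x r
  proof -
    have "mv N (entries (A * B)) x r = (\<Sum>s<N. \<Sum>t<N. entries A r t * entries B t s * x s)"
      unfolding mv_def using entries_mult[OF that(1,2,3)] by (simp add: sum_distrib_right)
    also have "\<dots> = (\<Sum>t<N. \<Sum>s<N. entries A r t * entries B t s * x s)" by (rule sum.swap)
    finally show ?thesis by (simp add: mv_def sum_distrib_left mult.assoc)
  qed
  have PE: "?P * E \<in> carrier_mat N N" using E(1) by (intro mult_carrier_mat[OF frame_mat_carrier])
  have PEP: "?P * E * ?P \<in> carrier_mat N N" using PE by (intro mult_carrier_mat[OF _ frame_mat_carrier])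
  have split: "mv N (entries (E - ?P * E * ?P)) w r =
      mv N (entries E) w r - mv N (entries ?P) (mv N (entries E) (mv N (entries ?P) w)) r" if r: "r < N" for r
  proof -
    have "mv N (entries (E - ?P * E * ?P)) w r = mv N (entries E) w r - mv N (entries (?P * E * ?P)) w r"
      by (rule mv_entries_minus[OF E(1) PEP r])
    also have "mv N (entries (?P * E * ?P)) w r = mv N (entries (?P * E)) (mv N (entries ?P) w) r"
      by (rule mult[OF PE frame_mat_carrier r])
    also have "\<dots> = mv N (entries ?P) (mv N (entries E) (mv N (entries ?P) w)) r"
      by (rule mult[OF frame_mat_carrier E(1) r])
    finally show ?thesis .
  qed
  have "nrm N (mv N (entries (E - ?P * E * ?P)) w) =
      nrm N (\<lambda>r. mv N (entries E) w r - mv N (entries ?P) (mv N (entries E) (mv N (entries ?P) w)) r)"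
    by (rule nrm_cong) (rule split)
  also have "\<dots> \<le> nrm N (mv N (entries E) w) + nrm N (mv N (entries ?P) (mv N (entries E) (mv N (entries ?P) w)))"
    by (rule nrm_triangle_diff)
  also have "\<dots> \<le> e * nrm N w + e * nrm N w"
  proof (rule add_mono[OF E(2)])
    have "nrm N (mv N (entries ?P) (mv N (entries E) (mv N (entries ?P) w))) \<le> nrm N (mv N (entries E) (mv N (entries ?P) w))"
      by (rule P)
    also have "\<dots> \<le> e * nrm N (mv N (entries ?P) w)" by (rule E(2))
    also have "\<dots> \<le> e * nrm N w" using e P by (intro mult_left_mono)
    finally show "nrm N (mv N (entries ?P) (mv N (entries E) (mv N (entries ?P) w))) \<le> e * nrm N w" .
  qed
  finally show ?thesis by simp
qed

text \<open>
  The operator \<open>B\<close> with eigenvalues \<open>\<alpha> g (\<mu> j)\<close> in the frame equals \<open>P0 * B * P0\<close> plus the sum of the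
  \<open>\<alpha> g i \<cdot> P i\<close>.  So the matrix in the last claim is \<open>E - P0 * E * P0\<close> with \<open>E = A g - B\<close>.
\<close>

lemma approx_family_projections:
  assumes good: "approx_family N I \<G> c (\<lambda>g. entries (A g)) \<alpha> e p" and fin: "finite I" and e: "0 \<le> e"
    and carrier: "\<forall>g\<in>\<G>. A g \<in> carrier_mat N N"
    and mats: "\<forall>i. P i = Matrix.mat N N (\<lambda>(r, s). p i r s)" and P0: "P0 = 1\<^sub>m N - msum N P I"
  shows "i \<in> I \<Longrightarrow> projection_mat N (P i)"
    and "i \<in> I \<Longrightarrow> j \<in> I \<Longrightarrow> i \<noteq> j \<Longrightarrow> P i * P j = 0\<^sub>m N N"
    and "i \<in> I \<Longrightarrow> vec_space.rank N (P i) = c i"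
    and "vec_space.rank N P0 = N - sum c I"
    and "g \<in> \<G> \<Longrightarrow> op_norm (A g - (P0 * A g * P0 + msum N (\<lambda>i. \<alpha> g i \<cdot>\<^sub>m P i) I)) \<le> 2 * e"
proof -
  note A = bspec[OF carrier] and P = mats[rule_format]
  obtain V \<mu> Q where V: "orthonormal N N V" and \<mu>: "\<forall>j<N. \<mu> j \<in> I" and Q: "selection {..<N} I c \<mu> Q"
     and p: "p = projs N I V Q" and close: "\<forall>g\<in>\<G>. op_close N e (entries (A g)) (diag_op N V (\<lambda>j. \<alpha> g (\<mu> j)))"
    using good unfolding approx_family_def by blast
  have Qs: "Q i \<subseteq> {..<N}" "\<And>j. j \<in> Q i \<Longrightarrow> \<mu> j = i" "card (Q i) = c i" if "i \<in> I" for i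
    using Q that by (auto simp: selection_def)
  let ?D = "frame_mat N V"
  have PD: "P i = ?D (\<lambda>j. of_bool (j \<in> Q i))" if i: "i \<in> I" for i
  proof (rule eq_matI)
    fix r s assume "r < dim_row (?D (\<lambda>j. of_bool (j \<in> Q i)))" "s < dim_col (?D (\<lambda>j. of_bool (j \<in> Q i)))"
    then have rs: "r < N" "s < N" by (auto simp: frame_mat_def)
    have "(\<Sum>j\<in>Q i. V j r * cnj (V j s)) = (\<Sum>j<N. if j \<in> Q i then V j r * cnj (V j s) else 0)"
      using Qs(1)[OF i] by (simp add: sum.If_cases Int_absorb1)
    also have "\<dots> = diag_op N V (\<lambda>j. of_bool (j \<in> Q i)) r s"
      unfolding diag_op_def by (intro sum.cong) auto
    finally show "P i $$ (r, s) = ?D (\<lambda>j. of_bool (j \<in> Q i)) $$ (r, s)"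
      using rs i by (simp add: P p projs_def)
  qed (simp_all add: P frame_mat_def)
  define R where "R = {..<N} - \<Union>(Q ` I)"
  have R: "R \<subseteq> {..<N}" by (auto simp: R_def)
  have one: "(\<Sum>i\<in>I. f i * of_bool (j \<in> Q i)) = f (\<mu> j) * of_bool (j \<notin> R)" if j: "j < N" for j and f :: "'a \<Rightarrow> complex"
  proof -
    have "(\<Sum>i\<in>I. f i * of_bool (j \<in> Q i)) = (\<Sum>i\<in>I. if i = \<mu> j then f (\<mu> j) * of_bool (j \<in> Q (\<mu> j)) else 0)"
      using Qs(2) by (intro sum.cong refl) auto
    also have "\<dots> = f (\<mu> j) * of_bool (j \<in> Q (\<mu> j))" using fin \<mu> j by simp
    also have "j \<in> Q (\<mu> j) \<longleftrightarrow> j \<notin> R" using j \<mu> Qs(2) by (auto simp: R_def)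
    finally show ?thesis .
  qed
  have msumP: "msum N (\<lambda>i. b i \<cdot>\<^sub>m P i) I = ?D (\<lambda>j. b (\<mu> j) * of_bool (j \<notin> R))" for b
  proof -
    have "msum N (\<lambda>i. b i \<cdot>\<^sub>m P i) I = msum N (\<lambda>i. ?D (\<lambda>j. b i * of_bool (j \<in> Q i))) I"
      unfolding msum_def by (intro cong_mat refl) (auto simp: PD frame_mat_scale intro!: sum.cong)
    also have "\<dots> = ?D (\<lambda>j. \<Sum>i\<in>I. b i * of_bool (j \<in> Q i))" by (rule frame_mat_msum)
    also have "\<dots> = ?D (\<lambda>j. b (\<mu> j) * of_bool (j \<notin> R))" by (rule frame_mat_cong) (rule one)
    finally show ?thesis .
  qed
  have P0D: "P0 = ?D (\<lambda>j. of_bool (j \<in> R))"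
  proof -
    have "msum N P I = msum N (\<lambda>i. 1 \<cdot>\<^sub>m P i) I" 
      unfolding msum_def by (intro cong_mat refl) (auto simp: P intro!: sum.cong)
    then have "P0 = ?D (\<lambda>j. 1) - ?D (\<lambda>j. 1 * of_bool (j \<notin> R))"
      unfolding P0 msumP frame_mat_one[OF V] by simp
    also have "\<dots> = ?D (\<lambda>j. of_bool (j \<in> R))" unfolding frame_mat_diff by (intro frame_mat_cong) auto
    finally show ?thesis .
  qed
  show "projection_mat N (P i)" if "i \<in> I"
    unfolding projection_mat_def PD[OF that] frame_mat_mult[OF V] frame_mat_adjoint
    by (auto intro!: frame_mat_cong)
  show "P i * P j = 0\<^sub>m N N" if "i \<in> I" "j \<in> I" "i \<noteq> j"
  proof -
    have "P i * P j = ?D (\<lambda>j. 0)"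
      unfolding PD[OF that(1)] PD[OF that(2)] frame_mat_mult[OF V]
      using Qs(2)[OF that(1)] Qs(2)[OF that(2)] that(3) by (intro frame_mat_cong) auto
    also have "\<dots> = 0\<^sub>m N N" by (rule eq_matI) (simp_all add: frame_mat_def diag_op_def)
    finally show ?thesis .
  qed
  show "vec_space.rank N (P i) = c i" if "i \<in> I"
    unfolding PD[OF that] using rank_frame_mat[OF V Qs(1)[OF that]] Qs(3)[OF that] by simp
  have "card (\<Union>(Q ` I)) = (\<Sum>i\<in>I. card (Q i))"
  proof (rule card_UN_disjoint[OF fin])
    show "\<forall>i\<in>I. finite (Q i)" using Qs(1) by (auto intro: finite_subset)
    show "\<forall>i\<in>I. \<forall>j\<in>I. i \<noteq> j \<longrightarrow> Q i \<inter> Q j = {}" using Qs(2) by blast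
  qed
  also have "\<dots> = sum c I" using Qs(3) by simp
  finally have "card R = N - sum c I"
    unfolding R_def using Qs(1) by (subst card_Diff_subset) (auto intro: finite_subset)
  then show "vec_space.rank N P0 = N - sum c I" unfolding P0D using rank_frame_mat[OF V R] by simp
  assume g: "g \<in> \<G>"
  let ?\<beta> = "\<lambda>j. \<alpha> g (\<mu> j)"
  define E where "E = A g - ?D ?\<beta>"
  have E: "E \<in> carrier_mat N N" unfolding E_def by (rule minus_carrier_mat[OF frame_mat_carrier])
  have Eb: "nrm N (mv N (entries E) w) \<le> e * nrm N w" for w
  proof -
    have "nrm N (mv N (entries E) w) = nrm N (\<lambda>r. mv N (entries (A g)) w r - mv N (diag_op N V ?\<beta>) w r)"
    proof (rule nrm_cong)
      fix r assume r: "r < N"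
      have "mv N (entries (?D ?\<beta>)) w r = mv N (diag_op N V ?\<beta>) w r"
        using r by (simp add: mv_def entries_def)
      then show "mv N (entries E) w r = mv N (entries (A g)) w r - mv N (diag_op N V ?\<beta>) w r"
        unfolding E_def by (simp add: mv_entries_minus[OF A[OF g] frame_mat_carrier r])
    qed
    then show ?thesis using close g by (simp add: op_close_def)
  qed
  have PB: "?D ?\<beta> = P0 * ?D ?\<beta> * P0 + msum N (\<lambda>i. \<alpha> g i \<cdot>\<^sub>m P i) I"
    unfolding msumP P0D frame_mat_mult[OF V] frame_mat_add by (intro frame_mat_cong) auto
  have c1: "P0 \<in> carrier_mat N N" "msum N (\<lambda>i. \<alpha> g i \<cdot>\<^sub>m P i) I \<in> carrier_mat N N"
    unfolding msumP P0D by simp_all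
  have "A g - (P0 * A g * P0 + msum N (\<lambda>i. \<alpha> g i \<cdot>\<^sub>m P i) I) = E - P0 * E * P0"
  proof -
    have PA: "P0 * A g \<in> carrier_mat N N" "P0 * ?D ?\<beta> \<in> carrier_mat N N"
      by (rule mult_carrier_mat[OF c1(1) A[OF g]], rule mult_carrier_mat[OF c1(1) frame_mat_carrier])
    have cs: "P0 * A g * P0 \<in> carrier_mat N N" "P0 * ?D ?\<beta> * P0 \<in> carrier_mat N N"
      by (rule mult_carrier_mat[OF PA(1) c1(1)], rule mult_carrier_mat[OF PA(2) c1(1)])
    have "P0 * E * P0 = P0 * A g * P0 - P0 * ?D ?\<beta> * P0"
      unfolding E_def
      by (simp only: mult_minus_distrib_mat[OF c1(1) A[OF g] frame_mat_carrier] minus_mult_distrib_mat[OF PA c1(1)])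
    moreover have "A g - (X + M) = (A g - (Y + M)) - (X - Y)"
      if "X \<in> carrier_mat N N" "Y \<in> carrier_mat N N" "M \<in> carrier_mat N N" for X Y M
      using that A[OF g] by (intro eq_matI) auto
    from this[OF cs c1(2)] have "A g - (P0 * A g * P0 + msum N (\<lambda>i. \<alpha> g i \<cdot>\<^sub>m P i) I)
       = E - (P0 * A g * P0 - P0 * ?D ?\<beta> * P0)" unfolding PB[symmetric] E_def .
    ultimately show ?thesis by simp
  qed
  moreover have "op_norm (E - P0 * E * P0) \<le> 2 * e"
  proof (rule op_norm_le[of _ N])
    show "E - P0 * E * P0 \<in> carrier_mat N N" 
      by (rule minus_carrier_mat[OF mult_carrier_mat[OF mult_carrier_mat[OF c1(1) E] c1(1)]])
    show "0 \<le> 2 * e" using e by simp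
    show "nrm N (mv N (entries (E - P0 * E * P0)) w) \<le> 2 * e * nrm N w" for w
      unfolding P0D by (rule nrm_mv_diff_conj_le[OF V e E Eb]) simp
  qed
  ultimately show "op_norm (A g - (P0 * A g * P0 + msum N (\<lambda>i. \<alpha> g i \<cdot>\<^sub>m P i) I)) \<le> 2 * e" by simp
qed

section \<open>Dimension drop algebras and the theorem\<close>

text \<open>
  At an end point, an element of \<^term>\<open>dim_drop_mats n k\<close> is a matrix of size \<open>n\<close> tensored with the
  identity of size \<open>k\<close>; conversely, a continuous matrix function with this property at both end points
  belongs to the algebra.
\<close>

lemma dim_drop_endpoint:
  assumes F: "F \<in> dim_drop_mats n k" and y: "y \<in> {0, 1}" and pq: "p < n * k" "q < n * k"
  shows "F y $$ (p, q) = (if p mod k = q mod k then F y $$ (p div k * k, q div k * k) else 0)"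
proof -
  have k: "0 < k" using pq by (cases k) auto
  have ij: "p div k < n" "q div k < n" using pq by (simp_all add: less_mult_imp_div_less)
  have "(\<lambda>t. mat_block k (p div k) (q div k) (F t)) \<in> dim_drop_alg k"
    using F ij by (simp add: dim_drop_mats_def)
  then obtain c where c: "mat_block k (p div k) (q div k) (F y) = c \<cdot>\<^sub>m 1\<^sub>m k"
    using y by (auto simp: dim_drop_alg_def)
  have entry: "F y $$ (p div k * k + r, q div k * k + s) = (if r = s then c else 0)" if "r < k" "s < k" for r s
  proof -
    have "F y $$ (p div k * k + r, q div k * k + s) = mat_block k (p div k) (q div k) (F y) $$ (r, s)"
      using that by (simp add: mat_block_def)
    then show ?thesis using c that by simp
  qed
  show ?thesis using entry[of "p mod k" "q mod k"] entry[of 0 0] k by simp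
qed

lemma dim_drop_matsI:
  assumes F: "F \<in> interval_mats (n * k)"
    and ends: "\<And>y. y \<in> {0, 1} \<Longrightarrow> \<exists>\<psi>. \<forall>r<n * k. \<forall>s<n * k.
      F y $$ (r, s) = (if r mod k = s mod k then \<psi> (r div k) (s div k) else 0)"
  shows "F \<in> dim_drop_mats n k"
  unfolding dim_drop_mats_def
proof (intro CollectI conjI allI impI F)
  fix i j assume ij: "i < n" "j < n"
  have cont: "(\<lambda>t. mat_block k i j (F t)) \<in> interval_mats k"
    unfolding interval_mats_def
  proof (intro CollectI conjI ballI allI impI)
    show "mat_block k i j (F t) \<in> carrier_mat k k" for t by (simp add: mat_block_def)
    fix r s assume rs: "r < k" "s < k"
    have "continuous_on {0..1} (\<lambda>t. F t $$ (i * k + r, j * k + s))"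
      using F block_index_less[OF ij(1) rs(1)] block_index_less[OF ij(2) rs(2)] by (simp add: interval_mats_def)
    then show "continuous_on {0..1} (\<lambda>t. mat_block k i j (F t) $$ (r, s))" using rs by (simp add: mat_block_def)
  qed
  have const: "\<exists>c. mat_block k i j (F y) = c \<cdot>\<^sub>m 1\<^sub>m k" if y: "y \<in> {0, 1}" for y
  proof -
    obtain \<psi> where \<psi>: "\<forall>r<n * k. \<forall>s<n * k. F y $$ (r, s) = (if r mod k = s mod k then \<psi> (r div k) (s div k) else 0)"
      using ends[OF y] by blast
    have "mat_block k i j (F y) = \<psi> i j \<cdot>\<^sub>m 1\<^sub>m k"
    proof (rule eq_matI)
      fix r s assume "r < dim_row (\<psi> i j \<cdot>\<^sub>m 1\<^sub>m k)" "s < dim_col (\<psi> i j \<cdot>\<^sub>m 1\<^sub>m k)"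
      then have rs: "r < k" "s < k" by auto
      have "F y $$ (i * k + r, j * k + s) = (if r = s then \<psi> i j else 0)"
        using \<psi>[rule_format, OF block_index_less[OF ij(1) rs(1)] block_index_less[OF ij(2) rs(2)]] rs by simp
      then show "mat_block k i j (F y) $$ (r, s) = (\<psi> i j \<cdot>\<^sub>m 1\<^sub>m k) $$ (r, s)" using rs by (simp add: mat_block_def)
    qed (simp_all add: mat_block_def)
    then show ?thesis by blast
  qed
  show "(\<lambda>t. mat_block k i j (F t)) \<in> dim_drop_alg k"
    unfolding dim_drop_alg_def using cont const by simp
qed

lemma sum_block_mult: "1 \<le> l1 \<Longrightarrow> (\<Sum>i\<in>{1..l1}. block_mult l1 l2 r i) = l1 * l2 + r"
proof -
  assume "1 \<le> l1"
  then have "{1..l1} = insert l1 {1..<l1}" by auto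
  moreover have "(\<Sum>i\<in>{1..<l1}. block_mult l1 l2 r i) = (\<Sum>i\<in>{1..<l1}. l2)" by (intro sum.cong) (auto simp: block_mult_def)
  ultimately show ?thesis using \<open>1 \<le> l1\<close> by (simp add: block_mult_def) (cases l1; simp)
qed

lemma hom_in_range: "unital_star_hom X N B \<phi> \<Longrightarrow> f \<in> cont_alg X \<Longrightarrow> \<phi> f \<in> B"
  by (simp add: unital_star_hom_def)

lemma hom_star:
  assumes "unital_star_hom X N B \<phi>" "f \<in> cont_alg X" "y \<in> {0..1}"
  shows "\<phi> (\<lambda>x. cnj (f x)) y = mat_adjoint (\<phi> f y)"
proof -
  have "\<forall>f\<in>cont_alg X. \<forall>y\<in>{0..1}. \<phi> (\<lambda>x. cnj (f x)) y = mat_adjoint (\<phi> f y)"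
    using assms(1) unfolding unital_star_hom_def by (elim conjE)
  then show ?thesis using assms(2,3) by blast
qed

lemma approximating_projections:
  fixes K :: "'a::euclidean_space set set"
  assumes kl: "1 \<le> k" "1 \<le> l1" "3 \<le> l2" and N: "N = (l1 * l2 + r) * k"
    and hom: "unital_star_hom (\<Union>K) N (dim_drop_mats (l1 * l2 + r) k) \<phi>"
    and maps: "\<forall>i\<in>{1..l1}. continuous_on {0..1} (a i) \<and> a i ` {0..1} \<subseteq> \<Union>K"
    and spectra: "\<forall>y\<in>{0..1}. \<exists>xs. is_spectrum (\<Union>K) N \<phi> y xs \<and> paired_within K \<eta> xs (Theta k l1 l2 r a y)"
    and G_prop: "finite \<G>" "\<G> \<subseteq> cont_alg (\<Union>K)" "\<forall>g\<in>\<G>. (\<lambda>x. cnj (g x)) \<in> \<G>"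
    and e: "0 < e"
    and uclose: "\<forall>g\<in>\<G>. \<forall>x\<in>\<Union>K. \<forall>x'\<in>\<Union>K. std_dist K x x' < ennreal \<eta> \<longrightarrow> cmod (g x - g x') < e"
  shows "\<exists>p p0.
      (\<forall>i\<in>{1..l1}. p i \<in> dim_drop_mats (l1 * l2 + r) k) \<and>
      (\<forall>i\<in>{1..l1}. \<forall>y\<in>{0..1}. projection_mat N (p i y)) \<and>
      (\<forall>i\<in>{1..l1}. \<forall>j\<in>{1..l1}. i \<noteq> j \<longrightarrow> (\<forall>y\<in>{0..1}. p i y * p j y = 0\<^sub>m N N)) \<and>
      (\<forall>y\<in>{0..1}. p0 y = 1\<^sub>m N - msum N (\<lambda>i. p i y) {1..l1}) \<and>
      (\<forall>g\<in>\<G>. \<forall>y\<in>{0..1}.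
         op_norm (\<phi> g y - (p0 y * \<phi> g y * p0 y + msum N (\<lambda>i. g (a i y) \<cdot>\<^sub>m p i y) {1..l1})) \<le> 10 * e) \<and>
      (\<forall>y\<in>{0..1}. (\<forall>i\<in>{1..l1}. vec_space.rank N (p i y) = (block_mult l1 l2 r i - 3) * k) \<and>
         vec_space.rank N (p0 y) = 3 * l1 * k)"
proof -
  let ?n = "l1 * l2 + r" and ?I = "{1..l1}" and ?X = "\<Union>K"
  let ?st = "\<lambda>(g :: 'a \<Rightarrow> complex) x. cnj (g x)"
  note a = bspec[OF maps] and spec = bspec[OF spectra]
  have close: "cmod (g x - g x') \<le> e"
    if "g \<in> \<G>" "x \<in> \<Union>K" "x' \<in> \<Union>K" "std_dist K x x' < ennreal \<eta>" for g x x'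
    using uclose that less_imp_le by blast
  have \<G>: "finite \<G>" "\<G> \<subseteq> cont_alg ?X" "\<And>g. g \<in> \<G> \<Longrightarrow> (\<lambda>x. cnj (g x)) \<in> \<G>"
    using G_prop by blast+
  define c0 where "c0 = (\<lambda>i. block_mult l1 l2 r i - 3)"
  let ?c = "\<lambda>i. c0 i * k" and ?L = "\<lambda>i. block_mult l1 l2 r i * k"
  let ?fam = "\<lambda>y. spectral_family N ?I \<G> ?st ?c ?L (\<lambda>g. entries (\<phi> g y)) (\<lambda>g i. g (a i y)) e"
  have k: "0 < k" using kl by simp
  have m3: "3 \<le> block_mult l1 l2 r i" for i using kl by (simp add: block_mult_def)
  have cL: "?c i < ?L i" for i using m3[of i] k by (simp add: c0_def)
  have range: "\<phi> f \<in> dim_drop_mats ?n k" if "f \<in> cont_alg ?X" for f by (rule hom_in_range[OF hom that])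
  have carr: "\<phi> f y \<in> carrier_mat N N" if "f \<in> cont_alg ?X" "y \<in> {0..1}" for f y
    using range[OF that(1)] that(2) by (auto simp: dim_drop_mats_def interval_mats_def N)
  have star: "entries (\<phi> (?st f) y) t s = cnj (entries (\<phi> f y) s t)"
    if "f \<in> cont_alg ?X" "y \<in> {0..1}" "t < N" "s < N" for f y t s
    using entries_adjoint[OF carr[OF that(1,2)] that(3,4)] hom_star[OF hom that(1,2)] by simp
  have labelled: "\<exists>xs V \<mu>. orthonormal N N V \<and>
     (\<forall>f\<in>cont_alg ?X. \<forall>j<N. \<forall>t<N. mv N (entries (\<phi> f y)) (V j) t = f (xs ! j) * V j t) \<and>
     labelling {..<N} ?I (\<lambda>j i. \<forall>g\<in>\<G>. cmod (g (xs ! j) - g (a i y)) \<le> e) ?L \<mu>" if y: "y \<in> {0..1}" for y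
  proof -
    obtain xs where xs: "is_spectrum ?X N \<phi> y xs" "paired_within K \<eta> xs (Theta k l1 l2 r a y)"
      using spec[OF y] by blast
    have sub: "set xs \<subseteq> ?X" using xs(1) by (simp add: is_spectrum_def)
    have aX: "a i y \<in> ?X" if "i \<in> ?I" for i using a[OF that] y by blast
    have "\<exists>\<mu>. labelling {..<N} ?I (\<lambda>j i. \<forall>g\<in>\<G>. cmod (g (xs ! j) - g (a i y)) \<le> e) ?L \<mu>"
      unfolding N by (rule labelling_of_pairing[OF xs(2) kl(2) sub]) (rule aX close; assumption)+
    then show ?thesis using spectrum_eigenframe[OF xs(1)] by blast
  qed
  have fam: "\<exists>p. ?fam y p" if y: "y \<in> {0..1}" for y
  proof -
    obtain xs V \<mu> where V: "orthonormal N N V"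
      and eig: "\<forall>f\<in>cont_alg ?X. \<forall>j<N. \<forall>t<N. mv N (entries (\<phi> f y)) (V j) t = f (xs ! j) * V j t"
      and lab: "labelling {..<N} ?I (\<lambda>j i. \<forall>g\<in>\<G>. cmod (g (xs ! j) - g (a i y)) \<le> e) ?L \<mu>"
      using labelled[OF y] by blast
    obtain Q where Q: "selection {..<N} ?I ?c \<mu> Q"
      using selection_exists[OF lab, of ?c] cL less_imp_le by blast
    have "?fam y (projs N ?I V Q)"
      unfolding spectral_family_def
      by (intro exI[of _ V] exI[of _ "\<lambda>g j. g (xs ! j)"] exI[of _ \<mu>] exI[of _ Q] conjI V lab Q refl)
        (use eig \<G>(2) in auto)
    then show ?thesis by blast
  qed
  have fam_end: "\<exists>p P. ?fam y p \<and>
      (\<forall>i\<in>?I. \<forall>t<N. \<forall>s<N. p i t s = (if t mod k = s mod k then P i (t div k) (s div k) else 0))"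
    if y: "y \<in> {0, 1}" for y
  proof -
    have y': "y \<in> {0..1}" using y by auto
    obtain xs V \<mu> where V: "orthonormal N N V"
      and eig: "\<forall>f\<in>cont_alg ?X. \<forall>j<N. \<forall>t<N. mv N (entries (\<phi> f y)) (V j) t = f (xs ! j) * V j t"
      and lab: "labelling {..<N} ?I (\<lambda>j i. \<forall>g\<in>\<G>. cmod (g (xs ! j) - g (a i y)) \<le> e) ?L \<mu>"
      using labelled[OF y'] by blast
    let ?lab0 = "\<lambda>b. labels 1 l1 l2 r ! b"
    have len: "length (labels 1 l1 l2 r) = ?n" using length_labels[OF kl(2), of 1 l2 r] by simp
    show ?thesis
    proof (rule ampliated_spectral_family[where n = ?n and k = k and l = "block_mult l1 l2 r" and ?c0.0 = c0 and X = ?X and V = V and pt = "\<lambda>j. xs ! j" and \<mu> = \<mu> and ?lab0.0 = ?lab0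
          and \<psi> = "\<lambda>f i j. \<phi> f y $$ (i * k, j * k)", folded N])
      show "entries (\<phi> f y) p q = (if p mod k = q mod k then \<phi> f y $$ (p div k * k, q div k * k) else 0)"
        if "f \<in> cont_alg ?X" "p < N" "q < N" for f p q
        unfolding entries_def by (rule dim_drop_endpoint[OF range[OF that(1)] y]) (use that N in simp_all)
      show "?lab0 b \<in> ?I" if "b < ?n" for b
      proof (rule set_labels[OF kl(2), THEN subsetD])
        show "?lab0 b \<in> set (labels 1 l1 l2 r)" using that len by (intro nth_mem) simp
      qed
      show "card {b \<in> {..<?n}. ?lab0 b = i} = block_mult l1 l2 r i" if "i \<in> ?I" for i
        using card_labels[OF that, of 1 l2 r] len by simp
      show "0 < block_mult l1 l2 r i" for i using m3[of i] by simp
      show "c0 i \<le> block_mult l1 l2 r i" for i by (simp add: c0_def)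
      show "mv N (entries (\<phi> f y)) (V j) t = f (xs ! j) * V j t" if "f \<in> cont_alg ?X" "j < N" "t < N" for f j t
        using eig that by blast
    qed (rule k V \<G>(2) lab finite_atLeastAtMost | rule star[OF _ y'], assumption+)+
  qed
  obtain pa Pa where pa: "?fam 0 pa"
    "\<forall>i\<in>?I. \<forall>t<N. \<forall>s<N. pa i t s = (if t mod k = s mod k then Pa i (t div k) (s div k) else 0)"
    using fam_end[of 0] by blast
  obtain pb Pb where pb: "?fam 1 pb"
    "\<forall>i\<in>?I. \<forall>t<N. \<forall>s<N. pb i t s = (if t mod k = s mod k then Pb i (t div k) (s div k) else 0)"
    using fam_end[of 1] by blast
  have "\<exists>q. continuous_on {0..1} q \<and> q 0 = pa \<and> q 1 = pb \<and>
     (\<forall>y\<in>{0..1}. approx_family N ?I \<G> ?c (\<lambda>g. entries (\<phi> g y)) (\<lambda>g i. g (a i y)) (5 * e) (q y))"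
  proof (rule spectral_families_joined[where D = "\<lambda>g y. entries (\<phi> g y)" and \<alpha> = "\<lambda>g i y. g (a i y)" and st = ?st and L = ?L])
    show "continuous_on {0..1} (\<lambda>y. entries (\<phi> g y) t s)" if "g \<in> \<G>" "t < N" "s < N" for g t s
      using range[of g] that \<G>(2) by (auto simp: dim_drop_mats_def interval_mats_def N entries_def)
    show "continuous_on {0..1} (\<lambda>y. g (a i y))" if "g \<in> \<G>" "i \<in> ?I" for g i
      using \<G>(2) that a[OF that(2)] by (intro continuous_on_compose2[of ?X g _ "a i"]) (auto simp: cont_alg_def)
    show "entries (\<phi> (?st g) y) t s = cnj (entries (\<phi> g y) s t)" if "g \<in> \<G>" "y \<in> {0..1}" "t < N" "s < N" for g y t s
      using star \<G>(2) that by blast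
    show "\<exists>p. ?fam y p" if "y \<in> {0..1}" for y by (rule fam[OF that])
  qed (rule \<G>(1) finite_atLeastAtMost e cL pa(1) pb(1) | erule \<G>(3))+
  then obtain q where q: "continuous_on {0..1} q" "q 0 = pa" "q 1 = pb"
    and good: "\<And>y. y \<in> {0..1} \<Longrightarrow> approx_family N ?I \<G> ?c (\<lambda>g. entries (\<phi> g y)) (\<lambda>g i. g (a i y)) (5 * e) (q y)"
    by blast
  define p where "p = (\<lambda>i y. Matrix.mat N N (\<lambda>(t, s). q y i t s))"
  define p0 where "p0 = (\<lambda>y. 1\<^sub>m N - msum N (\<lambda>i. p i y) ?I)"
  have e5: "0 \<le> 5 * e" using e by simp
  have drop: "p i \<in> dim_drop_mats ?n k" if i: "i \<in> ?I" for i
  proof (rule dim_drop_matsI)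
    have "continuous_on {0..1} (\<lambda>y. q y i t s)" for t s
      using continuous_on_product_then_coordinatewise[OF continuous_on_product_then_coordinatewise[OF continuous_on_product_then_coordinatewise[OF q(1)]]] .
    then show "p i \<in> interval_mats (?n * k)"
      unfolding interval_mats_def N[symmetric] by (auto simp: p_def)
    show "\<exists>\<psi>. \<forall>t<?n * k. \<forall>s<?n * k. p i y $$ (t, s) = (if t mod k = s mod k then \<psi> (t div k) (s div k) else 0)"
      if y: "y \<in> {0, 1}" for y
    proof (cases "y = 0")
      case True
      then show ?thesis unfolding N[symmetric] using pa(2) i q(2) by (intro exI[of _ "Pa i"]) (simp add: p_def)
    next
      case False
      then have "y = 1" using y by simp
      then show ?thesis unfolding N[symmetric] using pb(2) i q(3) by (intro exI[of _ "Pb i"]) (simp add: p_def)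
    qed
  qed
  have total: "N - (\<Sum>i\<in>?I. ?c i) = 3 * l1 * k"
  proof -
    have "(\<Sum>i\<in>?I. c0 i) + 3 * l1 = (\<Sum>i\<in>?I. c0 i + 3)" by (simp add: sum.distrib)
    also have "\<dots> = (\<Sum>i\<in>?I. block_mult l1 l2 r i)" using m3 by (intro sum.cong refl) (simp add: c0_def)
    finally have "N = ((\<Sum>i\<in>?I. c0 i) + 3 * l1) * k" using sum_block_mult[OF kl(2)] N by simp
    moreover have "(\<Sum>i\<in>?I. ?c i) = (\<Sum>i\<in>?I. c0 i) * k" by (rule sum_distrib_right[symmetric])
    ultimately show ?thesis by (simp only: add_mult_distrib diff_add_inverse)
  qed
  have carr\<G>: "\<phi> g y \<in> carrier_mat N N" if "y \<in> {0..1}" "g \<in> \<G>" for g y 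
    by (rule carr[OF subsetD[OF \<G>(2) that(2)] that(1)])
  show ?thesis
  proof (intro exI[of _ p] exI[of _ p0] conjI ballI impI)
    fix y :: real assume y: "y \<in> {0..1}"
    have A: "\<forall>g\<in>\<G>. \<phi> g y \<in> carrier_mat N N" using carr\<G>[OF y] by blast
    have P: "\<forall>i. p i y = Matrix.mat N N (\<lambda>(t, s). q y i t s)" by (simp add: p_def)
    have P0: "p0 y = 1\<^sub>m N - msum N (\<lambda>i. p i y) ?I" by (simp add: p0_def)
    note gp = approx_family_projections[OF good[OF y] finite_atLeastAtMost e5 A P P0]
    show "p0 y = 1\<^sub>m N - msum N (\<lambda>i. p i y) ?I" by (rule P0)
    show "vec_space.rank N (p0 y) = 3 * l1 * k" using gp(4) total by simp
    show "vec_space.rank N (p i y) = (block_mult l1 l2 r i - 3) * k" if "i \<in> ?I" for i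
      using gp(3)[OF that] by (simp add: c0_def)
    show "projection_mat N (p i y)" if "i \<in> ?I" for i by (rule gp(1)[OF that])
    show "p i y * p j y = 0\<^sub>m N N" if "i \<in> ?I" "j \<in> ?I" "i \<noteq> j" for i j by (rule gp(2)[OF that])
    show "op_norm (\<phi> g y - (p0 y * \<phi> g y * p0 y + msum N (\<lambda>i. g (a i y) \<cdot>\<^sub>m p i y) ?I)) \<le> 10 * e"
      if "g \<in> \<G>" for g using gp(5)[OF that] by simp
  qed (rule drop)
qed

lemma finite_family_close:
  fixes G :: "('a::euclidean_space \<Rightarrow> complex) set"
  assumes K: "simplicial_complex K" and "finite G" and "G \<subseteq> cont_alg (\<Union>K)" and e: "0 < e"
  shows "\<exists>\<eta>>0. \<forall>g\<in>G. \<forall>x\<in>\<Union>K. \<forall>x'\<in>\<Union>K. std_dist K x x' < ennreal \<eta> \<longrightarrow> cmod (g x - g x') < e"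
  using assms(2,3)
proof (induction G rule: finite_induct)
  case empty
  then show ?case by (intro exI[of _ 1]) simp
next
  case (insert g G)
  obtain \<eta>1 where \<eta>1: "0 < \<eta>1" "\<forall>h\<in>G. \<forall>x\<in>\<Union>K. \<forall>x'\<in>\<Union>K. std_dist K x x' < ennreal \<eta>1 \<longrightarrow> cmod (h x - h x') < e"
    using insert by auto
  obtain \<eta>2 where \<eta>2: "0 < \<eta>2" "\<forall>x\<in>\<Union>K. \<forall>x'\<in>\<Union>K. std_dist K x x' < ennreal \<eta>2 \<longrightarrow> cmod (g x - g x') < e"
    using std_dist_small_imp_close[OF K _ e, of g] insert.prems by (auto simp: cont_alg_def)
  have le: "d < ennreal \<eta>1" "d < ennreal \<eta>2" if "d < ennreal (min \<eta>1 \<eta>2)" for d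
    using that by (meson ennreal_leI min.cobounded1 min.cobounded2 less_le_trans)+
  show ?case using \<eta>1 \<eta>2 le by (intro exI[of _ "min \<eta>1 \<eta>2"]) auto
qed

theorem theorem4p7:
  fixes K :: "'a::euclidean_space set set"
    and G :: "('a \<Rightarrow> complex) set"
    and \<epsilon> :: real
  assumes "simplicial_complex K"
    and "\<forall>S\<in>K. aff_dim S \<le> 2"
    and "connected (\<Union>K)"
    and "finite G"
    and "generates_cont_alg (\<Union>K) G"
    and "\<epsilon> > 0"
  shows "\<exists>\<eta>>0. \<forall>(k::nat) (l1::nat) (l2::nat) (r::nat)
      (\<phi> :: ('a \<Rightarrow> complex) \<Rightarrow> real \<Rightarrow> complex Matrix.mat) (a :: nat \<Rightarrow> real \<Rightarrow> 'a) N.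
    1 \<le> k \<and> 1 \<le> l1 \<and> 3 \<le> l2 \<and> N = (l1 * l2 + r) * k \<and>
    unital_star_hom (\<Union>K) N (dim_drop_mats (l1 * l2 + r) k) \<phi> \<and>
    (\<forall>i\<in>{1..l1}. continuous_on {0..1} (a i) \<and> a i ` {0..1} \<subseteq> \<Union>K) \<and>
    (\<forall>y\<in>{0..1}. \<exists>xs. is_spectrum (\<Union>K) N \<phi> y xs \<and>
       paired_within K \<eta> xs (Theta k l1 l2 r a y))
    \<longrightarrow>
    (\<exists>(p :: nat \<Rightarrow> real \<Rightarrow> complex Matrix.mat) (p0 :: real \<Rightarrow> complex Matrix.mat).
      (\<forall>i\<in>{1..l1}. p i \<in> dim_drop_mats (l1 * l2 + r) k) \<and>
      (\<forall>i\<in>{1..l1}. \<forall>y\<in>{0..1}. projection_mat N (p i y)) \<and>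
      (\<forall>i\<in>{1..l1}. \<forall>j\<in>{1..l1}. i \<noteq> j \<longrightarrow> (\<forall>y\<in>{0..1}. p i y * p j y = 0\<^sub>m N N)) \<and>
      (\<forall>y\<in>{0..1}. p0 y = 1\<^sub>m N - msum N (\<lambda>i. p i y) {1..l1}) \<and>
      (\<forall>g\<in>G. \<forall>y\<in>{0..1}.
         op_norm (\<phi> g y -
           (p0 y * \<phi> g y * p0 y + msum N (\<lambda>i. g (a i y) \<cdot>\<^sub>m p i y) {1..l1})) < \<epsilon>) \<and>
      (\<forall>y\<in>{0..1}.
         (\<forall>i\<in>{1..<l1}. vec_space.rank N (p i y) = (l2 - 3) * k) \<and>
         vec_space.rank N (p l1 y) = (l2 + r - 3) * k \<and>
         vec_space.rank N (p0 y) = 3 * l1 * k))"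
proof -
  let ?X = "\<Union>K"
  \<comment> \<open>the final error is at most \<open>2 * (5 * e)\<close>\<close>
  define e where "e = \<epsilon> / 11"
  have e: "0 < e" "10 * e < \<epsilon>" using assms(6) by (simp_all add: e_def)
  have GX: "G \<subseteq> cont_alg ?X" using assms(5) by (simp add: generates_cont_alg_def)
  define \<G> where "\<G> = G \<union> (\<lambda>g x. cnj (g x)) ` G"
  have \<G>: "finite \<G>" "\<G> \<subseteq> cont_alg ?X" "\<forall>g\<in>\<G>. (\<lambda>x. cnj (g x)) \<in> \<G>" "G \<subseteq> \<G>"
    using assms(4) GX by (auto simp: \<G>_def cont_alg_def intro: continuous_on_cnj)
  obtain \<eta> where \<eta>: "0 < \<eta>"
    "\<forall>g\<in>\<G>. \<forall>x\<in>?X. \<forall>x'\<in>?X. std_dist K x x' < ennreal \<eta> \<longrightarrow> cmod (g x - g x') < e"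
    using finite_family_close[OF assms(1) \<G>(1,2) e(1)] by blast
  show ?thesis
  proof (intro exI[of _ \<eta>] conjI \<eta>(1) allI impI, elim conjE)
    fix k l1 l2 r :: nat and \<phi> :: "('a \<Rightarrow> complex) \<Rightarrow> real \<Rightarrow> complex Matrix.mat"
      and a :: "nat \<Rightarrow> real \<Rightarrow> 'a" and N
    assume h: "1 \<le> k" "1 \<le> l1" "3 \<le> l2" "N = (l1 * l2 + r) * k"
      "unital_star_hom ?X N (dim_drop_mats (l1 * l2 + r) k) \<phi>"
      and a: "\<forall>i\<in>{1..l1}. continuous_on {0..1} (a i) \<and> a i ` {0..1} \<subseteq> ?X"
      and spec: "\<forall>y\<in>{0..1}. \<exists>xs. is_spectrum ?X N \<phi> y xs \<and> paired_within K \<eta> xs (Theta k l1 l2 r a y)"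
    obtain p p0 where
      p: "\<forall>i\<in>{1..l1}. p i \<in> dim_drop_mats (l1 * l2 + r) k"
        "\<forall>i\<in>{1..l1}. \<forall>y\<in>{0..1}. projection_mat N (p i y)"
        "\<forall>i\<in>{1..l1}. \<forall>j\<in>{1..l1}. i \<noteq> j \<longrightarrow> (\<forall>y\<in>{0..1}. p i y * p j y = 0\<^sub>m N N)"
        "\<forall>y\<in>{0..1}. p0 y = 1\<^sub>m N - msum N (\<lambda>i. p i y) {1..l1}"
      and norm: "\<forall>g\<in>\<G>. \<forall>y\<in>{0..1}. op_norm (\<phi> g y -
           (p0 y * \<phi> g y * p0 y + msum N (\<lambda>i. g (a i y) \<cdot>\<^sub>m p i y) {1..l1})) \<le> 10 * e"
      and rank: "\<forall>y\<in>{0..1}. (\<forall>i\<in>{1..l1}. vec_space.rank N (p i y) = (block_mult l1 l2 r i - 3) * k) \<and>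
         vec_space.rank N (p0 y) = 3 * l1 * k"
      using approximating_projections[OF h a spec \<G>(1-3) e(1) \<eta>(2)]
      by (elim exE conjE) (rule that)
    have "\<forall>g\<in>G. \<forall>y\<in>{0..1}. op_norm (\<phi> g y -
           (p0 y * \<phi> g y * p0 y + msum N (\<lambda>i. g (a i y) \<cdot>\<^sub>m p i y) {1..l1})) < \<epsilon>"
      using norm \<G>(4) e(2) by (meson le_less_trans subsetD)
    moreover have "\<forall>y\<in>{0..1}. (\<forall>i\<in>{1..<l1}. vec_space.rank N (p i y) = (l2 - 3) * k) \<and>
         vec_space.rank N (p l1 y) = (l2 + r - 3) * k \<and> vec_space.rank N (p0 y) = 3 * l1 * k"
      using rank h(2) by (auto simp: block_mult_def)
    ultimately show "\<exists>p p0. (\<forall>i\<in>{1..l1}. p i \<in> dim_drop_mats (l1 * l2 + r) k) \<and>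
      (\<forall>i\<in>{1..l1}. \<forall>y\<in>{0..1}. projection_mat N (p i y)) \<and>
      (\<forall>i\<in>{1..l1}. \<forall>j\<in>{1..l1}. i \<noteq> j \<longrightarrow> (\<forall>y\<in>{0..1}. p i y * p j y = 0\<^sub>m N N)) \<and>
      (\<forall>y\<in>{0..1}. p0 y = 1\<^sub>m N - msum N (\<lambda>i. p i y) {1..l1}) \<and>
      (\<forall>g\<in>G. \<forall>y\<in>{0..1}.
         op_norm (\<phi> g y -
           (p0 y * \<phi> g y * p0 y + msum N (\<lambda>i. g (a i y) \<cdot>\<^sub>m p i y) {1..l1})) < \<epsilon>) \<and>
      (\<forall>y\<in>{0..1}.
         (\<forall>i\<in>{1..<l1}. vec_space.rank N (p i y) = (l2 - 3) * k) \<and>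
         vec_space.rank N (p l1 y) = (l2 + r - 3) * k \<and>
         vec_space.rank N (p0 y) = 3 * l1 * k)"
      using p by (intro exI[of _ p] exI[of _ p0] conjI)
  qed
qed

end
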